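(* Let $\mathbf P$ be an irreducible $s\times s$ stochastic matrix, $\mathbf a$ a known initial law (row vector), $1\le r\le s-1$, $U=\{1,\ldots,r\}$, $D=\{r+1,\ldots,s\}$, and use the notation of the context. Let $\mathbf N_U=(\mathbf I_r-\mathbf P_{UU})^{-1}$ and $\mathbf N_D=(\mathbf I_{s-r}-\mathbf P_{DD})^{-1}$, and let $$\operatorname{MTTF}=\mathbf a_U\mathbf N_U\mathbf 1_r,\qquad \operatorname{MTTR}=\mathbf a_D\mathbf N_D\mathbf 1_{s-r},$$ with plug-in estimators $\widehat{\operatorname{MTTF}}(n)$, $\widehat{\operatorname{MTTR}}(n)$. Then $$\sqrt n\{\widehat{\operatorname{MTTF}}(n)-\operatorname{MTTF}\}\xrightarrow{d}\mathbf a_U\mathbf N_U\mathbf W_{UU}\mathbf N_U\mathbf 1_r,$$ with variance $$\sigma^2_{\operatorname{MTTF}}=\mathbf L_U\mathbf\Sigma_{\mathbf p_{UU}}\mathbf L_U^\top,\qquad \mathbf L_U=\mathbf a_U\mathbf N_U\otimes\mathbf 1_r^\top\mathbf N_U^\top.$$ Similarly, $$\sqrt n\{\widehat{\operatorname{MTTR}}(n)-\operatorname{MTTR}\}\xrightarrow{d}\mathbf a_D\mathbf N_D\mathbf W_{DD}\mathbf N_D\mathbf 1_{s-r},$$ with variance $$\sigma^2_{\operatorname{MTTR}}=\mathbf L_D\mathbf\Sigma_{\mathbf p_{DD}}\mathbf L_D^\top,\qquad \mathbf L_D=\mathbf a_D\mathbf N_D\otimes\mathbf 1_{s-r}^\top\mathbf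 N_D^\top.$$
   Context: $(X_m)_{m\ge0}$ is a time-homogeneous Markov chain on $\{1,\ldots,s\}$ with irreducible transition matrix $\mathbf P=(p_{ij})$, initial law $\mathbf a$ and stationary row vector $\boldsymbol\pi=(\pi_1,\ldots,\pi_s)$, observed along a single trajectory $X_0,\ldots,X_n$. $N_{ij}(n)$ is the number of transitions from $i$ to $j$ up to time $n$, $N_i(n)=\sum_jN_{ij}(n)$, and $\widehat{\mathbf P}(n)$ has entries $N_{ij}(n)/N_i(n)$ (and $0$ if $N_i(n)=0$). Limits are as $n\to\infty$; $\xrightarrow{d}$ is convergence in distribution. Plug-in estimators are obtained by replacing $\mathbf P$ by $\widehat{\mathbf P}(n)$ and may be defined arbitrarily when the defining inverse does not exist. $\mathbf W=(W_{ij})$ is the centered Gaussian random $s\times s$ matrix with $\operatorname{Cov}(W_{ij},W_{kl})=\delta_{ik}\pi_i^{-1}p_{ij}(\delta_{jl}-p_{il})$. For $B\in\{U,D\}$, $\mathbf P_{BB}$ and $\mathbf W_{BB}$ are the submatrices with rows and columns in $B$, $\mathbf a_B$ is the restriction of $\mathbf a$ to $B$, and $\mathbf\Sigma_{\mathbf p_{BB}}=\operatorname{Cov}(\operatorname{vec}(\mathbf W_{BB}^\top))$, where $\operatorname{vec}$ stacks columns. $\otimes$ is the Kronecker product (in $\mathbf L_U$, $\mathbf L_D$ it is taken between the row vectors $\mathbf a_B\mathbf N_B$ and $(\mathbf N_B\mathbf 1)^\top$), and $\mathbf 1_d$ is the all-ones column vector of length $d$. MTTF and MTTR are the mean hitting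 times $\mathbb E(T_D)$, $T_D=\inf\{n\ge0:X_n\in D\}$, and $\mathbb E(T_U)$, $T_U=\inf\{n\ge0:X_n\in U\}$; irreducibility with $U,D$ nonempty ensures that $\mathbf P_{UU}$ and $\mathbf P_{DD}$ have spectral radius less than one. *)

theory Defs
  imports
    "HOL-Probability.Probability"
    "Jordan_Normal_Form.Gauss_Jordan_Elimination"
    "Jordan_Normal_Form.DL_Submatrix"
begin

(* The state space {1,...,s} is rendered as {0..<s}, matching the indexing of real mat.
   Row and column vectors are matrices with one row and one column respectively, and a scalar
   obtained as a product of matrices is read off at position (0,0). *)

section \<open>Matrices\<close>

definition ones :: "nat \<Rightarrow> real mat" where
  "ones d = mat d 1 (\<lambda>_. 1)"

definition kronecker :: "real mat \<Rightarrow> real mat \<Rightarrow> real mat" where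
  "kronecker A B = mat (dim_row A * dim_row B) (dim_col A * dim_col B)
     (\<lambda>(i, j). A $$ (i div dim_row B, j div dim_col B) * B $$ (i mod dim_row B, j mod dim_col B))"

definition vec_cols :: "real mat \<Rightarrow> real mat" where
  "vec_cols A = mat (dim_row A * dim_col A) 1 (\<lambda>(k, _). A $$ (k mod dim_row A, k div dim_row A))"

definition probability_row :: "nat \<Rightarrow> real mat \<Rightarrow> bool" where
  "probability_row s a \<longleftrightarrow>
     a \<in> carrier_mat 1 s \<and> (\<forall>i<s. 0 \<le> a $$ (0, i)) \<and> (\<Sum>i<s. a $$ (0, i)) = 1"

definition stochastic_mat :: "nat \<Rightarrow> real mat \<Rightarrow> bool" where
  "stochastic_mat s P \<longleftrightarrow>
     P \<in> carrier_mat s s \<and> (\<forall>i<s. \<forall>j<s. 0 \<le> P $$ (i, j)) \<and> (\<forall>i<s. (\<Sum>j<s. P $$ (i, j)) = 1)"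

definition irreducible_mat :: "nat \<Rightarrow> real mat \<Rightarrow> bool" where
  "irreducible_mat s P \<longleftrightarrow> (\<forall>i<s. \<forall>j<s. \<exists>m. (P ^\<^sub>m m) $$ (i, j) > 0)"

definition stationary_row :: "nat \<Rightarrow> real mat \<Rightarrow> real mat \<Rightarrow> bool" where
  "stationary_row s P \<pi> \<longleftrightarrow> probability_row s \<pi> \<and> \<pi> * P = \<pi>"

text \<open>
  The matrix \<open>(I - P\<^sub>B\<^sub>B)\<^sup>-\<^sup>1\<close>. It is unspecified when \<open>I - P\<^sub>B\<^sub>B\<close> is singular.
\<close>

definition fundamental_mat :: "real mat \<Rightarrow> nat set \<Rightarrow> real mat" where
  "fundamental_mat P B = the (mat_inverse (1\<^sub>m (card B) - submatrix P B B))"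

text \<open>
  \<open>a\<^sub>B N\<^sub>B 1\<close>: this is MTTF for \<open>B = U\<close> and MTTR for \<open>B = D\<close>.
\<close>

definition mean_time :: "real mat \<Rightarrow> nat set \<Rightarrow> real mat \<Rightarrow> real" where
  "mean_time a B P = (submatrix a UNIV B * fundamental_mat P B * ones (card B)) $$ (0, 0)"

section \<open>The chain and its empirical transition matrix\<close>

definition markov_chain ::
  "'w measure \<Rightarrow> nat \<Rightarrow> real mat \<Rightarrow> real mat \<Rightarrow> (nat \<Rightarrow> 'w \<Rightarrow> nat) \<Rightarrow> bool" where
  "markov_chain M s a P X \<longleftrightarrow>
     (\<forall>n. X n \<in> measurable M (count_space {0..<s})) \<and>
     (\<forall>i<s. \<P>(\<omega> in M. X 0 \<omega> = i) = a $$ (0, i)) \<and>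
     (\<forall>n x. \<forall>j<s. \<P>(\<omega> in M. \<forall>k\<le>n. X k \<omega> = x k) > 0 \<longrightarrow>
        \<P>(\<omega> in M. X (Suc n) \<omega> = j \<bar> \<forall>k\<le>n. X k \<omega> = x k) = P $$ (x n, j))"

definition transition_count :: "(nat \<Rightarrow> 'w \<Rightarrow> nat) \<Rightarrow> nat \<Rightarrow> 'w \<Rightarrow> nat \<Rightarrow> nat \<Rightarrow> nat" where
  "transition_count X n \<omega> i j = card {m. m < n \<and> X m \<omega> = i \<and> X (Suc m) \<omega> = j}"

definition visit_count :: "nat \<Rightarrow> (nat \<Rightarrow> 'w \<Rightarrow> nat) \<Rightarrow> nat \<Rightarrow> 'w \<Rightarrow> nat \<Rightarrow> nat" where
  "visit_count s X n \<omega> i = (\<Sum>j<s. transition_count X n \<omega> i j)"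

definition empirical_mat :: "nat \<Rightarrow> (nat \<Rightarrow> 'w \<Rightarrow> nat) \<Rightarrow> nat \<Rightarrow> 'w \<Rightarrow> real mat" where
  "empirical_mat s X n \<omega> = mat s s (\<lambda>(i, j).
     if visit_count s X n \<omega> i = 0 then 0
     else real (transition_count X n \<omega> i j) / real (visit_count s X n \<omega> i))"

text \<open>
  A plug-in estimator of \<open>mean_time a B P\<close> is any sequence of random variables that agrees with
  the formula evaluated at the empirical matrix wherever the inverse in it exists; elsewhere its
  value is left open.
\<close>

definition plug_in_estimator ::
  "'w measure \<Rightarrow> nat \<Rightarrow> (nat \<Rightarrow> 'w \<Rightarrow> nat) \<Rightarrow> real mat \<Rightarrow> nat set \<Rightarrow> (nat \<Rightarrow> 'w \<Rightarrow> real) \<Rightarrow> bool" where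
  "plug_in_estimator M s X a B est \<longleftrightarrow>
     (\<forall>n. est n \<in> borel_measurable M) \<and>
     (\<forall>n. \<forall>\<omega>\<in>space M. invertible_mat (1\<^sub>m (card B) - submatrix (empirical_mat s X n \<omega>) B B) \<longrightarrow>
        est n \<omega> = mean_time a B (empirical_mat s X n \<omega>))"

section \<open>Gaussian random matrices\<close>

definition covariance :: "'v measure \<Rightarrow> ('v \<Rightarrow> real) \<Rightarrow> ('v \<Rightarrow> real) \<Rightarrow> real" where
  "covariance M Y Z =
     (LINT \<omega>|M. (Y \<omega> - (LINT \<eta>|M. Y \<eta>)) * (Z \<omega> - (LINT \<eta>|M. Z \<eta>)))"

definition covariance_mat :: "'v measure \<Rightarrow> nat \<Rightarrow> ('v \<Rightarrow> real mat) \<Rightarrow> real mat" where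
  "covariance_mat M d V =
     mat d d (\<lambda>(k, l). covariance M (\<lambda>\<omega>. V \<omega> $$ (k, 0)) (\<lambda>\<omega>. V \<omega> $$ (l, 0)))"

text \<open>
  Point masses count as normal laws (\<open>\<sigma> = 0\<close>), since the covariances below are singular.
\<close>

definition normal_law :: "real \<Rightarrow> real \<Rightarrow> real measure" where
  "normal_law \<mu> \<sigma> = (if \<sigma> = 0 then return borel \<mu> else density lborel (normal_density \<mu> \<sigma>))"

definition gaussian_random_mat :: "'v measure \<Rightarrow> nat \<Rightarrow> ('v \<Rightarrow> real mat) \<Rightarrow> bool" where
  "gaussian_random_mat M s W \<longleftrightarrow>
     (\<forall>\<omega>\<in>space M. W \<omega> \<in> carrier_mat s s) \<and>
     (\<forall>i<s. \<forall>j<s. (\<lambda>\<omega>. W \<omega> $$ (i, j)) \<in> borel_measurable M) \<and>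
     (\<forall>c :: nat \<Rightarrow> nat \<Rightarrow> real. \<exists>\<mu> \<sigma>. \<sigma> \<ge> 0 \<and>
        distr M borel (\<lambda>\<omega>. \<Sum>i<s. \<Sum>j<s. c i j * W \<omega> $$ (i, j)) = normal_law \<mu> \<sigma>)"

definition limit_mat ::
  "'v measure \<Rightarrow> nat \<Rightarrow> real mat \<Rightarrow> real mat \<Rightarrow> ('v \<Rightarrow> real mat) \<Rightarrow> bool" where
  "limit_mat M s P \<pi> W \<longleftrightarrow>
     gaussian_random_mat M s W \<and>
     (\<forall>i<s. \<forall>j<s. (LINT \<omega>|M. W \<omega> $$ (i, j)) = 0) \<and>
     (\<forall>i<s. \<forall>j<s. \<forall>k<s. \<forall>l<s.
        covariance M (\<lambda>\<omega>. W \<omega> $$ (i, j)) (\<lambda>\<omega>. W \<omega> $$ (k, l)) =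
          (if i = k then inverse (\<pi> $$ (0, i)) * P $$ (i, j) * ((if j = l then 1 else 0) - P $$ (i, l))
           else 0))"

text \<open>
  Covariance of the column-stacked transpose of \<open>W\<^sub>B\<^sub>B\<close>, i.e. the entries of \<open>W\<^sub>B\<^sub>B\<close> are listed row by
  row.
\<close>

definition sigma_mat :: "'v measure \<Rightarrow> ('v \<Rightarrow> real mat) \<Rightarrow> nat set \<Rightarrow> real mat" where
  "sigma_mat M W B =
     covariance_mat M (card B * card B) (\<lambda>\<omega>. vec_cols (transpose_mat (submatrix (W \<omega>) B B)))"

end

theory Submission
  imports Defs "Jordan_Normal_Form.Determinant" "HOL-Real_Asymp.Real_Asymp"
begin

text \<open>
  Both parts of the theorem are instances, for \<open>B = U\<close> and \<open>B = D\<close>, of statements about an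
  arbitrary proper subset \<open>B\<close> of the state space: \<open>plug_in_clt\<close> for the limit law and
  \<open>sandwich_variance\<close> for its variance.

  \<^emph>\<open>Linearization.\<close> Let \<open>x = N\<^sub>B 1\<close>, and for another matrix \<open>P'\<close> let \<open>x' = N'\<^sub>B 1\<close> and
  \<open>\<Delta> = (P' - P)\<^sub>B\<^sub>B\<close>. The resolvent identity gives \<open>a\<^sub>B x' - a\<^sub>B x = a\<^sub>B N\<^sub>B \<Delta> x'\<close> and
  \<open>x' - x = N\<^sub>B \<Delta> x'\<close> exactly, so the mean time differs from its linear part \<open>a\<^sub>B N\<^sub>B \<Delta> N\<^sub>B 1\<close> by a
  quantity of second order in \<open>\<Delta>\<close> (\<open>mean_time_perturbation\<close>). For the empirical matrix, \<open>\<Delta>\<close> has the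
  entries \<open>(N\<^sub>i\<^sub>j - p\<^sub>i\<^sub>j N\<^sub>i) / N\<^sub>i\<close>. The numerators are sums of bounded martingale increments, and
  replacing the denominator \<open>N\<^sub>i\<close> by \<open>n \<pi>\<^sub>i\<close> is again an error of second order. Hence the estimation
  error is \<open>S\<^sub>n / n\<close> plus a remainder, where \<open>S\<^sub>n\<close> is a martingale that sums one function of
  \<open>(X\<^sub>m, X\<^sub>m\<^sub>+\<^sub>1)\<close>.

  \<^emph>\<open>The remainder.\<close> It is at most a constant times the sum of the squares of \<open>N\<^sub>i / n - \<pi>\<^sub>i\<close> and
  \<open>(N\<^sub>i\<^sub>j - p\<^sub>i\<^sub>j N\<^sub>i) / n\<close>, as long as this sum, the \<open>fluctuation\<close>, is small. The expectation of the
  fluctuation is \<open>O(1 / n)\<close>: for the second kind of term because martingale increments are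
  orthogonal, for the first because Poisson's equation turns \<open>N\<^sub>i - n \<pi>\<^sub>i\<close> into a martingale plus a
  bounded term. So the remainder, multiplied by \<open>sqrt n\<close>, does not change the limit of the
  characteristic functions (\<open>characteristic_approximation\<close>). Irreducibility makes Poisson's
  equation solvable for periodic chains too.

  \<^emph>\<open>The central limit theorem for \<open>S\<^sub>n\<close>.\<close> Let \<open>g i\<close> be the conditional variance of an increment
  that starts in state \<open>i\<close>. Each of the \<open>n\<close> steps contributes to the expectation of
  \<open>exp (i t S\<^sub>n / sqrt n + t\<^sup>2 / (2 n) * (g (X\<^sub>0) + \<dots> + g (X\<^sub>n\<^sub>-\<^sub>1)))\<close> a change of \<open>O(n\<^sup>-\<^sup>3\<^sup>/\<^sup>2)\<close>, so this
  expectation tends to 1; and the averages of \<open>g\<close> along the path converge to the stationary mean of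
  \<open>g\<close> by the same second moment bound (\<open>martingale_clt\<close>). That mean is the variance of the Gaussian
  functional \<open>a\<^sub>B N\<^sub>B W\<^sub>B\<^sub>B N\<^sub>B 1\<close> (\<open>limit_mat_functional\<close>), and Levy's continuity theorem concludes.
\<close>

section \<open>Inverses of real matrices\<close>

lemma mult_mat_entry:
  assumes "A \<in> carrier_mat n m" "B \<in> carrier_mat m k" "i < n" "j < k"
  shows "(A * B) $$ (i, j) = (\<Sum>l<m. A $$ (i, l) * B $$ (l, j))"
  using assms by (simp add: scalar_prod_def atLeast0LessThan)

lemma invertible_mat_if_injective:
  fixes A :: "real mat"
  assumes A: "A \<in> carrier_mat n n"
    and inj: "\<And>x. (\<And>i. i < n \<Longrightarrow> (\<Sum>j<n. A $$ (i, j) * x j) = 0) \<Longrightarrow> (\<forall>i<n. x i = 0)"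
  shows "invertible_mat A"
proof -
  have "Determinant.det A \<noteq> 0"
  proof
    assume "Determinant.det A = 0"
    then obtain v where v: "v \<in> carrier_vec n" "v \<noteq> 0\<^sub>v n" "A *\<^sub>v v = 0\<^sub>v n"
      using det_0_iff_vec_prod_zero[OF A] by auto
    have "(\<Sum>j<n. A $$ (i, j) * vec_index v j) = 0" if "i < n" for i
    proof -
      have "vec_index (A *\<^sub>v v) i = 0" using v(3) that by simp
      then show ?thesis using A v(1) that
        by (simp add: scalar_prod_def atLeast0LessThan)
    qed
    then have "\<forall>i<n. vec_index v i = 0" by (rule inj)
    then have "v = 0\<^sub>v n" using v(1) by (intro eq_vecI) auto
    then show False using v(2) by simp
  qed
  then obtain B where "B \<in> carrier_mat n n" "A * B = 1\<^sub>m n" "B * A = 1\<^sub>m n"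
    using det_non_zero_imp_unit[OF A, of "()"] by (auto simp: Units_def ring_mat_def)
  then show ?thesis using A by (auto simp: invertible_mat_def inverts_mat_def)
qed

lemma the_mat_inverse:
  fixes A :: "real mat"
  assumes A: "A \<in> carrier_mat n n" and inv: "invertible_mat A"
  shows "the (mat_inverse A) \<in> carrier_mat n n"
    and "A * the (mat_inverse A) = 1\<^sub>m n" and "the (mat_inverse A) * A = 1\<^sub>m n"
proof -
  obtain B where B: "A * B = 1\<^sub>m n" "B * A = 1\<^sub>m (dim_row B)"
    using inv A by (auto simp: invertible_mat_def inverts_mat_def)
  have "dim_col B = n" using B(1) by (metis index_mult_mat(3) index_one_mat(3))
  moreover have "dim_row B = n" using B(2) A by (metis carrier_matD(2) index_mult_mat(3) index_one_mat(3))
  ultimately have "A \<in> Units (ring_mat TYPE(real) n ())"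
    using A B unfolding Units_def ring_mat_def by auto
  then obtain N where "mat_inverse A = Some N" using mat_inverse(1)[OF A] by fastforce
  then show "the (mat_inverse A) \<in> carrier_mat n n"
    and "A * the (mat_inverse A) = 1\<^sub>m n" and "the (mat_inverse A) * A = 1\<^sub>m n"
    using mat_inverse(2)[OF A] by auto
qed

section \<open>Harmonic functions of an irreducible stochastic matrix\<close>

lemma stochastic_mat_pow:
  assumes "stochastic_mat s P"
  shows "stochastic_mat s (P ^\<^sub>m m)"
proof (induction m)
  case 0
  have "(\<Sum>j<s. (1\<^sub>m s :: real mat) $$ (i, j)) = 1" if "i < s" for i
    using that by (simp add: sum.delta)
  moreover have "dim_row P = s" using assms by (auto simp: stochastic_mat_def)
  ultimately show ?case by (simp add: stochastic_mat_def)
next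
  case (Suc m)
  let ?Q = "P ^\<^sub>m m"
  have Q: "?Q \<in> carrier_mat s s" and P: "P \<in> carrier_mat s s"
    using Suc assms by (auto simp: stochastic_mat_def)
  have e: "(?Q * P) $$ (i, j) = (\<Sum>k<s. ?Q $$ (i, k) * P $$ (k, j))" if "i < s" "j < s" for i j
    using Q P that by (simp add: scalar_prod_def atLeast0LessThan)
  have "(\<Sum>j<s. (?Q * P) $$ (i, j)) = 1" if "i < s" for i
  proof -
    have "(\<Sum>j<s. (?Q * P) $$ (i, j)) = (\<Sum>j<s. \<Sum>k<s. ?Q $$ (i, k) * P $$ (k, j))"
      using e that by simp
    also have "\<dots> = (\<Sum>k<s. ?Q $$ (i, k) * (\<Sum>j<s. P $$ (k, j)))"
      by (subst sum.swap) (simp add: sum_distrib_left)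
    also have "\<dots> = 1" using assms Suc that by (simp add: stochastic_mat_def)
    finally show ?thesis .
  qed
  moreover have "0 \<le> (?Q * P) $$ (i, j)" if "i < s" "j < s" for i j
    unfolding e[OF that] using Suc assms that
    by (intro sum_nonneg mult_nonneg_nonneg) (auto simp: stochastic_mat_def)
  ultimately show ?case using mult_carrier_mat[OF Q P] unfolding stochastic_mat_def pow_mat.simps by (intro conjI allI impI)
qed

lemma subharmonic_iterate:
  assumes st: "stochastic_mat s P"
    and sub: "\<And>i. i < s \<Longrightarrow> y i \<le> (\<Sum>j<s. P $$ (i, j) * y j)"
    and "i < s"
  shows "y i \<le> (\<Sum>j<s. (P ^\<^sub>m m) $$ (i, j) * y j)"
proof (induction m)
  case 0
  have "dim_row P = s" using st by (auto simp: stochastic_mat_def)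
  then show ?case using \<open>i < s\<close> by (simp add: if_distrib[of "\<lambda>x. x * _"] cong: if_cong)
next
  case (Suc m)
  let ?Q = "P ^\<^sub>m m"
  have Q: "stochastic_mat s ?Q" by (rule stochastic_mat_pow[OF st])
  have "y i \<le> (\<Sum>k<s. ?Q $$ (i, k) * y k)" by (rule Suc)
  also have "\<dots> \<le> (\<Sum>k<s. ?Q $$ (i, k) * (\<Sum>j<s. P $$ (k, j) * y j))"
    using Q \<open>i < s\<close> by (intro sum_mono mult_left_mono sub) (auto simp: stochastic_mat_def)
  also have "\<dots> = (\<Sum>j<s. (\<Sum>k<s. ?Q $$ (i, k) * P $$ (k, j)) * y j)"
    by (simp add: sum_distrib_left sum_distrib_right mult.assoc) (rule sum.swap)
  also have "\<dots> = (\<Sum>j<s. (?Q * P) $$ (i, j) * y j)"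
  proof (intro sum.cong refl)
    fix j assume "j \<in> {..<s}"
    moreover have "?Q \<in> carrier_mat s s" "P \<in> carrier_mat s s" using Q st by (simp_all add: stochastic_mat_def)
    ultimately show "(\<Sum>k<s. ?Q $$ (i, k) * P $$ (k, j)) * y j = (?Q * P) $$ (i, j) * y j"
      using \<open>i < s\<close> by (simp add: scalar_prod_def atLeast0LessThan)
  qed
  finally show ?case by simp
qed

text \<open>
  The maximum principle. At a state where the maximum is attained, every iterate of the matrix averages
  values that do not exceed the maximum to at least the maximum, so all states that can be reached share
  that value. It yields the invertibility of \<open>I - P\<^sub>B\<^sub>B\<close> as well as the solvability of Poisson's equation.
\<close>

lemma subharmonic_constant:
  assumes st: "stochastic_mat s P" and irr: "irreducible_mat s P"
    and sub: "\<And>i. i < s \<Longrightarrow> y i \<le> (\<Sum>j<s. P $$ (i, j) * y j)"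
    and "i < s" "j < s"
  shows "y i = (y j :: real)"
proof -
  have "\<exists>k<s. \<forall>l<s. y l \<le> y k"
  proof -
    have "Max (y ` {..<s}) \<in> y ` {..<s}" using \<open>i < s\<close> by (intro Max_in) auto
    then obtain k where "k < s" "Max (y ` {..<s}) = y k" by auto
    then show ?thesis by (metis Max_ge finite_imageI finite_lessThan imageI lessThan_iff)
  qed
  then obtain k where k: "k < s" "\<And>l. l < s \<Longrightarrow> y l \<le> y k" by auto
  have "y l = y k" if "l < s" for l
  proof -
    obtain m where m: "(P ^\<^sub>m m) $$ (k, l) > 0" using irr[unfolded irreducible_mat_def, rule_format, OF k(1) \<open>l < s\<close>] ..
    let ?Q = "P ^\<^sub>m m"
    have Q: "stochastic_mat s ?Q" by (rule stochastic_mat_pow[OF st])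
    have "y k \<le> (\<Sum>j<s. ?Q $$ (k, j) * y j)" by (rule subharmonic_iterate[OF st sub k(1)])
    then have "(\<Sum>j<s. ?Q $$ (k, j) * (y k - y j)) \<le> 0"
      using Q k(1) by (simp add: right_diff_distrib sum_subtractf stochastic_mat_def flip: sum_distrib_right)
    moreover have nn: "0 \<le> ?Q $$ (k, j) * (y k - y j)" if "j < s" for j
      using Q k that by (auto simp: stochastic_mat_def)
    ultimately have "(\<Sum>j<s. ?Q $$ (k, j) * (y k - y j)) = 0"
      by (intro antisym sum_nonneg) auto
    then have "?Q $$ (k, l) * (y k - y l) = 0"
      using \<open>l < s\<close> nn by (subst (asm) sum_nonneg_eq_0_iff) auto
    then show ?thesis using m by auto
  qed
  then show ?thesis using \<open>i < s\<close> \<open>j < s\<close> by simp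
qed

lemma stationary_row_pos:
  assumes st: "stochastic_mat s P" and irr: "irreducible_mat s P" and stat: "stationary_row s P \<pi>"
    and "j < s"
  shows "0 < \<pi> $$ (0, j)"
proof -
  have pi: "\<pi> \<in> carrier_mat 1 s" "\<And>i. i < s \<Longrightarrow> 0 \<le> \<pi> $$ (0, i)" "(\<Sum>i<s. \<pi> $$ (0, i)) = 1"
    and piP: "\<pi> * P = \<pi>" using stat by (auto simp: stationary_row_def probability_row_def)
  have P: "P \<in> carrier_mat s s" using st by (simp add: stochastic_mat_def)
  obtain i where i: "i < s" "\<pi> $$ (0, i) > 0"
  proof -
    have "\<exists>i<s. \<pi> $$ (0, i) \<noteq> 0"
      using pi(3) by (metis (no_types, lifting) lessThan_iff sum.neutral zero_neq_one)
    then show thesis using pi(2) that by (metis order_less_le)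
  qed
  obtain m where m: "(P ^\<^sub>m m) $$ (i, j) > 0" using irr[unfolded irreducible_mat_def, rule_format, OF i(1) \<open>j < s\<close>] ..
  have Q: "stochastic_mat s (P ^\<^sub>m m)" by (rule stochastic_mat_pow[OF st])
  have "\<pi> * P ^\<^sub>m m = \<pi>" for m
  proof (induction m)
    case (Suc m)
    have "\<pi> * (P ^\<^sub>m m * P) = \<pi> * P ^\<^sub>m m * P"
      using pi(1) P by (intro assoc_mult_mat[symmetric]) auto
    then show ?case using Suc piP by simp
  qed (use pi(1) P in auto)
  then have "\<pi> $$ (0, j) = (\<pi> * P ^\<^sub>m m) $$ (0, j)" by simp
  also have "\<dots> = (\<Sum>k<s. \<pi> $$ (0, k) * (P ^\<^sub>m m) $$ (k, j))"
    using pi(1) Q P \<open>j < s\<close> by (simp add: stochastic_mat_def scalar_prod_def atLeast0LessThan)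
  also have "\<dots> > 0"
    using i m pi(2) Q \<open>j < s\<close>
    by (intro sum_pos2[of _ i]) (auto simp: stochastic_mat_def)
  finally show ?thesis .
qed

lemma stationary_row_sum:
  assumes "stochastic_mat s P" "stationary_row s P \<pi>" "j < s"
  shows "(\<Sum>i<s. \<pi> $$ (0, i) * P $$ (i, j)) = \<pi> $$ (0, j)"
proof -
  have c: "\<pi> \<in> carrier_mat 1 s" "P \<in> carrier_mat s s" and e: "\<pi> * P = \<pi>"
    using assms by (auto simp: stationary_row_def probability_row_def stochastic_mat_def)
  have "(\<pi> * P) $$ (0, j) = (\<Sum>i<s. \<pi> $$ (0, i) * P $$ (i, j))"
    using c assms(3) by (simp add: scalar_prod_def atLeast0LessThan)
  then show ?thesis using e by simp
qed

text \<open>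
  Although \<open>I - P\<close> is singular, \<open>I - P + 1 \<pi>\<close> is not: multiplying by \<open>\<pi>\<close> from the left
  shows that a vector in its kernel has \<open>\<pi>\<close>-mean 0, so that it is harmonic, hence constant, hence 0. For
  the same reason the solution for a right-hand side of \<open>\<pi>\<close>-mean 0 solves the equation with \<open>I - P\<close>.
\<close>

lemma poisson_equation:
  fixes f :: "nat \<Rightarrow> real"
  assumes st: "stochastic_mat s P" and irr: "irreducible_mat s P" and stat: "stationary_row s P \<pi>"
    and f: "(\<Sum>i<s. \<pi> $$ (0, i) * f i) = 0"
  obtains h where "\<And>i. i < s \<Longrightarrow> h i - (\<Sum>j<s. P $$ (i, j) * h j) = f i"
proof -
  define A where "A = mat s s (\<lambda>(i, j). (if i = j then 1 else 0) - P $$ (i, j) + \<pi> $$ (0, j))"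
  have A: "A \<in> carrier_mat s s" by (simp add: A_def)
  have pi1: "(\<Sum>i<s. \<pi> $$ (0, i)) = 1" using stat by (simp add: stationary_row_def probability_row_def)
  have Ax: "(\<Sum>j<s. A $$ (i, j) * x j) = x i - (\<Sum>j<s. P $$ (i, j) * x j) + (\<Sum>j<s. \<pi> $$ (0, j) * x j)"
    if "i < s" for i and x :: "nat \<Rightarrow> real"
    using that by (simp add: A_def algebra_simps sum.distrib sum_subtractf sum.delta
        if_distrib[of "\<lambda>y. _ * y"] cong: if_cong)
  have piA: "(\<Sum>i<s. \<pi> $$ (0, i) * (\<Sum>j<s. A $$ (i, j) * x j)) = (\<Sum>j<s. \<pi> $$ (0, j) * x j)" for x :: "nat \<Rightarrow> real"
  proof -
    have "(\<Sum>i<s. \<pi> $$ (0, i) * (\<Sum>j<s. P $$ (i, j) * x j)) = (\<Sum>j<s. (\<Sum>i<s. \<pi> $$ (0, i) * P $$ (i, j)) * x j)"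
      by (simp add: sum_distrib_left sum_distrib_right mult.assoc) (rule sum.swap)
    also have "\<dots> = (\<Sum>j<s. \<pi> $$ (0, j) * x j)" using stationary_row_sum[OF st stat] by simp
    finally show ?thesis
      by (simp add: Ax distrib_left right_diff_distrib sum.distrib sum_subtractf pi1 flip: sum_distrib_right)
  qed
  have "invertible_mat A"
  proof (rule invertible_mat_if_injective[OF A])
    fix x assume x: "\<And>i. i < s \<Longrightarrow> (\<Sum>j<s. A $$ (i, j) * x j) = 0"
    have 0: "(\<Sum>j<s. \<pi> $$ (0, j) * x j) = 0" using piA[of x] x by simp
    have "x i = (\<Sum>j<s. P $$ (i, j) * x j)" if "i < s" for i using x[OF that] Ax[OF that] 0 by simp
    then have c: "x i = x j" if "i < s" "j < s" for i j
      using that by (intro subharmonic_constant[OF st irr, of x]) auto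
    show "\<forall>i<s. x i = 0"
    proof (intro allI impI)
      fix i assume "i < s"
      have "(\<Sum>j<s. \<pi> $$ (0, j) * x j) = (\<Sum>j<s. \<pi> $$ (0, j) * x i)"
        using c[OF _ \<open>i < s\<close>] by (intro sum.cong) auto
      then show "x i = 0" using 0 pi1 by (simp flip: sum_distrib_right)
    qed
  qed
  note N = the_mat_inverse[OF A this]
  let ?N = "the (mat_inverse A)"
  define h where "h i = (\<Sum>j<s. ?N $$ (i, j) * f j)" for i
  have Ah: "(\<Sum>j<s. A $$ (i, j) * h j) = f i" if "i < s" for i
  proof -
    have "(\<Sum>j<s. A $$ (i, j) * h j) = (\<Sum>k<s. (\<Sum>j<s. A $$ (i, j) * ?N $$ (j, k)) * f k)"
      by (simp add: h_def sum_distrib_left sum_distrib_right mult.assoc) (rule sum.swap)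
    also have "\<dots> = (\<Sum>k<s. (A * ?N) $$ (i, k) * f k)"
      using A N(1) that by (intro sum.cong refl) (auto simp: scalar_prod_def atLeast0LessThan)
    also have "\<dots> = f i" unfolding N(2) using that by (simp add: if_distrib[of "\<lambda>y. y * _"] cong: if_cong)
    finally show ?thesis .
  qed
  have "(\<Sum>j<s. \<pi> $$ (0, j) * h j) = 0" using piA[of h] Ah f by simp
  then show thesis using Ah Ax by (intro that[of h]) force
qed

section \<open>Mean times as a function of the transition matrix\<close>

lemma left_inverse_mat_apply:
  fixes A N :: "real mat"
  assumes "A \<in> carrier_mat n n" "N \<in> carrier_mat n n" "N * A = 1\<^sub>m n" "k < n"
  shows "(\<Sum>i<n. N $$ (k, i) * (\<Sum>j<n. A $$ (i, j) * y j)) = y k"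
proof -
  have "(\<Sum>i<n. N $$ (k, i) * (\<Sum>j<n. A $$ (i, j) * y j))
      = (\<Sum>j<n. (\<Sum>i<n. N $$ (k, i) * A $$ (i, j)) * y j)"
    by (simp add: sum_distrib_left sum_distrib_right mult.assoc) (rule sum.swap)
  also have "\<dots> = (\<Sum>j<n. (1\<^sub>m n) $$ (k, j) * y j)"
    using assms(1,2,4) by (simp flip: assms(3) add: scalar_prod_def atLeast0LessThan)
  also have "\<dots> = y k"
    using assms(4) by (simp add: if_distrib[of "\<lambda>z. z * _"] cong: if_cong)
  finally show ?thesis .
qed

lemma bij_betw_pick:
  assumes "finite B"
  shows "bij_betw (pick B) {..<card B} B"
  unfolding bij_betw_def
proof
  show "inj_on (pick B) {..<card B}"
    by (intro inj_onI) (metis lessThan_iff nat_neq_iff pick_eq_iff_inf pick_mono_le)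
  then have "card (pick B ` {..<card B}) = card B" by (simp add: card_image)
  moreover have "pick B ` {..<card B} \<subseteq> B" by (auto intro: pick_in_set_le)
  ultimately show "pick B ` {..<card B} = B" using assms by (intro card_subset_eq) auto
qed

lemma submatrix_square:
  assumes "A \<in> carrier_mat s s" "B \<subseteq> {0..<s}"
  shows "submatrix A B B \<in> carrier_mat (card B) (card B)"
    and "\<And>i j. i < card B \<Longrightarrow> j < card B \<Longrightarrow> submatrix A B B $$ (i, j) = A $$ (pick B i, pick B j)"
proof -
  have "{i. i < s \<and> i \<in> B} = B" using assms(2) by auto
  then show "submatrix A B B \<in> carrier_mat (card B) (card B)"
    and "\<And>i j. i < card B \<Longrightarrow> j < card B \<Longrightarrow> submatrix A B B $$ (i, j) = A $$ (pick B i, pick B j)"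
    using assms(1) by (auto simp: submatrix_def)
qed

lemma submatrix_row:
  assumes "a \<in> carrier_mat 1 s" "B \<subseteq> {0..<s}"
  shows "submatrix a UNIV B \<in> carrier_mat 1 (card B)"
proof -
  have "{i. i < s \<and> i \<in> B} = B" using assms(2) by auto
  then show ?thesis using assms(1) by (auto simp: submatrix_def)
qed

lemma pick_less:
  assumes "B \<subseteq> {0..<s}" "i < card B" shows "pick B i < s"
  using pick_in_set_le[OF assms(2)] assms(1) by auto

text \<open>
  If \<open>x = P\<^sub>B\<^sub>B x\<close>, then \<open>\<bar>x\<bar>\<close> extended by 0 outside of \<open>B\<close> is subharmonic for \<open>P\<close>, so it is
  constant; as it vanishes somewhere, it is 0.
\<close>

lemma invertible_mat_restriction:
  assumes st: "stochastic_mat s P" and irr: "irreducible_mat s P" and B: "B \<subset> {0..<s}"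
  shows "invertible_mat (1\<^sub>m (card B) - submatrix P B B)"
proof (rule invertible_mat_if_injective)
  let ?c = "card B"
  have P: "P \<in> carrier_mat s s" using st by (simp add: stochastic_mat_def)
  have Bs: "B \<subseteq> {0..<s}" and fin: "finite B" using B finite_subset[of B "{0..<s}"] by auto
  note sub = submatrix_square[OF P Bs]
  show "1\<^sub>m ?c - submatrix P B B \<in> carrier_mat ?c ?c" using sub(1) by (rule minus_carrier_mat)
  fix x :: "nat \<Rightarrow> real"
  assume x: "\<And>i. i < ?c \<Longrightarrow> (\<Sum>j<?c. (1\<^sub>m ?c - submatrix P B B) $$ (i, j) * x j) = 0"
  have x': "x i = (\<Sum>j<?c. P $$ (pick B i, pick B j) * x j)" if "i < ?c" for i
    using x[OF that] that sub carrier_matD[OF sub(1)]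
    by (simp add: left_diff_distrib sum_subtractf if_distrib[of "\<lambda>z. z * _"] cong: if_cong)
  let ?q = "inv_into {..<?c} (pick B)"
  note bij = bij_betw_pick[OF fin]
  have q: "?q (pick B i) = i" if "i < ?c" for i
    using bij that by (simp add: bij_betw_def)
  define y where "y b = (if b \<in> B then \<bar>x (?q b)\<bar> else 0)" for b
  have y_pick: "y (pick B i) = \<bar>x i\<bar>" if "i < ?c" for i
    using q[OF that] pick_in_set_le[OF that] by (simp add: y_def)
  have "y b \<le> (\<Sum>j<s. P $$ (b, j) * y j)" if "b < s" for b
  proof (cases "b \<in> B")
    case True
    then obtain i where i: "i < ?c" "b = pick B i" using bij by (auto simp: bij_betw_def)
    have "y b \<le> (\<Sum>j<?c. \<bar>P $$ (pick B i, pick B j) * x j\<bar>)"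
      unfolding i(2) y_pick[OF i(1)] by (subst x'[OF i(1)]) (rule sum_abs)
    also have "\<dots> = (\<Sum>j<?c. P $$ (b, pick B j) * y (pick B j))"
      using st pick_less[OF Bs] i y_pick by (intro sum.cong) (auto simp: abs_mult stochastic_mat_def)
    also have "\<dots> = (\<Sum>j\<in>B. P $$ (b, j) * y j)"
      by (rule sum.reindex_bij_betw[OF bij])
    also have "\<dots> = (\<Sum>j<s. P $$ (b, j) * y j)"
      using Bs by (intro sum.mono_neutral_left) (auto simp: y_def)
    finally show ?thesis .
  next
    case False
    then show ?thesis using st that by (auto simp: y_def stochastic_mat_def intro!: sum_nonneg)
  qed
  then have const: "y i = y j" if "i < s" "j < s" for i j
    by (rule subharmonic_constant[OF st irr _ that])
  obtain d where d: "d < s" "d \<notin> B" using psubset_imp_ex_mem[OF B] by auto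
  show "\<forall>i<?c. x i = 0"
  proof (intro allI impI)
    fix i assume i: "i < ?c"
    have "y (pick B i) = y d" using const pick_less[OF Bs i] d(1) by blast
    then show "x i = 0" using y_pick[OF i] d(2) by (simp add: y_def)
  qed
qed

lemma fundamental_mat_inverse:
  assumes "P \<in> carrier_mat s s" "B \<subseteq> {0..<s}"
    and "invertible_mat (1\<^sub>m (card B) - submatrix P B B)"
  shows "fundamental_mat P B \<in> carrier_mat (card B) (card B)"
    and "(1\<^sub>m (card B) - submatrix P B B) * fundamental_mat P B = 1\<^sub>m (card B)"
    and "fundamental_mat P B * (1\<^sub>m (card B) - submatrix P B B) = 1\<^sub>m (card B)"
proof -
  have "1\<^sub>m (card B) - submatrix P B B \<in> carrier_mat (card B) (card B)"
    using submatrix_square(1)[OF assms(1,2)] by (rule minus_carrier_mat)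
  from the_mat_inverse[OF this assms(3)] show "fundamental_mat P B \<in> carrier_mat (card B) (card B)"
    and "(1\<^sub>m (card B) - submatrix P B B) * fundamental_mat P B = 1\<^sub>m (card B)"
    and "fundamental_mat P B * (1\<^sub>m (card B) - submatrix P B B) = 1\<^sub>m (card B)"
    by (simp_all add: fundamental_mat_def)
qed

lemma mean_time_sum:
  assumes "a \<in> carrier_mat 1 s" "P \<in> carrier_mat s s" "B \<subseteq> {0..<s}"
    and "invertible_mat (1\<^sub>m (card B) - submatrix P B B)"
  shows "mean_time a B P = (\<Sum>k<card B. submatrix a UNIV B $$ (0, k) * (fundamental_mat P B * ones (card B)) $$ (k, 0))"
    and "\<And>i. i < card B \<Longrightarrow>
      (\<Sum>j<card B. (1\<^sub>m (card B) - submatrix P B B) $$ (i, j) * (fundamental_mat P B * ones (card B)) $$ (j, 0)) = 1"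
proof -
  let ?c = "card B" and ?N = "fundamental_mat P B" and ?A = "1\<^sub>m (card B) - submatrix P B B"
  note N = fundamental_mat_inverse[OF assms(2-4)]
  have A: "?A \<in> carrier_mat ?c ?c" using submatrix_square(1)[OF assms(2,3)] by (rule minus_carrier_mat)
  have o: "ones ?c \<in> carrier_mat ?c 1" by (simp add: ones_def)
  note a = submatrix_row[OF assms(1,3)]
  have "mean_time a B P = (submatrix a UNIV B * (?N * ones ?c)) $$ (0, 0)"
    unfolding mean_time_def using assoc_mult_mat[OF a N(1) o] by simp
  moreover have "?N * ones ?c \<in> carrier_mat ?c 1" using N(1) o by simp
  ultimately show "mean_time a B P = (\<Sum>k<?c. submatrix a UNIV B $$ (0, k) * (?N * ones ?c) $$ (k, 0))"
    using mult_mat_entry[OF a, of "?N * ones ?c" 1 0 0] by simp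
  have X: "?N * ones ?c \<in> carrier_mat ?c 1" using N(1) o by simp
  fix i assume i: "i < ?c"
  have "(?A * (?N * ones ?c)) $$ (i, 0) = 1"
    using assoc_mult_mat[OF A N(1) o] N(2) i by (simp add: ones_def)
  moreover have "(?A * (?N * ones ?c)) $$ (i, 0) = (\<Sum>j<?c. ?A $$ (i, j) * (?N * ones ?c) $$ (j, 0))"
    by (rule mult_mat_entry[OF A X i]) simp
  ultimately show "(\<Sum>j<?c. ?A $$ (i, j) * (?N * ones ?c) $$ (j, 0)) = 1" by simp
qed

text \<open>
  The second-order expansion of the mean time. Invertibility at the perturbed matrix is part of the
  conclusion: \<open>N\<^sub>B \<Delta>\<close> is a contraction when the perturbation is small.
\<close>

lemma mean_time_perturbation:
  assumes a: "a \<in> carrier_mat 1 s" and P: "P \<in> carrier_mat s s" and Bs: "B \<subseteq> {0..<s}"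
    and inv: "invertible_mat (1\<^sub>m (card B) - submatrix P B B)"
  defines "u \<equiv> \<lambda>i. (submatrix a UNIV B * fundamental_mat P B) $$ (0, i)"
    and "v \<equiv> \<lambda>j. (fundamental_mat P B * ones (card B)) $$ (j, 0)"
  shows "\<exists>C \<eta>. 0 \<le> C \<and> 0 < \<eta> \<and> (\<forall>P'\<in>carrier_mat s s. \<forall>e.
      (\<forall>i<s. \<forall>j<s. \<bar>P' $$ (i, j) - P $$ (i, j)\<bar> \<le> e) \<longrightarrow> 0 \<le> e \<longrightarrow> e \<le> \<eta> \<longrightarrow>
       invertible_mat (1\<^sub>m (card B) - submatrix P' B B) \<and>
       \<bar>mean_time a B P' - mean_time a B P -
         (\<Sum>i<card B. \<Sum>j<card B. u i * v j * (P' $$ (pick B i, pick B j) - P $$ (pick B i, pick B j)))\<bar> \<le> C * e\<^sup>2)"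
proof -
  let ?c = "card B" and ?N = "fundamental_mat P B" and ?A = "1\<^sub>m (card B) - submatrix P B B"
  let ?a = "\<lambda>k. submatrix a UNIV B $$ (0, k)"
  note N = fundamental_mat_inverse[OF P Bs inv]
  have A: "?A \<in> carrier_mat ?c ?c" using submatrix_square(1)[OF P Bs] by (rule minus_carrier_mat)
  have aB: "submatrix a UNIV B \<in> carrier_mat 1 ?c" by (rule submatrix_row[OF a Bs])
  define H where "H = (\<Sum>k<?c. \<Sum>i<?c. \<bar>?N $$ (k, i)\<bar>)"
  define V where "V = (\<Sum>k<?c. \<bar>v k\<bar>)"
  define R where "R = (\<Sum>k<?c. \<bar>u k\<bar>)"
  have nn: "H \<ge> 0" "V \<ge> 0" "R \<ge> 0" by (auto simp: H_def V_def R_def intro!: sum_nonneg)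
  have NA: "(\<Sum>i<?c. ?N $$ (k, i) * (\<Sum>j<?c. ?A $$ (i, j) * y j)) = y k" if "k < ?c" for k y
    by (rule left_inverse_mat_apply[OF A N(1) N(3) that])
  have u_eq: "u i = (\<Sum>k<?c. ?a k * ?N $$ (k, i))" if "i < ?c" for i
    using aB N(1) that by (simp add: u_def scalar_prod_def atLeast0LessThan)
  have uA: "(\<Sum>k<?c. ?a k * y k) = (\<Sum>i<?c. u i * (\<Sum>j<?c. ?A $$ (i, j) * y j))" for y
  proof -
    have "(\<Sum>k<?c. ?a k * y k) = (\<Sum>k<?c. ?a k * (\<Sum>i<?c. ?N $$ (k, i) * (\<Sum>j<?c. ?A $$ (i, j) * y j)))"
      using NA[of _ y] by simp
    also have "\<dots> = (\<Sum>k<?c. \<Sum>i<?c. ?a k * ?N $$ (k, i) * (\<Sum>j<?c. ?A $$ (i, j) * y j))"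
      by (simp only: sum_distrib_left mult.assoc)
    also have "\<dots> = (\<Sum>i<?c. \<Sum>k<?c. ?a k * ?N $$ (k, i) * (\<Sum>j<?c. ?A $$ (i, j) * y j))"
      by (rule sum.swap)
    also have "\<dots> = (\<Sum>i<?c. u i * (\<Sum>j<?c. ?A $$ (i, j) * y j))"
      by (intro sum.cong refl) (simp only: lessThan_iff u_eq sum_distrib_right)
    finally show ?thesis .
  qed
  have Av: "(\<Sum>j<?c. ?A $$ (i, j) * v j) = 1" if "i < ?c" for i
    unfolding v_def by (rule mean_time_sum(2)[OF a P Bs inv that])
  have bound_sum: "(\<Sum>k<?c. \<bar>\<Sum>i<?c. ?N $$ (k, i) * w i\<bar>) \<le> H * b"
    if w: "\<And>i. i < ?c \<Longrightarrow> \<bar>w i\<bar> \<le> b" for w b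
  proof -
    have "(\<Sum>k<?c. \<bar>\<Sum>i<?c. ?N $$ (k, i) * w i\<bar>) \<le> (\<Sum>k<?c. \<Sum>i<?c. \<bar>?N $$ (k, i)\<bar> * b)"
    proof (rule sum_mono)
      fix k
      have "\<bar>\<Sum>i<?c. ?N $$ (k, i) * w i\<bar> \<le> (\<Sum>i<?c. \<bar>?N $$ (k, i) * w i\<bar>)" by (rule sum_abs)
      also have "\<dots> \<le> (\<Sum>i<?c. \<bar>?N $$ (k, i)\<bar> * b)"
        unfolding abs_mult using w by (intro sum_mono mult_left_mono) auto
      finally show "\<bar>\<Sum>i<?c. ?N $$ (k, i) * w i\<bar> \<le> (\<Sum>i<?c. \<bar>?N $$ (k, i)\<bar> * b)" .
    qed
    also have "\<dots> = H * b" by (simp add: H_def sum_distrib_right)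
    finally show ?thesis .
  qed
  \<comment> \<open>With entries at most \<open>\<eta>\<close>, the matrix \<open>N\<^sub>B \<Delta>\<close> has norm at most 1/2 for the sum of absolute values.\<close>
  define \<eta> where "\<eta> = 1 / (2 * (H + 1))"
  have eta: "\<eta> > 0" using nn by (simp add: \<eta>_def)
  show ?thesis
  proof (rule exI[of _ "R * (2 * H * V)"], rule exI[of _ \<eta>], intro conjI[OF _ conjI] ballI allI impI)
    show "0 \<le> R * (2 * H * V)" using nn by simp
    show "0 < \<eta>" by (rule eta)
  next
    fix P' e
    assume P': "P' \<in> carrier_mat s s" and D: "\<forall>i<s. \<forall>j<s. \<bar>P' $$ (i, j) - P $$ (i, j)\<bar> \<le> e"
      and e: "0 \<le> e" "e \<le> \<eta>"
    let ?A' = "1\<^sub>m (card B) - submatrix P' B B"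
    define \<Delta> where "\<Delta> i j = P' $$ (pick B i, pick B j) - P $$ (pick B i, pick B j)" for i j
    have \<Delta>: "\<bar>\<Delta> i j\<bar> \<le> e" if "i < ?c" "j < ?c" for i j
      unfolding \<Delta>_def using D pick_less[OF Bs] that by blast
    have A': "?A' \<in> carrier_mat ?c ?c" using submatrix_square(1)[OF P' Bs] by (rule minus_carrier_mat)
    have AA': "?A $$ (i, j) = ?A' $$ (i, j) + \<Delta> i j" if "i < ?c" "j < ?c" for i j
      using that submatrix_square[OF P Bs] submatrix_square[OF P' Bs]
        carrier_matD[OF submatrix_square(1)[OF P Bs]] carrier_matD[OF submatrix_square(1)[OF P' Bs]]
      by (simp add: \<Delta>_def)
    have Ay: "(\<Sum>j<?c. ?A $$ (i, j) * y j) = (\<Sum>j<?c. ?A' $$ (i, j) * y j) + (\<Sum>j<?c. \<Delta> i j * y j)"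
      if "i < ?c" for i y
    proof -
      have "(\<Sum>j<?c. ?A $$ (i, j) * y j) = (\<Sum>j<?c. (?A' $$ (i, j) + \<Delta> i j) * y j)"
        by (intro sum.cong refl arg_cong2[of _ _ _ _ "(*)"] AA' that) simp
      then show ?thesis by (simp only: distrib_right sum.distrib)
    qed
    have \<Delta>y: "\<bar>\<Sum>j<?c. \<Delta> i j * y j\<bar> \<le> e * (\<Sum>j<?c. \<bar>y j\<bar>)" if "i < ?c" for i y
    proof -
      have "\<bar>\<Sum>j<?c. \<Delta> i j * y j\<bar> \<le> (\<Sum>j<?c. \<bar>\<Delta> i j * y j\<bar>)" by (rule sum_abs)
      also have "\<dots> \<le> (\<Sum>j<?c. e * \<bar>y j\<bar>)"
        unfolding abs_mult using \<Delta>[OF that] by (intro sum_mono mult_right_mono) auto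
      finally show ?thesis by (simp add: sum_distrib_left)
    qed
    have "H * e \<le> H * \<eta>" using e nn by (intro mult_left_mono)
    also have "\<dots> \<le> 1 / 2" using nn by (simp add: \<eta>_def divide_simps)
    finally have He: "H * e \<le> 1 / 2" .
    have half: "H * (e * y) \<le> y / 2" if "y \<ge> 0" for y
      using mult_right_mono[OF He that] by simp
    have inv': "invertible_mat ?A'"
    proof (rule invertible_mat_if_injective[OF A'])
      fix y assume y: "\<And>i. i < ?c \<Longrightarrow> (\<Sum>j<?c. ?A' $$ (i, j) * y j) = 0"
      let ?Y = "\<Sum>j<?c. \<bar>y j\<bar>"
      have yk: "y k = (\<Sum>i<?c. ?N $$ (k, i) * (\<Sum>j<?c. \<Delta> i j * y j))" if "k < ?c" for k
        using NA[OF that, of y] Ay[of _ y] y by simp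
      have "?Y = (\<Sum>k<?c. \<bar>\<Sum>i<?c. ?N $$ (k, i) * (\<Sum>j<?c. \<Delta> i j * y j)\<bar>)"
        by (rule sum.cong[OF refl]) (simp flip: yk)
      also have "\<dots> \<le> H * (e * ?Y)" by (rule bound_sum[OF \<Delta>y])
      also have "\<dots> \<le> ?Y / 2" by (rule half) (simp add: sum_nonneg)
      finally have "?Y \<le> 0" by simp
      then have "?Y = 0" by (intro antisym sum_nonneg) auto
      then show "\<forall>i<?c. y i = 0" by (simp add: sum_nonneg_eq_0_iff)
    qed
    define x where "x k = (fundamental_mat P' B * ones ?c) $$ (k, 0)" for k
    let ?X = "\<Sum>j<?c. \<bar>x j\<bar>"
    have A'x: "(\<Sum>j<?c. ?A' $$ (i, j) * x j) = 1" if "i < ?c" for i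
      unfolding x_def by (rule mean_time_sum(2)[OF a P' Bs inv' that])
    have Ax: "(\<Sum>j<?c. ?A $$ (i, j) * x j) = 1 + (\<Sum>j<?c. \<Delta> i j * x j)" if "i < ?c" for i
      using Ay[OF that, of x] A'x[OF that] by simp
    have xk: "x k - v k = (\<Sum>i<?c. ?N $$ (k, i) * (\<Sum>j<?c. \<Delta> i j * x j))" if "k < ?c" for k
    proof -
      have "x k - v k = (\<Sum>i<?c. ?N $$ (k, i) * (1 + (\<Sum>j<?c. \<Delta> i j * x j))) - (\<Sum>i<?c. ?N $$ (k, i) * 1)"
        using NA[OF that, of x] NA[OF that, of v] Ax Av by simp
      then show ?thesis by (simp add: distrib_left sum.distrib)
    qed
    have dX: "(\<Sum>k<?c. \<bar>x k - v k\<bar>) \<le> H * (e * ?X)"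
    proof -
      have "(\<Sum>k<?c. \<bar>x k - v k\<bar>) = (\<Sum>k<?c. \<bar>\<Sum>i<?c. ?N $$ (k, i) * (\<Sum>j<?c. \<Delta> i j * x j)\<bar>)"
        using xk by simp
      also have "\<dots> \<le> H * (e * ?X)" by (rule bound_sum[OF \<Delta>y])
      finally show ?thesis .
    qed
    have "?X \<le> (\<Sum>k<?c. \<bar>x k - v k\<bar> + \<bar>v k\<bar>)" by (intro sum_mono) auto
    also have "\<dots> \<le> ?X / 2 + V"
      using dX half[of ?X] by (simp add: sum.distrib V_def sum_nonneg)
    finally have X: "?X \<le> 2 * V" by simp
    have dX': "(\<Sum>k<?c. \<bar>x k - v k\<bar>) \<le> 2 * H * V * e"
    proof -
      have "H * (e * ?X) \<le> H * (e * (2 * V))" using X nn e by (intro mult_left_mono) auto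
      then show ?thesis using dX by (simp add: mult_ac)
    qed
    \<comment> \<open>Both times are expressed through \<open>u = a\<^sub>B N\<^sub>B\<close>, so that their difference is exactly \<open>u \<Delta> x\<close>.\<close>
    have mt': "mean_time a B P' = (\<Sum>i<?c. u i * (1 + (\<Sum>j<?c. \<Delta> i j * x j)))"
      using mean_time_sum(1)[OF a P' Bs inv'] uA[of x] Ax by (simp flip: x_def)
    have mt: "mean_time a B P = (\<Sum>i<?c. u i)"
      using mean_time_sum(1)[OF a P Bs inv] uA[of v] Av by (simp add: v_def)
    have "mean_time a B P' - mean_time a B P - (\<Sum>i<?c. \<Sum>j<?c. u i * v j * \<Delta> i j)
        = (\<Sum>i<?c. u i * (\<Sum>j<?c. \<Delta> i j * (x j - v j)))"
      unfolding mt mt' by (simp add: distrib_left right_diff_distrib sum.distrib sum_subtractf sum_distrib_left mult_ac)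
    also have "\<bar>\<dots>\<bar> \<le> (\<Sum>i<?c. \<bar>u i * (\<Sum>j<?c. \<Delta> i j * (x j - v j))\<bar>)" by (rule sum_abs)
    also have "\<dots> \<le> (\<Sum>i<?c. \<bar>u i\<bar> * (e * (2 * H * V * e)))"
      unfolding abs_mult
    proof (intro sum_mono mult_left_mono)
      fix i assume "i \<in> {..<?c}"
      then have "\<bar>\<Sum>j<?c. \<Delta> i j * (x j - v j)\<bar> \<le> e * (\<Sum>j<?c. \<bar>x j - v j\<bar>)" by (intro \<Delta>y) simp
      also have "\<dots> \<le> e * (2 * H * V * e)" using dX' e by (intro mult_left_mono)
      finally show "\<bar>\<Sum>j<?c. \<Delta> i j * (x j - v j)\<bar> \<le> e * (2 * H * V * e)" .
    qed simp
    also have "\<dots> = R * (2 * H * V) * e\<^sup>2" by (simp add: R_def power2_eq_square mult_ac flip: sum_distrib_right sum_distrib_left)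
    finally show "invertible_mat ?A' \<and> \<bar>mean_time a B P' - mean_time a B P -
         (\<Sum>i<?c. \<Sum>j<?c. u i * v j * (P' $$ (pick B i, pick B j) - P $$ (pick B i, pick B j)))\<bar> \<le> R * (2 * H * V) * e\<^sup>2"
      using inv' by (simp add: \<Delta>_def)
  qed
qed

section \<open>Expectations along a finite Markov chain\<close>

locale finite_markov_chain = prob_space M for M :: "'w measure" +
  fixes s :: nat and a P :: "real mat" and X :: "nat \<Rightarrow> 'w \<Rightarrow> nat"
  assumes chain: "markov_chain M s a P X" and stoch: "stochastic_mat s P"
begin

lemma P_nonneg: "i < s \<Longrightarrow> j < s \<Longrightarrow> 0 \<le> P $$ (i, j)"
  and P_row_sum: "i < s \<Longrightarrow> (\<Sum>j<s. P $$ (i, j)) = 1"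
  using stoch by (auto simp: stochastic_mat_def)

lemma X_measurable: "X n \<in> measurable M (count_space {0..<s})"
  using chain by (simp add: markov_chain_def)

lemma X_less: "\<omega> \<in> space M \<Longrightarrow> X n \<omega> < s"
  using measurable_space[OF X_measurable] by auto

definition cylinder :: "nat \<Rightarrow> (nat \<Rightarrow> nat) \<Rightarrow> 'w set" where
  "cylinder n x = {\<omega> \<in> space M. \<forall>k\<le>n. X k \<omega> = x k}"

lemma event_X [measurable]: "{\<omega> \<in> space M. X n \<omega> = i} \<in> sets M"
proof -
  have "{\<omega> \<in> space M. X n \<omega> = i} = X n -` ({i} \<inter> {0..<s}) \<inter> space M"
    using X_less by auto
  moreover have "X n -` ({i} \<inter> {0..<s}) \<inter> space M \<in> sets M"
    by (rule measurable_sets[OF X_measurable]) simp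
  ultimately show ?thesis by (simp only:)
qed

lemma cylinder_sets [measurable]: "cylinder n x \<in> sets M"
proof -
  have "cylinder n x = (\<Inter>k\<in>{..n}. {\<omega> \<in> space M. X k \<omega> = x k})" by (auto simp: cylinder_def)
  also have "\<dots> \<in> sets M" by (intro sets.finite_INT) auto
  finally show ?thesis .
qed

text \<open>
  The defining property of the chain speaks only about cylinders of positive probability; for null
  cylinders both sides are 0.
\<close>

lemma cylinder_step:
  assumes "\<And>k. k \<le> n \<Longrightarrow> x k < s" and "j < s"
  shows "measure M (cylinder n x \<inter> {\<omega> \<in> space M. X (Suc n) \<omega> = j}) = P $$ (x n, j) * measure M (cylinder n x)"
proof (cases "measure M (cylinder n x) = 0")
  case True
  have "measure M (cylinder n x \<inter> {\<omega> \<in> space M. X (Suc n) \<omega> = j}) \<le> measure M (cylinder n x)"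
    by (intro finite_measure_mono) auto
  then show ?thesis using True by (simp add: measure_le_0_iff)
next
  case False
  then have "measure M (cylinder n x) > 0" by (simp add: zero_less_measure_iff)
  then have "\<P>(\<omega> in M. X (Suc n) \<omega> = j \<bar> \<forall>k\<le>n. X k \<omega> = x k) = P $$ (x n, j)"
    using chain assms(2) unfolding markov_chain_def cylinder_def by blast
  moreover have "cylinder n x \<inter> {\<omega> \<in> space M. X (Suc n) \<omega> = j}
      = {\<omega> \<in> space M. X (Suc n) \<omega> = j \<and> (\<forall>k\<le>n. X k \<omega> = x k)}" by (auto simp: cylinder_def)
  ultimately show ?thesis using False by (simp add: cond_prob_def cylinder_def field_simps)
qed

definition paths :: "nat \<Rightarrow> (nat \<Rightarrow> nat) set" where
  "paths n = PiE {..n} (\<lambda>_. {..<s})"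

lemma finite_paths [simp]: "finite (paths n)"
  by (auto simp: paths_def intro: finite_PiE)

definition adapted :: "nat \<Rightarrow> ((nat \<Rightarrow> nat) \<Rightarrow> 'b) \<Rightarrow> bool" where
  "adapted n F \<longleftrightarrow> (\<forall>x y. (\<forall>k\<le>n. x k = y k) \<longrightarrow> F x = F y)"

lemma adaptedI:
  assumes "\<And>x y. (\<And>k. k \<le> n \<Longrightarrow> x k = y k) \<Longrightarrow> F x = F y"
  shows "adapted n F"
  unfolding adapted_def using assms by blast

lemma adaptedD:
  assumes "adapted n F" "\<And>k. k \<le> n \<Longrightarrow> x k = y k"
  shows "F x = F y"
  using assms unfolding adapted_def by blast

text \<open>
  A function of the first \<open>n + 1\<close> states takes finitely many values, one for each path of that length.
  Writing it as a simple function settles measurability and integrability of all path functionals below,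
  and reduces their expectations to finite sums.
\<close>

lemma adapted_decompose:
  fixes F :: "(nat \<Rightarrow> nat) \<Rightarrow> 'b::real_vector"
  assumes F: "adapted n F" and w: "\<omega> \<in> space M"
  shows "F (\<lambda>k. X k \<omega>) = (\<Sum>x\<in>paths n. indicator (cylinder n x) \<omega> *\<^sub>R F x)"
proof -
  let ?x = "restrict (\<lambda>k. X k \<omega>) {..n}"
  have x: "?x \<in> paths n" using X_less[OF w] by (auto simp: paths_def)
  have "(\<Sum>x\<in>paths n. indicator (cylinder n x) \<omega> *\<^sub>R F x) = (\<Sum>x\<in>paths n. if x = ?x then F x else 0)"
  proof (rule sum.cong[OF refl])
    fix x assume "x \<in> paths n"
    then have "\<omega> \<in> cylinder n x \<longleftrightarrow> x = ?x"
      using w by (auto simp: cylinder_def paths_def fun_eq_iff PiE_def extensional_def)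
    then show "indicator (cylinder n x) \<omega> *\<^sub>R F x = (if x = ?x then F x else 0)"
      by (simp add: indicator_def)
  qed
  also have "\<dots> = F ?x" using x by simp
  also have "F ?x = F (\<lambda>k. X k \<omega>)" using F by (auto simp: adapted_def)
  finally show ?thesis by simp
qed

lemma adapted_integrable:
  fixes F :: "(nat \<Rightarrow> nat) \<Rightarrow> 'b::{banach, second_countable_topology}"
  assumes F: "adapted n F"
  shows "integrable M (\<lambda>\<omega>. F (\<lambda>k. X k \<omega>))"
proof -
  have "integrable M (\<lambda>\<omega>. \<Sum>x\<in>paths n. indicator (cylinder n x) \<omega> *\<^sub>R F x)"
    by (intro Bochner_Integration.integrable_sum integrable_scaleR_left integrable_real_indicator)
      (auto simp: emeasure_eq_measure)
  then show ?thesis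
    by (subst Bochner_Integration.integrable_cong[OF refl adapted_decompose[OF F]])
qed

text \<open>
  The Markov property in integrated form: conditioning on the past replaces the next state by an average
  with the weights given by the current row of \<open>P\<close>.
\<close>

lemma expectation_step:
  fixes G :: "(nat \<Rightarrow> nat) \<Rightarrow> nat \<Rightarrow> 'b::{banach, second_countable_topology}"
  assumes G: "\<And>j. adapted n (\<lambda>x. G x j)"
  shows "(LINT \<omega>|M. G (\<lambda>k. X k \<omega>) (X (Suc n) \<omega>))
       = (LINT \<omega>|M. (\<Sum>j<s. P $$ (X n \<omega>, j) *\<^sub>R G (\<lambda>k. X k \<omega>) j))"
proof -
  let ?E = "\<lambda>x j. cylinder n x \<inter> {\<omega> \<in> space M. X (Suc n) \<omega> = j}"
  have int: "integrable M (\<lambda>\<omega>. indicator A \<omega> *\<^sub>R c)" if "A \<in> sets M" for A and c :: 'b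
    using that by (intro integrable_scaleR_left integrable_real_indicator) (auto simp: emeasure_eq_measure)
  have val: "(LINT \<omega>|M. indicator A \<omega> *\<^sub>R c) = measure M A *\<^sub>R c" if "A \<in> sets M" for A and c :: 'b
    using that by (subst integral_scaleR_left) (auto simp: emeasure_eq_measure)
  have "(LINT \<omega>|M. G (\<lambda>k. X k \<omega>) (X (Suc n) \<omega>))
      = (LINT \<omega>|M. (\<Sum>x\<in>paths n. \<Sum>j<s. indicator (?E x j) \<omega> *\<^sub>R G x j))"
  proof (rule Bochner_Integration.integral_cong[OF refl])
    fix \<omega> assume w: "\<omega> \<in> space M"
    have "(\<Sum>j<s. indicator (?E x j) \<omega> *\<^sub>R G x j)
        = indicator (cylinder n x) \<omega> *\<^sub>R G x (X (Suc n) \<omega>)" for x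
    proof -
      have "(\<Sum>j<s. indicator (?E x j) \<omega> *\<^sub>R G x j)
          = (\<Sum>j<s. if j = X (Suc n) \<omega> then indicator (cylinder n x) \<omega> *\<^sub>R G x j else 0)"
        using w by (intro sum.cong) (auto simp: indicator_def)
      then show ?thesis using X_less[OF w] by simp
    qed
    then show "G (\<lambda>k. X k \<omega>) (X (Suc n) \<omega>) = (\<Sum>x\<in>paths n. \<Sum>j<s. indicator (?E x j) \<omega> *\<^sub>R G x j)"
      using adapted_decompose[OF G w] by simp
  qed
  also have "\<dots> = (\<Sum>x\<in>paths n. \<Sum>j<s. measure M (?E x j) *\<^sub>R G x j)"
    by (subst Bochner_Integration.integral_sum, (intro Bochner_Integration.integrable_sum int; simp))+
      (simp add: val)
  also have "\<dots> = (\<Sum>x\<in>paths n. \<Sum>j<s. measure M (cylinder n x) *\<^sub>R P $$ (x n, j) *\<^sub>R G x j)"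
    by (intro sum.cong refl) (subst cylinder_step, auto simp: paths_def mult.commute)
  also have "\<dots> = (\<Sum>x\<in>paths n. measure M (cylinder n x) *\<^sub>R (\<Sum>j<s. P $$ (x n, j) *\<^sub>R G x j))"
    by (simp only: scaleR_sum_right)
  also have "\<dots> = (LINT \<omega>|M. (\<Sum>x\<in>paths n. indicator (cylinder n x) \<omega> *\<^sub>R (\<Sum>j<s. P $$ (x n, j) *\<^sub>R G x j)))"
    by (subst Bochner_Integration.integral_sum, rule int, simp) (simp add: val)
  also have "\<dots> = (LINT \<omega>|M. (\<Sum>j<s. P $$ (X n \<omega>, j) *\<^sub>R G (\<lambda>k. X k \<omega>) j))"
  proof (rule Bochner_Integration.integral_cong[OF refl])
    have "adapted n (\<lambda>x. \<Sum>j<s. P $$ (x n, j) *\<^sub>R G x j)"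
    proof (rule adaptedI)
      fix x y :: "nat \<Rightarrow> nat" assume eq: "\<And>k. k \<le> n \<Longrightarrow> x k = y k"
      have "G x j = G y j" for j by (rule adaptedD[OF G eq])
      then show "(\<Sum>j<s. P $$ (x n, j) *\<^sub>R G x j) = (\<Sum>j<s. P $$ (y n, j) *\<^sub>R G y j)"
        using eq[of n] by simp
    qed
    then show "(\<Sum>x\<in>paths n. indicator (cylinder n x) \<omega> *\<^sub>R (\<Sum>j<s. P $$ (x n, j) *\<^sub>R G x j))
        = (\<Sum>j<s. P $$ (X n \<omega>, j) *\<^sub>R G (\<lambda>k. X k \<omega>) j)" if "\<omega> \<in> space M" for \<omega>
      using adapted_decompose[OF _ that, of n "\<lambda>x. \<Sum>j<s. P $$ (x n, j) *\<^sub>R G x j"] by simp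
  qed
  finally show ?thesis .
qed

section \<open>Second moments of additive functionals\<close>

definition path_sum :: "(nat \<Rightarrow> nat \<Rightarrow> 'b::comm_monoid_add) \<Rightarrow> nat \<Rightarrow> (nat \<Rightarrow> nat) \<Rightarrow> 'b" where
  "path_sum \<xi> n x = (\<Sum>m<n. \<xi> (x m) (x (Suc m)))"

lemma path_sum_cong: "(\<And>k. k \<le> n \<Longrightarrow> x k = y k) \<Longrightarrow> path_sum \<xi> n x = path_sum \<xi> n y"
  unfolding path_sum_def by (intro sum.cong) auto

lemma adapted_path_sum: "adapted n (\<lambda>x. H (path_sum \<xi> n x))"
  by (rule adaptedI) (subst path_sum_cong, auto)

definition martingale_increment :: "(nat \<Rightarrow> nat \<Rightarrow> real) \<Rightarrow> real \<Rightarrow> bool" where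
  "martingale_increment \<xi> b \<longleftrightarrow> (\<forall>i<s. (\<Sum>j<s. P $$ (i, j) * \<xi> i j) = 0) \<and> (\<forall>i<s. \<forall>j<s. \<bar>\<xi> i j\<bar> \<le> b)"

definition increment_variance :: "(nat \<Rightarrow> nat \<Rightarrow> real) \<Rightarrow> nat \<Rightarrow> real" where
  "increment_variance \<xi> i = (\<Sum>j<s. P $$ (i, j) * (\<xi> i j)\<^sup>2)"

lemma increment_variance_bounds:
  assumes "martingale_increment \<xi> b" "i < s"
  shows "0 \<le> increment_variance \<xi> i" and "increment_variance \<xi> i \<le> b\<^sup>2"
proof -
  show "0 \<le> increment_variance \<xi> i"
    unfolding increment_variance_def using P_nonneg[OF assms(2)] by (intro sum_nonneg) auto
  have "(\<xi> i j)\<^sup>2 \<le> b\<^sup>2" if "j < s" for j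
  proof -
    have "\<bar>\<xi> i j\<bar> \<le> b" using assms that by (simp add: martingale_increment_def)
    then show ?thesis by (intro abs_le_square_iff[THEN iffD1]) linarith
  qed
  then have "increment_variance \<xi> i \<le> (\<Sum>j<s. P $$ (i, j) * b\<^sup>2)"
    unfolding increment_variance_def using P_nonneg[OF assms(2)]
    by (intro sum_mono mult_left_mono) auto
  then show "increment_variance \<xi> i \<le> b\<^sup>2"
    using P_row_sum[OF assms(2)] by (simp flip: sum_distrib_right)
qed

text \<open>
  Increments with conditional mean 0 are orthogonal: averaging the square over the next state removes the
  mixed term.
\<close>

lemma martingale_second_moment:
  assumes "martingale_increment \<xi> b"
  shows "(LINT \<omega>|M. (path_sum \<xi> n (\<lambda>k. X k \<omega>))\<^sup>2) \<le> b\<^sup>2 * real n"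
proof (induction n)
  case 0
  then show ?case by (simp add: path_sum_def)
next
  case (Suc n)
  let ?S = "\<lambda>n \<omega>. path_sum \<xi> n (\<lambda>k. X k \<omega>)"
  have int: "integrable M (\<lambda>\<omega>. (?S n \<omega>)\<^sup>2)"
    by (rule adapted_integrable[OF adapted_path_sum])
  have "(LINT \<omega>|M. (?S (Suc n) \<omega>)\<^sup>2) = (LINT \<omega>|M. (?S n \<omega> + \<xi> (X n \<omega>) (X (Suc n) \<omega>))\<^sup>2)"
    by (simp add: path_sum_def)
  also have "\<dots> = (LINT \<omega>|M. (\<Sum>j<s. P $$ (X n \<omega>, j) *\<^sub>R (?S n \<omega> + \<xi> (X n \<omega>) j)\<^sup>2))"
  proof (rule expectation_step)
    fix j show "adapted n (\<lambda>x. (path_sum \<xi> n x + \<xi> (x n) j)\<^sup>2)"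
      using path_sum_cong[of n _ _ \<xi>] by (intro adaptedI) (metis order_refl)
  qed
  also have "\<dots> \<le> (LINT \<omega>|M. (?S n \<omega>)\<^sup>2 + b\<^sup>2)"
  proof (rule integral_mono)
    show "integrable M (\<lambda>\<omega>. \<Sum>j<s. P $$ (X n \<omega>, j) *\<^sub>R (?S n \<omega> + \<xi> (X n \<omega>) j)\<^sup>2)"
    proof (rule adapted_integrable[of n "\<lambda>x. \<Sum>j<s. P $$ (x n, j) *\<^sub>R (path_sum \<xi> n x + \<xi> (x n) j)\<^sup>2"])
      show "adapted n (\<lambda>x. \<Sum>j<s. P $$ (x n, j) *\<^sub>R (path_sum \<xi> n x + \<xi> (x n) j)\<^sup>2)"
      proof (rule adaptedI)
        fix x y :: "nat \<Rightarrow> nat" assume eq: "\<And>k. k \<le> n \<Longrightarrow> x k = y k"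
        show "(\<Sum>j<s. P $$ (x n, j) *\<^sub>R (path_sum \<xi> n x + \<xi> (x n) j)\<^sup>2)
            = (\<Sum>j<s. P $$ (y n, j) *\<^sub>R (path_sum \<xi> n y + \<xi> (y n) j)\<^sup>2)"
          using path_sum_cong[OF eq, where \<xi> = \<xi>] eq[of n] by simp
      qed
    qed
    show "integrable M (\<lambda>\<omega>. (?S n \<omega>)\<^sup>2 + b\<^sup>2)" using int by simp
    fix \<omega> assume "\<omega> \<in> space M"
    then have i: "X n \<omega> < s" by (rule X_less)
    let ?i = "X n \<omega>"
    have "(\<Sum>j<s. P $$ (?i, j) *\<^sub>R (?S n \<omega> + \<xi> ?i j)\<^sup>2)
        = (\<Sum>j<s. P $$ (?i, j)) * (?S n \<omega>)\<^sup>2 + 2 * ?S n \<omega> * (\<Sum>j<s. P $$ (?i, j) * \<xi> ?i j) + increment_variance \<xi> ?i"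
      by (simp add: increment_variance_def power2_sum distrib_left sum.distrib sum_distrib_left sum_distrib_right mult_ac)
    also have "\<dots> \<le> (?S n \<omega>)\<^sup>2 + b\<^sup>2"
      using assms i P_row_sum increment_variance_bounds(2)[OF assms i] by (simp add: martingale_increment_def)
    finally show "(\<Sum>j<s. P $$ (?i, j) *\<^sub>R (?S n \<omega> + \<xi> ?i j)\<^sup>2) \<le> (?S n \<omega>)\<^sup>2 + b\<^sup>2" .
  qed
  also have "\<dots> = (LINT \<omega>|M. (?S n \<omega>)\<^sup>2) + b\<^sup>2" using int by (simp add: prob_space)
  also have "\<dots> \<le> b\<^sup>2 * real (Suc n)" using Suc by (simp add: algebra_simps)
  finally show ?case .
qed

text \<open>
  A quantitative mean ergodic theorem. If \<open>h\<close> solves Poisson's equation for \<open>f - \<pi> f\<close>, then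
  \<open>f (X\<^sub>m) - \<pi> f = h (X\<^sub>m) - h (X\<^sub>m\<^sub>+\<^sub>1) + \<xi> (X\<^sub>m, X\<^sub>m\<^sub>+\<^sub>1)\<close> with a martingale increment \<open>\<xi>\<close>; the first
  difference telescopes to a bounded term.
\<close>

lemma ergodic_second_moment:
  fixes f :: "nat \<Rightarrow> real"
  assumes irr: "irreducible_mat s P" and stat: "stationary_row s P \<pi>"
  shows "\<exists>C\<ge>0. \<forall>n. (LINT \<omega>|M. ((\<Sum>m<n. f (X m \<omega>)) - real n * (\<Sum>i<s. \<pi> $$ (0, i) * f i))\<^sup>2)
    \<le> C * real (Suc n)"
proof -
  let ?f = "\<Sum>i<s. \<pi> $$ (0, i) * f i"
  have pi1: "(\<Sum>i<s. \<pi> $$ (0, i)) = 1" using stat by (simp add: stationary_row_def probability_row_def)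
  have "(\<Sum>i<s. \<pi> $$ (0, i) * (f i - ?f)) = 0"
    by (simp add: right_diff_distrib sum_subtractf pi1 flip: sum_distrib_right)
  from poisson_equation[OF stoch irr stat this]
  obtain h where h: "\<And>i. i < s \<Longrightarrow> h i - (\<Sum>j<s. P $$ (i, j) * h j) = f i - ?f" by blast
  define H where "H = (\<Sum>i<s. \<bar>h i\<bar>)"
  have H: "\<bar>h i\<bar> \<le> H" if "i < s" for i
    unfolding H_def using that by (intro member_le_sum) auto
  define \<xi> where "\<xi> i j = h j - (\<Sum>k<s. P $$ (i, k) * h k)" for i j
  have \<xi>: "martingale_increment \<xi> (2 * H)"
    unfolding martingale_increment_def
  proof (intro conjI allI impI)
    fix i assume i: "i < s"
    show "(\<Sum>j<s. P $$ (i, j) * \<xi> i j) = 0"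
      using P_row_sum[OF i] by (simp add: \<xi>_def right_diff_distrib sum_subtractf flip: sum_distrib_right)
    fix j assume j: "j < s"
    have "\<bar>\<Sum>k<s. P $$ (i, k) * h k\<bar> \<le> (\<Sum>k<s. P $$ (i, k) * H)"
      using P_nonneg[OF i] H by (intro order.trans[OF sum_abs] sum_mono) (auto simp: abs_mult intro: mult_left_mono)
    also have "\<dots> = H" using P_row_sum[OF i] by (simp flip: sum_distrib_right)
    finally show "\<bar>\<xi> i j\<bar> \<le> 2 * H" unfolding \<xi>_def using H[OF j] by linarith
  qed
  let ?S = "\<lambda>n \<omega>. path_sum \<xi> n (\<lambda>k. X k \<omega>)"
  have bound: "((\<Sum>m<n. f (X m \<omega>)) - real n * ?f)\<^sup>2 \<le> 2 * (?S n \<omega>)\<^sup>2 + 8 * H\<^sup>2" if w: "\<omega> \<in> space M" for n \<omega>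
  proof -
    have "(\<Sum>m<n. f (X m \<omega>)) - real n * ?f = (\<Sum>m<n. f (X m \<omega>) - ?f)" by (simp add: sum_subtractf)
    also have "\<dots> = (\<Sum>m<n. (h (X m \<omega>) - h (X (Suc m) \<omega>)) + \<xi> (X m \<omega>) (X (Suc m) \<omega>))"
      using h[OF X_less[OF w]] by (simp add: \<xi>_def)
    also have "\<dots> = (h (X 0 \<omega>) - h (X n \<omega>)) + ?S n \<omega>"
      by (simp add: sum.distrib path_sum_def sum_lessThan_telescope'[of "\<lambda>m. h (X m \<omega>)"])
    finally have e: "(\<Sum>m<n. f (X m \<omega>)) - real n * ?f = (h (X 0 \<omega>) - h (X n \<omega>)) + ?S n \<omega>" .
    have "\<bar>h (X 0 \<omega>) - h (X n \<omega>)\<bar> \<le> \<bar>2 * H\<bar>"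
      using H[OF X_less[OF w, of 0]] H[OF X_less[OF w, of n]] by linarith
    then have "(h (X 0 \<omega>) - h (X n \<omega>))\<^sup>2 \<le> (2 * H)\<^sup>2" by (simp only: abs_le_square_iff)
    then have h4: "(h (X 0 \<omega>) - h (X n \<omega>))\<^sup>2 \<le> 4 * H\<^sup>2" by (simp add: power_mult_distrib)
    have "(p + q)\<^sup>2 \<le> 2 * q\<^sup>2 + 2 * p\<^sup>2" for p q :: real
      using sum_squares_bound[of p q] by (simp add: power2_sum)
    from order.trans[OF this add_left_mono] h4 show ?thesis unfolding e by (smt (verit))
  qed
  have "(LINT \<omega>|M. ((\<Sum>m<n. f (X m \<omega>)) - real n * ?f)\<^sup>2) \<le> 8 * H\<^sup>2 * real (Suc n)" for n
  proof -
    have int: "integrable M (\<lambda>\<omega>. (?S n \<omega>)\<^sup>2)"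
      by (rule adapted_integrable[OF adapted_path_sum])
    have "(LINT \<omega>|M. ((\<Sum>m<n. f (X m \<omega>)) - real n * ?f)\<^sup>2) \<le> (LINT \<omega>|M. 2 * (?S n \<omega>)\<^sup>2 + 8 * H\<^sup>2)"
    proof (rule integral_mono)
      show "integrable M (\<lambda>\<omega>. ((\<Sum>m<n. f (X m \<omega>)) - real n * ?f)\<^sup>2)"
        using adapted_integrable[OF adapted_path_sum[of n "\<lambda>y. (y - real n * ?f)\<^sup>2" "\<lambda>i _. f i"]]
        by (simp add: path_sum_def)
    qed (use int bound in auto)
    also have "\<dots> = 2 * (LINT \<omega>|M. (?S n \<omega>)\<^sup>2) + 8 * H\<^sup>2" using int by (simp add: prob_space)
    also have "\<dots> \<le> 8 * H\<^sup>2 * real (Suc n)"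
      using martingale_second_moment[OF \<xi>, of n] by (simp add: algebra_simps power_mult_distrib)
    finally show ?thesis .
  qed
  then show ?thesis by (intro exI[of _ "8 * H\<^sup>2"]) auto
qed

end

section \<open>A central limit theorem for martingale sums along the chain\<close>

lemma norm_integral_le:
  fixes f :: "'a \<Rightarrow> 'b::{banach, second_countable_topology}"
  assumes "integrable M f" "integrable M g" "\<And>x. x \<in> space M \<Longrightarrow> norm (f x) \<le> g x"
  shows "norm (LINT x|M. f x) \<le> (LINT x|M. g x)"
  by (rule order.trans[OF integral_norm_bound integral_mono]) (use assms in auto)

lemma abs_exp_diff_le:
  fixes x y :: real
  assumes "x \<le> m" "y \<le> m"
  shows "\<bar>exp x - exp y\<bar> \<le> exp m * \<bar>x - y\<bar>"
proof -
  have *: "exp x - exp y \<le> exp m * (x - y)" if "y \<le> x" "x \<le> m" for x y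
  proof -
    have "exp x - exp y = exp x * (1 - exp (y - x))" by (simp add: right_diff_distrib flip: exp_add)
    also have "\<dots> \<le> exp m * (x - y)"
    proof (intro mult_mono)
      show "1 - exp (y - x) \<le> x - y" using exp_ge_add_one_self[of "y - x"] by linarith
    qed (use that in auto)
    finally show ?thesis .
  qed
  show ?thesis
  proof (cases "y \<le> x")
    case True then show ?thesis using *[of y x] assms by simp
  next
    case False then show ?thesis using *[of x y] assms by simp
  qed
qed

lemma exp_minus_second_order:
  fixes y :: real
  assumes "0 \<le> y"
  shows "\<bar>exp (- y) - (1 - y)\<bar> \<le> y\<^sup>2"
proof -
  have "exp (- y) - (1 - y) \<ge> 0" using exp_ge_add_one_self[of "- y"] by simp
  moreover have "exp (- y) \<le> 1 - y + y\<^sup>2"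
  proof -
    have "exp (- y) \<le> 1 / (1 + y)"
      using exp_ge_add_one_self[of y] assms by (simp add: exp_minus inverse_eq_divide frac_le)
    also have "\<dots> \<le> 1 - y + y\<^sup>2"
    proof -
      have "(1 - y + y\<^sup>2) * (1 + y) = 1 + y ^ 3" by (simp add: algebra_simps power2_eq_square power3_eq_cube)
      then show ?thesis using assms by (simp add: divide_le_eq)
    qed
    finally show ?thesis .
  qed
  ultimately show ?thesis by simp
qed

context finite_markov_chain
begin

text \<open>
  The conditional characteristic function of an increment is \<open>1 - \<theta>\<^sup>2 g / 2\<close> up to third order in \<open>\<theta>\<close>,
  since the first-order term has mean 0; so is \<open>exp (- \<theta>\<^sup>2 g / 2)\<close>. The exponential factor cancels it.
\<close>

lemma one_step_characteristic:
  assumes \<xi>: "martingale_increment \<xi> b" and "0 \<le> b" and i: "i < s" and \<theta>: "\<bar>\<theta>\<bar> \<le> T"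
  shows "norm (of_real (exp (\<theta>\<^sup>2 / 2 * increment_variance \<xi> i)) * (\<Sum>j<s. P $$ (i, j) *\<^sub>R iexp (\<theta> * \<xi> i j)) - 1)
    \<le> exp (T\<^sup>2 / 2 * b\<^sup>2) * (b ^ 3 + T * b ^ 4) * \<bar>\<theta>\<bar> ^ 3"
proof -
  let ?\<phi> = "\<Sum>j<s. P $$ (i, j) *\<^sub>R iexp (\<theta> * \<xi> i j)"
  define y where "y = \<theta>\<^sup>2 / 2 * increment_variance \<xi> i"
  note v = increment_variance_bounds[OF \<xi> i]
  have y0: "0 \<le> y" using v by (simp add: y_def)
  have yle: "y \<le> \<theta>\<^sup>2 / 2 * b\<^sup>2" unfolding y_def using v by (intro mult_left_mono) auto
  have T: "0 \<le> T" using \<theta> by linarith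
  have \<theta>T: "\<theta>\<^sup>2 \<le> T\<^sup>2" using \<theta> T by (simp add: abs_le_square_iff[symmetric])
  let ?p = "\<lambda>j. 1 + \<i> * of_real (\<theta> * \<xi> i j) - of_real ((\<theta> * \<xi> i j)\<^sup>2 / 2)"
  have "(\<Sum>j<s. P $$ (i, j) *\<^sub>R ?p j) = of_real (1 - y)"
  proof (rule complex_eqI)
    have "Re (\<Sum>j<s. P $$ (i, j) *\<^sub>R ?p j) = (\<Sum>j<s. P $$ (i, j)) - \<theta>\<^sup>2 / 2 * increment_variance \<xi> i"
      by (simp add: increment_variance_def algebra_simps sum_subtractf sum_distrib_left power_mult_distrib)
    then show "Re (\<Sum>j<s. P $$ (i, j) *\<^sub>R ?p j) = Re (of_real (1 - y))"
      using P_row_sum[OF i] by (simp add: y_def)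
    have "Im (\<Sum>j<s. P $$ (i, j) *\<^sub>R ?p j) = \<theta> * (\<Sum>j<s. P $$ (i, j) * \<xi> i j)"
      by (simp add: algebra_simps sum_distrib_left)
    then show "Im (\<Sum>j<s. P $$ (i, j) *\<^sub>R ?p j) = Im (of_real (1 - y))"
      using \<xi> i by (simp add: martingale_increment_def)
  qed
  then have "?\<phi> - of_real (1 - y) = (\<Sum>j<s. P $$ (i, j) *\<^sub>R (iexp (\<theta> * \<xi> i j) - ?p j))"
    by (simp only: scaleR_diff_right sum_subtractf)
  also have "norm \<dots> \<le> (\<Sum>j<s. P $$ (i, j) * (\<bar>\<theta>\<bar> ^ 3 * b ^ 3))"
  proof (rule order.trans[OF norm_sum], rule sum_mono)
    fix j assume j: "j \<in> {..<s}"
    have "(\<Sum>k\<le>2. (\<i> * complex_of_real (\<theta> * \<xi> i j)) ^ k / fact k) = ?p j"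
      by (simp add: numeral_2_eq_2 power_mult_distrib)
    then have "norm (iexp (\<theta> * \<xi> i j) - ?p j) \<le> \<bar>\<theta> * \<xi> i j\<bar> ^ 3 / fact 3"
      using iexp_approx1[of "\<theta> * \<xi> i j" 2] by simp
    also have "\<dots> \<le> \<bar>\<theta> * \<xi> i j\<bar> ^ 3" by (simp add: fact_numeral)
    also have "\<dots> \<le> (\<bar>\<theta>\<bar> * b) ^ 3"
      using \<xi> i j by (intro power_mono) (auto simp: abs_mult martingale_increment_def intro!: mult_left_mono)
    finally have "norm (iexp (\<theta> * \<xi> i j) - ?p j) \<le> \<bar>\<theta>\<bar> ^ 3 * b ^ 3" by (simp add: power_mult_distrib)
    then show "norm (P $$ (i, j) *\<^sub>R (iexp (\<theta> * \<xi> i j) - ?p j)) \<le> P $$ (i, j) * (\<bar>\<theta>\<bar> ^ 3 * b ^ 3)"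
      using P_nonneg[OF i] j by (auto intro!: mult_left_mono)
  qed
  also have "\<dots> = \<bar>\<theta>\<bar> ^ 3 * b ^ 3" using P_row_sum[OF i] by (simp flip: sum_distrib_right)
  finally have 1: "norm (?\<phi> - of_real (1 - y)) \<le> \<bar>\<theta>\<bar> ^ 3 * b ^ 3" .
  have "norm (of_real (exp (- y)) - of_real (1 - y) :: complex) \<le> y\<^sup>2"
    using exp_minus_second_order[OF y0] by (simp only: of_real_diff[symmetric] norm_of_real)
  also have "y\<^sup>2 \<le> (\<theta>\<^sup>2 * b\<^sup>2)\<^sup>2" using y0 yle by (intro power_mono) auto
  also have "\<dots> = \<bar>\<theta>\<bar> * (\<bar>\<theta>\<bar> ^ 3 * b ^ 4)"
    by (simp add: power_mult_distrib power2_eq_square power3_eq_cube power4_eq_xxxx abs_mult_self_eq mult_ac)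
  also have "\<dots> \<le> T * (\<bar>\<theta>\<bar> ^ 3 * b ^ 4)"
    using \<theta> assms(2) by (intro mult_right_mono) auto
  finally have "norm (?\<phi> - of_real (exp (- y))) \<le> (b ^ 3 + T * b ^ 4) * \<bar>\<theta>\<bar> ^ 3"
    using 1 norm_triangle_ineq4[of "?\<phi> - of_real (1 - y)" "of_real (exp (- y)) - of_real (1 - y)"]
    by (simp add: algebra_simps)
  moreover have "exp y \<le> exp (T\<^sup>2 / 2 * b\<^sup>2)"
    using yle \<theta>T mult_right_mono[of "\<theta>\<^sup>2 / 2" "T\<^sup>2 / 2" "b\<^sup>2"] by simp
  ultimately have "exp y * norm (?\<phi> - of_real (exp (- y)))
      \<le> exp (T\<^sup>2 / 2 * b\<^sup>2) * ((b ^ 3 + T * b ^ 4) * \<bar>\<theta>\<bar> ^ 3)"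
    by (intro mult_mono) auto
  moreover have "of_real (exp y) * ?\<phi> - 1 = of_real (exp y) * (?\<phi> - of_real (exp (- y)))"
    by (simp add: right_diff_distrib exp_minus flip: of_real_mult)
  ultimately show ?thesis by (simp add: norm_mult y_def mult.assoc)
qed

text \<open>
  The compensating factor \<open>exp (\<theta>\<^sup>2 / 2 * \<dots>)\<close> depends on the past only, so each step changes the
  expectation by no more than the error of a single step times a bound on the compensator. The total
  is used with \<open>\<theta> = t / sqrt n\<close>, where \<open>n\<close> errors of order \<open>\<bar>\<theta>\<bar>\<^sup>3\<close> add up to \<open>O(1 / sqrt n)\<close>.
\<close>

lemma tilted_characteristic:
  assumes \<xi>: "martingale_increment \<xi> b" and "0 \<le> b" and \<theta>: "\<bar>\<theta>\<bar> \<le> T"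
  shows "norm ((LINT \<omega>|M. of_real (exp (\<theta>\<^sup>2 / 2 * (\<Sum>m<n. increment_variance \<xi> (X m \<omega>)))) *
      iexp (\<theta> * path_sum \<xi> n (\<lambda>k. X k \<omega>))) - 1)
    \<le> real n * (exp (\<theta>\<^sup>2 / 2 * b\<^sup>2 * real n) * (exp (T\<^sup>2 / 2 * b\<^sup>2) * (b ^ 3 + T * b ^ 4) * \<bar>\<theta>\<bar> ^ 3))"
proof -
  let ?g = "increment_variance \<xi>"
  let ?c = "exp (T\<^sup>2 / 2 * b\<^sup>2) * (b ^ 3 + T * b ^ 4) * \<bar>\<theta>\<bar> ^ 3"
  define F where "F n x = of_real (exp (\<theta>\<^sup>2 / 2 * (\<Sum>m<n. ?g (x m)))) * iexp (\<theta> * path_sum \<xi> n x)" for n x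
  define w where "w i = of_real (exp (\<theta>\<^sup>2 / 2 * ?g i)) * (\<Sum>j<s. P $$ (i, j) *\<^sub>R iexp (\<theta> * \<xi> i j))" for i
  have T: "0 \<le> T" using \<theta> by linarith
  have c0: "?c \<ge> 0" using assms(2) T by simp
  have F_cong: "F n x = F n y" if "\<And>k. k \<le> n \<Longrightarrow> x k = y k" for n x y
  proof -
    have "(\<Sum>m<n. ?g (x m)) = (\<Sum>m<n. ?g (y m))" using that by simp
    then show ?thesis using path_sum_cong[OF that, where \<xi> = \<xi>] by (simp only: F_def)
  qed
  have step: "norm ((LINT \<omega>|M. F (Suc n) (\<lambda>k. X k \<omega>)) - (LINT \<omega>|M. F n (\<lambda>k. X k \<omega>)))
      \<le> exp (\<theta>\<^sup>2 / 2 * b\<^sup>2 * real n) * ?c" for n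
  proof -
    have "(LINT \<omega>|M. F (Suc n) (\<lambda>k. X k \<omega>))
        = (LINT \<omega>|M. F n (\<lambda>k. X k \<omega>) * of_real (exp (\<theta>\<^sup>2 / 2 * ?g (X n \<omega>))) * iexp (\<theta> * \<xi> (X n \<omega>) (X (Suc n) \<omega>)))"
      by (simp add: F_def path_sum_def distrib_left exp_add mult_ac)
    also have "\<dots> = (LINT \<omega>|M. (\<Sum>j<s. P $$ (X n \<omega>, j) *\<^sub>R
        (F n (\<lambda>k. X k \<omega>) * of_real (exp (\<theta>\<^sup>2 / 2 * ?g (X n \<omega>))) * iexp (\<theta> * \<xi> (X n \<omega>) j))))"
    proof (rule expectation_step, rule adaptedI)
      fix j and x y :: "nat \<Rightarrow> nat" assume eq: "\<And>k. k \<le> n \<Longrightarrow> x k = y k"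
      show "F n x * of_real (exp (\<theta>\<^sup>2 / 2 * ?g (x n))) * iexp (\<theta> * \<xi> (x n) j)
          = F n y * of_real (exp (\<theta>\<^sup>2 / 2 * ?g (y n))) * iexp (\<theta> * \<xi> (y n) j)"
        using F_cong[OF eq] eq[of n] by simp
    qed
    also have "\<dots> = (LINT \<omega>|M. F n (\<lambda>k. X k \<omega>) * w (X n \<omega>))"
      by (simp add: w_def sum_distrib_left mult_ac scaleR_conv_of_real)
    finally have e: "(LINT \<omega>|M. F (Suc n) (\<lambda>k. X k \<omega>)) = (LINT \<omega>|M. F n (\<lambda>k. X k \<omega>) * w (X n \<omega>))" .
    have int1: "integrable M (\<lambda>\<omega>. F n (\<lambda>k. X k \<omega>))"
      by (rule adapted_integrable[OF adaptedI]) (rule F_cong)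
    have int2: "integrable M (\<lambda>\<omega>. F n (\<lambda>k. X k \<omega>) * w (X n \<omega>))"
    proof (rule adapted_integrable[of n "\<lambda>x. F n x * w (x n)"], rule adaptedI)
      fix x y :: "nat \<Rightarrow> nat" assume eq: "\<And>k. k \<le> n \<Longrightarrow> x k = y k"
      show "F n x * w (x n) = F n y * w (y n)" using F_cong[OF eq] eq[of n] by simp
    qed
    have "(LINT \<omega>|M. F (Suc n) (\<lambda>k. X k \<omega>)) - (LINT \<omega>|M. F n (\<lambda>k. X k \<omega>))
        = (LINT \<omega>|M. F n (\<lambda>k. X k \<omega>) * (w (X n \<omega>) - 1))"
      unfolding e using int1 int2 by (simp add: right_diff_distrib)
    also have "norm \<dots> \<le> (LINT \<omega>|M. exp (\<theta>\<^sup>2 / 2 * b\<^sup>2 * real n) * ?c)"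
    proof (rule norm_integral_le)
      show "integrable M (\<lambda>\<omega>. F n (\<lambda>k. X k \<omega>) * (w (X n \<omega>) - 1))"
        using int1 int2 by (simp add: right_diff_distrib)
      fix \<omega> assume w: "\<omega> \<in> space M"
      have "(\<Sum>m<n. ?g (X m \<omega>)) \<le> (\<Sum>m<n. b\<^sup>2)"
        by (intro sum_mono increment_variance_bounds(2)[OF \<xi>] X_less[OF w])
      then have "\<theta>\<^sup>2 / 2 * (\<Sum>m<n. ?g (X m \<omega>)) \<le> \<theta>\<^sup>2 / 2 * (b\<^sup>2 * real n)"
        by (intro mult_left_mono) (simp_all add: mult.commute)
      then have "norm (F n (\<lambda>k. X k \<omega>)) \<le> exp (\<theta>\<^sup>2 / 2 * b\<^sup>2 * real n)"
        by (simp add: F_def norm_mult mult.assoc)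
      moreover have "norm (w (X n \<omega>) - 1) \<le> ?c"
        unfolding w_def by (rule one_step_characteristic[OF \<xi> assms(2) X_less[OF w] \<theta>])
      ultimately show "norm (F n (\<lambda>k. X k \<omega>) * (w (X n \<omega>) - 1)) \<le> exp (\<theta>\<^sup>2 / 2 * b\<^sup>2 * real n) * ?c"
        unfolding norm_mult by (intro mult_mono) auto
    qed simp
    also have "\<dots> = exp (\<theta>\<^sup>2 / 2 * b\<^sup>2 * real n) * ?c" by (simp add: prob_space)
    finally show ?thesis .
  qed
  have "norm ((LINT \<omega>|M. F n (\<lambda>k. X k \<omega>)) - 1) \<le> real n * (exp (\<theta>\<^sup>2 / 2 * b\<^sup>2 * real n) * ?c)" for n
  proof (induction n)
    case 0
    then show ?case by (simp add: F_def path_sum_def prob_space)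
  next
    case (Suc n)
    let ?E = "\<lambda>n. exp (\<theta>\<^sup>2 / 2 * b\<^sup>2 * real n) * ?c"
    have mono: "?E n \<le> ?E (Suc n)" using c0 by (intro mult_right_mono) (auto intro!: mult_left_mono)
    have "norm ((LINT \<omega>|M. F (Suc n) (\<lambda>k. X k \<omega>)) - 1) \<le> ?E n + real n * ?E n"
      using step[of n] Suc norm_triangle_ineq[of "(LINT \<omega>|M. F (Suc n) (\<lambda>k. X k \<omega>)) - (LINT \<omega>|M. F n (\<lambda>k. X k \<omega>))" "(LINT \<omega>|M. F n (\<lambda>k. X k \<omega>)) - 1"]
      by simp
    also have "\<dots> = real (Suc n) * ?E n" by (simp add: algebra_simps)
    also have "\<dots> \<le> real (Suc n) * ?E (Suc n)" using mono by (intro mult_left_mono) auto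
    finally show ?case .
  qed
  then show ?thesis by (simp only: F_def)
qed

text \<open>
  The compensator in \<open>tilted_characteristic\<close> is close to the constant \<open>exp (t\<^sup>2 v / 2)\<close>, where \<open>v\<close> is the
  stationary mean of the conditional variance; exchanging the two costs \<open>O(1 / sqrt n)\<close> in mean.
\<close>

lemma martingale_clt:
  assumes irr: "irreducible_mat s P" and stat: "stationary_row s P \<pi>"
    and \<xi>: "martingale_increment \<xi> b" and "0 \<le> b"
  shows "(\<lambda>n. LINT \<omega>|M. iexp (t * (path_sum \<xi> n (\<lambda>k. X k \<omega>) / sqrt (real n))))
    \<longlonglongrightarrow> of_real (exp (- (t\<^sup>2 / 2 * (\<Sum>i<s. \<pi> $$ (0, i) * increment_variance \<xi> i))))"
proof -
  let ?g = "increment_variance \<xi>"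
  define v where "v = (\<Sum>i<s. \<pi> $$ (0, i) * ?g i)"
  obtain C where C: "C \<ge> 0"
    "\<And>n. (LINT \<omega>|M. ((\<Sum>m<n. ?g (X m \<omega>)) - real n * v)\<^sup>2) \<le> C * real (Suc n)"
    using ergodic_second_moment[OF irr stat, of ?g] unfolding v_def by blast
  let ?Y = "\<lambda>n \<omega>. iexp (t * (path_sum \<xi> n (\<lambda>k. X k \<omega>) / sqrt (real n)))"
  let ?D = "\<lambda>n \<omega>. (\<Sum>m<n. ?g (X m \<omega>)) - real n * v"
  define K where "K = exp (t\<^sup>2 / 2 * b\<^sup>2) * (exp (t\<^sup>2 / 2 * b\<^sup>2) * (b ^ 3 + \<bar>t\<bar> * b ^ 4) * \<bar>t\<bar> ^ 3)"
  define L where "L = t\<^sup>2 / 2 * exp (t\<^sup>2 / 2 * b\<^sup>2) * (1 + 2 * C)"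
  have v_le: "v \<le> b\<^sup>2"
  proof -
    have pi: "\<And>i. i < s \<Longrightarrow> 0 \<le> \<pi> $$ (0, i)" "(\<Sum>i<s. \<pi> $$ (0, i)) = 1"
      using stat by (auto simp: stationary_row_def probability_row_def)
    have "v \<le> (\<Sum>i<s. \<pi> $$ (0, i) * b\<^sup>2)"
      unfolding v_def using pi(1) increment_variance_bounds(2)[OF \<xi>]
      by (intro sum_mono mult_left_mono) auto
    then show ?thesis using pi(2) by (simp flip: sum_distrib_right)
  qed
  have bound: "norm (of_real (exp (t\<^sup>2 / 2 * v)) * (LINT \<omega>|M. ?Y n \<omega>) - 1) \<le> (K + L) / sqrt (real n)"
    if n: "n \<ge> 1" for n
  proof -
    let ?\<theta> = "t / sqrt (real n)"
    let ?Z = "\<lambda>\<omega>. of_real (exp (?\<theta>\<^sup>2 / 2 * (\<Sum>m<n. ?g (X m \<omega>)))) * ?Y n \<omega>"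
    have sn: "sqrt (real n) \<ge> 1" using n by simp
    have sn2: "?\<theta>\<^sup>2 * real n = t\<^sup>2" using n by (simp add: power_divide)
    have \<theta>: "\<bar>?\<theta>\<bar> \<le> \<bar>t\<bar>" using sn by (simp add: abs_divide divide_le_eq mult_le_cancel_left1)
    have \<theta>3: "real n * \<bar>?\<theta>\<bar> ^ 3 = \<bar>t\<bar> ^ 3 / sqrt (real n)"
      using n by (simp add: power_divide power3_eq_cube abs_divide field_simps)
    have Z1: "norm ((LINT \<omega>|M. ?Z \<omega>) - 1) \<le> K / sqrt (real n)"
    proof -
      have "norm ((LINT \<omega>|M. ?Z \<omega>) - 1) \<le> real n * (exp (?\<theta>\<^sup>2 / 2 * b\<^sup>2 * real n) * (exp (\<bar>t\<bar>\<^sup>2 / 2 * b\<^sup>2) * (b ^ 3 + \<bar>t\<bar> * b ^ 4) * \<bar>?\<theta>\<bar> ^ 3))"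
        using tilted_characteristic[OF \<xi> \<open>0 \<le> b\<close> \<theta>, of n] by simp
      also have "\<dots> = exp (?\<theta>\<^sup>2 * real n / 2 * b\<^sup>2) * (exp (t\<^sup>2 / 2 * b\<^sup>2) * (b ^ 3 + \<bar>t\<bar> * b ^ 4) * (real n * \<bar>?\<theta>\<bar> ^ 3))"
        by (simp add: mult_ac)
      also have "\<dots> = K / sqrt (real n)" unfolding sn2 \<theta>3 by (simp add: K_def)
      finally show ?thesis .
    qed
    have intY: "integrable M (?Y n)"
      by (rule adapted_integrable[OF adapted_path_sum[of n "\<lambda>y. iexp (t * (y / sqrt (real n)))"]])
    have intZ: "integrable M ?Z"
    proof (rule adapted_integrable[of n "\<lambda>x. of_real (exp (?\<theta>\<^sup>2 / 2 * (\<Sum>m<n. ?g (x m)))) * iexp (t * (path_sum \<xi> n x / sqrt (real n)))"], rule adaptedI)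
      fix x y :: "nat \<Rightarrow> nat" assume eq: "\<And>k. k \<le> n \<Longrightarrow> x k = y k"
      have "(\<Sum>m<n. ?g (x m)) = (\<Sum>m<n. ?g (y m))" using eq by simp
      then show "of_real (exp (?\<theta>\<^sup>2 / 2 * (\<Sum>m<n. ?g (x m)))) * iexp (t * (path_sum \<xi> n x / sqrt (real n)))
          = of_real (exp (?\<theta>\<^sup>2 / 2 * (\<Sum>m<n. ?g (y m)))) * iexp (t * (path_sum \<xi> n y / sqrt (real n)))"
        using path_sum_cong[OF eq, where \<xi> = \<xi>] by simp
    qed
    have intD: "integrable M (\<lambda>\<omega>. (?D n \<omega>)\<^sup>2)"
      using adapted_integrable[OF adapted_path_sum[of n "\<lambda>y. (y - real n * v)\<^sup>2" "\<lambda>i _. ?g i"]]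
      by (simp add: path_sum_def)
    let ?d = "\<lambda>\<omega>. t\<^sup>2 / 2 * exp (t\<^sup>2 / 2 * b\<^sup>2) * (1 / sqrt (real n) + (?D n \<omega>)\<^sup>2 / (real n * sqrt (real n)))"
    have "norm (of_real (exp (t\<^sup>2 / 2 * v)) * (LINT \<omega>|M. ?Y n \<omega>) - (LINT \<omega>|M. ?Z \<omega>))
        = norm (LINT \<omega>|M. of_real (exp (t\<^sup>2 / 2 * v)) * ?Y n \<omega> - ?Z \<omega>)"
      using intY intZ by simp
    also have "\<dots> \<le> (LINT \<omega>|M. ?d \<omega>)"
    proof (rule norm_integral_le)
      fix \<omega> assume w: "\<omega> \<in> space M"
      let ?G = "\<Sum>m<n. ?g (X m \<omega>)"
      have G: "?G \<le> b\<^sup>2 * real n"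
        using sum_mono[of "{..<n}" "\<lambda>m. ?g (X m \<omega>)" "\<lambda>_. b\<^sup>2"] increment_variance_bounds(2)[OF \<xi> X_less[OF w]]
        by (simp add: mult.commute)
      have "?\<theta>\<^sup>2 / 2 * ?G \<le> ?\<theta>\<^sup>2 / 2 * (b\<^sup>2 * real n)" using G by (intro mult_left_mono) auto
      also have "\<dots> = ?\<theta>\<^sup>2 * real n / 2 * b\<^sup>2" by simp
      finally have le1: "?\<theta>\<^sup>2 / 2 * ?G \<le> t\<^sup>2 / 2 * b\<^sup>2" unfolding sn2 .
      have le2: "t\<^sup>2 / 2 * v \<le> t\<^sup>2 / 2 * b\<^sup>2" using v_le by (intro mult_left_mono) auto
      have diff: "t\<^sup>2 / 2 * v - ?\<theta>\<^sup>2 / 2 * ?G = - (t\<^sup>2 / 2 * (?D n \<omega> / real n))"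
        using n by (simp add: power_divide field_simps)
      \<comment> \<open>The inequality of arithmetic and geometric means turns the first moment of the deviation
        into its second moment, which is of order \<open>n\<close>.\<close>
      have amgm: "\<bar>?D n \<omega> / real n\<bar> \<le> 1 / sqrt (real n) + (?D n \<omega>)\<^sup>2 / (real n * sqrt (real n))"
      proof -
        have "2 * \<bar>?D n \<omega> / sqrt (real n)\<bar> \<le> 1 + (?D n \<omega>)\<^sup>2 / real n"
          using sum_squares_bound[of 1 "\<bar>?D n \<omega> / sqrt (real n)\<bar>"] n by (simp add: power_divide)
        moreover have "x \<le> y" if "2 * x \<le> y" "0 \<le> x" for x y :: real using that by linarith
        ultimately have "\<bar>?D n \<omega> / sqrt (real n)\<bar> \<le> 1 + (?D n \<omega>)\<^sup>2 / real n" by (metis abs_ge_zero)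
        then have "\<bar>?D n \<omega> / sqrt (real n)\<bar> / sqrt (real n) \<le> (1 + (?D n \<omega>)\<^sup>2 / real n) / sqrt (real n)"
          using sn by (intro divide_right_mono) auto
        then show ?thesis by (simp add: abs_divide add_divide_distrib)
      qed
      have "norm (of_real (exp (t\<^sup>2 / 2 * v)) * ?Y n \<omega> - ?Z \<omega>) = \<bar>exp (t\<^sup>2 / 2 * v) - exp (?\<theta>\<^sup>2 / 2 * ?G)\<bar>"
        by (simp only: left_diff_distrib[symmetric] norm_mult of_real_diff[symmetric] norm_of_real norm_exp_i_times mult_1_right)
      also have "\<dots> \<le> exp (t\<^sup>2 / 2 * b\<^sup>2) * \<bar>t\<^sup>2 / 2 * v - ?\<theta>\<^sup>2 / 2 * ?G\<bar>"
        by (rule abs_exp_diff_le[OF le2 le1])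
      also have "\<dots> = t\<^sup>2 / 2 * exp (t\<^sup>2 / 2 * b\<^sup>2) * \<bar>?D n \<omega> / real n\<bar>"
        unfolding diff by (simp add: abs_mult)
      also have "\<dots> \<le> ?d \<omega>" using amgm by (intro mult_left_mono) auto
      finally show "norm (of_real (exp (t\<^sup>2 / 2 * v)) * ?Y n \<omega> - ?Z \<omega>) \<le> ?d \<omega>" .
    qed (use intY intZ intD in auto)
    also have "\<dots> = t\<^sup>2 / 2 * exp (t\<^sup>2 / 2 * b\<^sup>2) * (1 / sqrt (real n) + (LINT \<omega>|M. (?D n \<omega>)\<^sup>2) / (real n * sqrt (real n)))"
      using intD by (simp add: prob_space)
    also have "\<dots> \<le> t\<^sup>2 / 2 * exp (t\<^sup>2 / 2 * b\<^sup>2) * (1 / sqrt (real n) + 2 * C / sqrt (real n))"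
    proof (intro mult_left_mono add_left_mono)
      have "(LINT \<omega>|M. (?D n \<omega>)\<^sup>2) \<le> C * (2 * real n)"
        using C(2)[of n] C(1) n by (elim order.trans) (intro mult_left_mono, auto)
      then have "(LINT \<omega>|M. (?D n \<omega>)\<^sup>2) / (real n * sqrt (real n)) \<le> C * (2 * real n) / (real n * sqrt (real n))"
        by (intro divide_right_mono) auto
      also have "\<dots> = 2 * C / sqrt (real n)" using n by simp
      finally show "(LINT \<omega>|M. (?D n \<omega>)\<^sup>2) / (real n * sqrt (real n)) \<le> 2 * C / sqrt (real n)" .
    qed simp
    also have "\<dots> = L / sqrt (real n)" by (simp only: L_def add_divide_distrib distrib_left times_divide_eq_right mult_1_right)
    finally have "norm (of_real (exp (t\<^sup>2 / 2 * v)) * (LINT \<omega>|M. ?Y n \<omega>) - (LINT \<omega>|M. ?Z \<omega>)) \<le> L / sqrt (real n)" .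
    then show ?thesis using Z1
      norm_triangle_ineq[of "of_real (exp (t\<^sup>2 / 2 * v)) * (LINT \<omega>|M. ?Y n \<omega>) - (LINT \<omega>|M. ?Z \<omega>)" "(LINT \<omega>|M. ?Z \<omega>) - 1"]
      by (simp add: add_divide_distrib)
  qed
  have "(\<lambda>n. of_real (exp (t\<^sup>2 / 2 * v)) * (LINT \<omega>|M. ?Y n \<omega>) - 1) \<longlonglongrightarrow> 0"
  proof (rule Lim_null_comparison)
    show "\<forall>\<^sub>F n in sequentially. norm (of_real (exp (t\<^sup>2 / 2 * v)) * (LINT \<omega>|M. ?Y n \<omega>) - 1) \<le> (K + L) / sqrt (real n)"
      using bound by (intro eventually_sequentiallyI[of 1])
    show "(\<lambda>n. (K + L) / sqrt (real n)) \<longlonglongrightarrow> 0" by real_asymp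
  qed
  then have "(\<lambda>n. of_real (exp (- (t\<^sup>2 / 2 * v))) * (of_real (exp (t\<^sup>2 / 2 * v)) * (LINT \<omega>|M. ?Y n \<omega>) - 1) + of_real (exp (- (t\<^sup>2 / 2 * v))))
      \<longlonglongrightarrow> of_real (exp (- (t\<^sup>2 / 2 * v))) * 0 + of_real (exp (- (t\<^sup>2 / 2 * v)))"
    by (intro tendsto_intros)
  moreover have "of_real (exp (- (t\<^sup>2 / 2 * v))) * (of_real (exp (t\<^sup>2 / 2 * v)) * z - 1) + of_real (exp (- (t\<^sup>2 / 2 * v))) = z" for z :: complex
    by (simp add: right_diff_distrib mult.assoc[symmetric] exp_minus flip: of_real_mult)
  ultimately show ?thesis by (simp only: v_def[symmetric] mult_zero_right add_0_left)
qed

section \<open>Transition counts and the empirical matrix\<close>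

lemma martingale_increment_bounded:
  assumes "\<And>i. i < s \<Longrightarrow> (\<Sum>j<s. P $$ (i, j) * \<xi> i j) = 0"
  shows "\<exists>b\<ge>0. martingale_increment \<xi> b"
proof (intro exI conjI)
  let ?b = "\<Sum>i<s. \<Sum>j<s. \<bar>\<xi> i j\<bar>"
  show "0 \<le> ?b" by (intro sum_nonneg) auto
  have "\<bar>\<xi> i j\<bar> \<le> ?b" if "i < s" "j < s" for i j
  proof -
    have "\<bar>\<xi> i j\<bar> \<le> (\<Sum>j<s. \<bar>\<xi> i j\<bar>)" using that by (intro member_le_sum) auto
    also have "\<dots> \<le> ?b" using that by (intro member_le_sum[of i _ "\<lambda>i. \<Sum>j<s. \<bar>\<xi> i j\<bar>"] sum_nonneg) auto
    finally show ?thesis .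
  qed
  then show "martingale_increment \<xi> ?b" using assms by (simp add: martingale_increment_def)
qed

lemma transition_count_sum:
  "real (transition_count X n \<omega> i j) = (\<Sum>m<n. of_bool (X m \<omega> = i \<and> X (Suc m) \<omega> = j))"
proof -
  have "{m. m < n \<and> X m \<omega> = i \<and> X (Suc m) \<omega> = j} = {m \<in> {..<n}. X m \<omega> = i \<and> X (Suc m) \<omega> = j}" by auto
  then show ?thesis by (simp add: transition_count_def of_bool_def sum.If_cases Int_def)
qed

lemma visit_count_sum:
  assumes "\<omega> \<in> space M"
  shows "real (visit_count s X n \<omega> i) = (\<Sum>m<n. of_bool (X m \<omega> = i))"
proof -
  have "real (visit_count s X n \<omega> i) = (\<Sum>m<n. \<Sum>j<s. of_bool (X m \<omega> = i \<and> X (Suc m) \<omega> = j))"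
    unfolding visit_count_def of_nat_sum transition_count_sum by (rule sum.swap)
  also have "\<dots> = (\<Sum>m<n. of_bool (X m \<omega> = i))"
  proof (rule sum.cong[OF refl])
    fix m
    have "(\<Sum>j<s. of_bool (X m \<omega> = i \<and> X (Suc m) \<omega> = j)) = (\<Sum>j<s. if X (Suc m) \<omega> = j then of_bool (X m \<omega> = i) else 0 :: real)"
      by (intro sum.cong) auto
    then show "(\<Sum>j<s. of_bool (X m \<omega> = i \<and> X (Suc m) \<omega> = j)) = (of_bool (X m \<omega> = i) :: real)"
      using X_less[OF assms] by simp
  qed
  finally show ?thesis .
qed

definition transition_noise :: "nat \<Rightarrow> nat \<Rightarrow> nat \<Rightarrow> nat \<Rightarrow> real" where
  "transition_noise i j k l = of_bool (k = i) * (of_bool (l = j) - P $$ (i, j))"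

lemma transition_noise_increment:
  assumes "i < s" "j < s"
  shows "martingale_increment (transition_noise i j) 1"
  unfolding martingale_increment_def
proof (intro conjI allI impI)
  fix k assume k: "k < s"
  show "(\<Sum>l<s. P $$ (k, l) * transition_noise i j k l) = 0"
    using assms k P_row_sum[OF assms(1)]
    by (simp add: transition_noise_def of_bool_def right_diff_distrib sum_subtractf
        if_distrib[of "\<lambda>x. _ * x"] flip: sum_distrib_right cong: if_cong)
  fix l
  have "P $$ (i, j) \<le> (\<Sum>j<s. P $$ (i, j))"
    using assms P_nonneg[OF assms(1)] by (intro member_le_sum) auto
  then have "P $$ (i, j) \<le> 1" using P_row_sum[OF assms(1)] by simp
  then show "\<bar>transition_noise i j k l\<bar> \<le> 1"
    using P_nonneg[OF assms] by (simp add: transition_noise_def)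
qed

lemma path_sum_transition_noise:
  assumes "\<omega> \<in> space M"
  shows "path_sum (transition_noise i j) n (\<lambda>k. X k \<omega>)
    = real (transition_count X n \<omega> i j) - P $$ (i, j) * real (visit_count s X n \<omega> i)"
proof -
  have "path_sum (transition_noise i j) n (\<lambda>k. X k \<omega>)
      = (\<Sum>m<n. of_bool (X m \<omega> = i \<and> X (Suc m) \<omega> = j) - P $$ (i, j) * of_bool (X m \<omega> = i))"
    unfolding path_sum_def by (intro sum.cong) (auto simp: transition_noise_def)
  then show ?thesis
    unfolding transition_count_sum visit_count_sum[OF assms] by (simp add: sum_subtractf sum_distrib_left)
qed

text \<open>
  One nonnegative quantity that controls every error term: it dominates the squares of the deviations of
  the visit frequencies and of the centered transition frequencies, and hence also their products.
\<close>

definition fluctuation :: "real mat \<Rightarrow> nat \<Rightarrow> 'w \<Rightarrow> real" where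
  "fluctuation \<pi> n \<omega> = (\<Sum>i<s. (real (visit_count s X n \<omega> i) / real n - \<pi> $$ (0, i))\<^sup>2)
     + (\<Sum>i<s. \<Sum>j<s. (path_sum (transition_noise i j) n (\<lambda>k. X k \<omega>) / real n)\<^sup>2)"

lemma expectation_fluctuation:
  assumes irr: "irreducible_mat s P" and stat: "stationary_row s P \<pi>"
  obtains C where "0 \<le> C" "\<And>n. 1 \<le> n \<Longrightarrow> integrable M (fluctuation \<pi> n)"
    "\<And>n. 1 \<le> n \<Longrightarrow> (LINT \<omega>|M. fluctuation \<pi> n \<omega>) \<le> C / real n"
proof -
  have "\<exists>C\<ge>0. \<forall>n. (LINT \<omega>|M. ((\<Sum>m<n. of_bool (X m \<omega> = i)) - real n * \<pi> $$ (0, i))\<^sup>2) \<le> C * real (Suc n)"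
    if "i < s" for i
  proof -
    have "(\<Sum>k<s. \<pi> $$ (0, k) * of_bool (k = i)) = \<pi> $$ (0, i)"
      using that by (simp add: of_bool_def if_distrib[of "\<lambda>x. _ * x"] cong: if_cong)
    then show ?thesis
      using ergodic_second_moment[OF irr stat, of "\<lambda>k. of_bool (k = i)"] by (simp only:)
  qed
  then obtain K where K: "\<And>i. i < s \<Longrightarrow> 0 \<le> K i" "\<And>i n. i < s \<Longrightarrow>
      (LINT \<omega>|M. ((\<Sum>m<n. of_bool (X m \<omega> = i)) - real n * \<pi> $$ (0, i))\<^sup>2) \<le> K i * real (Suc n)" by metis
  let ?V = "\<lambda>n i \<omega>. (real (visit_count s X n \<omega> i) / real n - \<pi> $$ (0, i))\<^sup>2"
  let ?T = "\<lambda>n i j \<omega>. (path_sum (transition_noise i j) n (\<lambda>k. X k \<omega>) / real n)\<^sup>2"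
  have V: "integrable M (?V n i) \<and> (LINT \<omega>|M. ?V n i \<omega>) \<le> 2 * K i / real n" if "i < s" and n: "1 \<le> n" for n i
  proof -
    have V_eq: "?V n i \<omega> = ((\<Sum>m<n. of_bool (X m \<omega> = i)) - real n * \<pi> $$ (0, i))\<^sup>2 / (real n)\<^sup>2" if "\<omega> \<in> space M" for \<omega>
      unfolding visit_count_sum[OF that] power_divide[symmetric] using n by (simp add: diff_divide_distrib)
    have int: "integrable M (\<lambda>\<omega>. ((\<Sum>m<n. of_bool (X m \<omega> = i)) - real n * \<pi> $$ (0, i))\<^sup>2)"
      using adapted_integrable[OF adapted_path_sum[of n "\<lambda>y. (y - real n * \<pi> $$ (0, i))\<^sup>2" "\<lambda>k _. of_bool (k = i)"]]
      by (simp add: path_sum_def)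
    have "(LINT \<omega>|M. ?V n i \<omega>) = (LINT \<omega>|M. ((\<Sum>m<n. of_bool (X m \<omega> = i)) - real n * \<pi> $$ (0, i))\<^sup>2) / (real n)\<^sup>2"
      by (simp add: V_eq cong: Bochner_Integration.integral_cong)
    also have "\<dots> \<le> K i * (2 * real n) / (real n)\<^sup>2"
      using n K(1)[OF \<open>i < s\<close>] by (intro divide_right_mono order.trans[OF K(2)[OF \<open>i < s\<close>]] mult_left_mono) auto
    also have "\<dots> = 2 * K i / real n" by (simp add: power2_eq_square)
    finally show ?thesis using int by (simp add: V_eq cong: Bochner_Integration.integrable_cong)
  qed
  have T: "integrable M (?T n i j) \<and> (LINT \<omega>|M. ?T n i j \<omega>) \<le> 1 / real n" if "i < s" "j < s" and n: "1 \<le> n" for n i j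
  proof -
    have "integrable M (?T n i j)"
      using adapted_integrable[OF adapted_path_sum[of n "\<lambda>y. (y / real n)\<^sup>2" "transition_noise i j"]] .
    moreover have "(LINT \<omega>|M. ?T n i j \<omega>) = (LINT \<omega>|M. (path_sum (transition_noise i j) n (\<lambda>k. X k \<omega>))\<^sup>2) / (real n)\<^sup>2"
      by (simp add: power_divide)
    moreover have "\<dots> \<le> real n / (real n)\<^sup>2"
      using martingale_second_moment[OF transition_noise_increment[OF that(1,2)], of n] by (intro divide_right_mono) auto
    ultimately show ?thesis using n by (simp add: power2_eq_square)
  qed
  show thesis
  proof (rule that[of "(\<Sum>i<s. 2 * K i) + real s * real s"])
    show "0 \<le> (\<Sum>i<s. 2 * K i) + real s * real s" using K(1) by (intro add_nonneg_nonneg sum_nonneg) auto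
    fix n :: nat assume n: "1 \<le> n"
    have iV: "integrable M (\<lambda>\<omega>. \<Sum>i<s. ?V n i \<omega>)"
      using V n by (intro Bochner_Integration.integrable_sum) auto
    have iT: "integrable M (\<lambda>\<omega>. \<Sum>i<s. \<Sum>j<s. ?T n i j \<omega>)"
      using T n by (intro Bochner_Integration.integrable_sum) auto
    show "integrable M (fluctuation \<pi> n)"
      unfolding fluctuation_def using iV iT by (intro Bochner_Integration.integrable_add)
    have "(LINT \<omega>|M. fluctuation \<pi> n \<omega>) = (LINT \<omega>|M. (\<Sum>i<s. ?V n i \<omega>)) + (LINT \<omega>|M. (\<Sum>i<s. \<Sum>j<s. ?T n i j \<omega>))"
      unfolding fluctuation_def using iV iT by (rule Bochner_Integration.integral_add)
    also have "(LINT \<omega>|M. (\<Sum>i<s. ?V n i \<omega>)) = (\<Sum>i<s. (LINT \<omega>|M. ?V n i \<omega>))"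
      by (rule Bochner_Integration.integral_sum) (use V n in auto)
    also have "(LINT \<omega>|M. (\<Sum>i<s. \<Sum>j<s. ?T n i j \<omega>)) = (\<Sum>i<s. (LINT \<omega>|M. (\<Sum>j<s. ?T n i j \<omega>)))"
      by (rule Bochner_Integration.integral_sum) (use T n in \<open>auto intro!: Bochner_Integration.integrable_sum\<close>)
    also have "\<dots> = (\<Sum>i<s. \<Sum>j<s. (LINT \<omega>|M. ?T n i j \<omega>))"
      by (intro sum.cong refl Bochner_Integration.integral_sum) (use T n in auto)
    also have "(\<Sum>i<s. (LINT \<omega>|M. ?V n i \<omega>)) + (\<Sum>i<s. \<Sum>j<s. (LINT \<omega>|M. ?T n i j \<omega>))
        \<le> (\<Sum>i<s. 2 * K i / real n) + (\<Sum>i<s. \<Sum>j<s. 1 / real n)"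
      using V T n by (intro add_mono sum_mono) auto
    also have "\<dots> = ((\<Sum>i<s. 2 * K i) + real s * real s) / real n"
      by (simp add: add_divide_distrib sum_divide_distrib)
    finally show "(LINT \<omega>|M. fluctuation \<pi> n \<omega>) \<le> ((\<Sum>i<s. 2 * K i) + real s * real s) / real n" .
  qed
qed

lemma fluctuation_nonneg: "0 \<le> fluctuation \<pi> n \<omega>"
  by (auto simp: fluctuation_def intro!: add_nonneg_nonneg sum_nonneg)

text \<open>
  When the fluctuation \<open>Q\<close> exceeds \<open>\<eta>\<close>, the two exponentials differ by at most \<open>2 \<le> 2 Q / \<eta>\<close>, which is
  Chebyshev's argument. So the difference of the expectations is at most a multiple of \<open>sqrt n\<close> times the
  expected fluctuation \<open>O(1 / n)\<close> on all of the space.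
\<close>

lemma characteristic_approximation:
  assumes irr: "irreducible_mat s P" and stat: "stationary_row s P \<pi>"
    and Y: "\<And>n. random_variable borel (Y n)" and T: "\<And>n. random_variable borel (T n)"
    and pos: "0 < \<eta>" "0 \<le> K"
    and close: "\<And>n \<omega>. 1 \<le> n \<Longrightarrow> \<omega> \<in> space M \<Longrightarrow> fluctuation \<pi> n \<omega> \<le> \<eta> \<Longrightarrow>
      \<bar>Y n \<omega> - T n \<omega>\<bar> \<le> K * sqrt (real n) * fluctuation \<pi> n \<omega>"
    and lim: "(\<lambda>n. LINT \<omega>|M. iexp (t * T n \<omega>)) \<longlonglongrightarrow> l"
  shows "(\<lambda>n. LINT \<omega>|M. iexp (t * Y n \<omega>)) \<longlonglongrightarrow> l"
proof -
  obtain C where C: "0 \<le> C" "\<And>n. 1 \<le> n \<Longrightarrow> integrable M (fluctuation \<pi> n)"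
    "\<And>n. 1 \<le> n \<Longrightarrow> (LINT \<omega>|M. fluctuation \<pi> n \<omega>) \<le> C / real n"
    using expectation_fluctuation[OF irr stat] by blast
  have intY: "integrable M (\<lambda>\<omega>. iexp (t * Z \<omega>))" if "random_variable borel Z" for Z :: "'w \<Rightarrow> real"
    by (rule integrable_const_bound[of _ 1]) (use that in auto)
  have bound: "norm ((LINT \<omega>|M. iexp (t * Y n \<omega>)) - (LINT \<omega>|M. iexp (t * T n \<omega>)))
      \<le> (2 / \<eta> + \<bar>t\<bar> * K * sqrt (real n)) * (C / real n)" if n: "1 \<le> n" for n
  proof -
    let ?Q = "fluctuation \<pi> n"
    have "norm ((LINT \<omega>|M. iexp (t * Y n \<omega>)) - (LINT \<omega>|M. iexp (t * T n \<omega>)))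
        = norm (LINT \<omega>|M. iexp (t * Y n \<omega>) - iexp (t * T n \<omega>))"
      using intY[OF Y[of n]] intY[OF T[of n]] by simp
    also have "\<dots> \<le> (LINT \<omega>|M. (2 / \<eta> + \<bar>t\<bar> * K * sqrt (real n)) * ?Q \<omega>)"
    proof (rule norm_integral_le)
      fix \<omega> assume w: "\<omega> \<in> space M"
      have Q0: "0 \<le> ?Q \<omega>" by (rule fluctuation_nonneg)
      have nn: "0 \<le> 2 / \<eta> * ?Q \<omega>" "0 \<le> \<bar>t\<bar> * K * sqrt (real n) * ?Q \<omega>" using Q0 pos by auto
      show "norm (iexp (t * Y n \<omega>) - iexp (t * T n \<omega>)) \<le> (2 / \<eta> + \<bar>t\<bar> * K * sqrt (real n)) * ?Q \<omega>"
      proof (cases "?Q \<omega> \<le> \<eta>")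
        case True
        have "norm (iexp (t * Y n \<omega>) - iexp (t * T n \<omega>)) = norm (iexp (t * Y n \<omega> - t * T n \<omega>) - 1)"
        proof -
          have "iexp (t * Y n \<omega>) - iexp (t * T n \<omega>) = iexp (t * T n \<omega>) * (iexp (t * Y n \<omega> - t * T n \<omega>) - 1)"
            by (simp add: right_diff_distrib exp_diff)
          then show ?thesis by (simp only: norm_mult norm_exp_i_times mult_1)
        qed
        also have "\<dots> \<le> \<bar>t * Y n \<omega> - t * T n \<omega>\<bar>"
          using iexp_approx1[of "t * Y n \<omega> - t * T n \<omega>" 0] by simp
        also have "\<dots> = \<bar>t\<bar> * \<bar>Y n \<omega> - T n \<omega>\<bar>" by (simp add: abs_mult flip: right_diff_distrib)
        also have "\<dots> \<le> \<bar>t\<bar> * (K * sqrt (real n) * ?Q \<omega>)"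
          using close[OF n w True] by (intro mult_left_mono) auto
        finally show ?thesis using nn by (simp add: distrib_right mult.assoc)
      next
        case False
        have "norm (iexp (t * Y n \<omega>) - iexp (t * T n \<omega>)) \<le> 2"
          using norm_triangle_ineq4[of "iexp (t * Y n \<omega>)" "iexp (t * T n \<omega>)"] by simp
        also have "2 \<le> 2 / \<eta> * ?Q \<omega>" using False pos by (simp add: field_simps)
        finally show ?thesis using nn by (simp add: distrib_right)
      qed
    qed (use intY[OF Y[of n]] intY[OF T[of n]] C(2)[OF n] in auto)
    also have "\<dots> = (2 / \<eta> + \<bar>t\<bar> * K * sqrt (real n)) * (LINT \<omega>|M. ?Q \<omega>)" by simp
    also have "\<dots> \<le> (2 / \<eta> + \<bar>t\<bar> * K * sqrt (real n)) * (C / real n)"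
      using C(3)[OF n] pos by (intro mult_left_mono) auto
    finally show ?thesis .
  qed
  have "(\<lambda>n. (LINT \<omega>|M. iexp (t * Y n \<omega>)) - (LINT \<omega>|M. iexp (t * T n \<omega>))) \<longlonglongrightarrow> 0"
  proof (rule Lim_null_comparison)
    show "\<forall>\<^sub>F n in sequentially. norm ((LINT \<omega>|M. iexp (t * Y n \<omega>)) - (LINT \<omega>|M. iexp (t * T n \<omega>)))
        \<le> (2 / \<eta> + \<bar>t\<bar> * K * sqrt (real n)) * (C / real n)"
      using bound by (intro eventually_sequentiallyI[of 1])
    show "(\<lambda>n. (2 / \<eta> + \<bar>t\<bar> * K * sqrt (real n)) * (C / real n)) \<longlonglongrightarrow> 0" by real_asymp
  qed
  from tendsto_add[OF this lim] show ?thesis by simp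
qed

text \<open>
  The increments of \<open>n\<close> times the linear part of the estimation error for the functional with the
  coefficients \<open>c\<close>. The division by \<open>\<pi>\<^sub>k\<close> stands for the division by the visit frequency of \<open>k\<close>.
\<close>

definition scaled_noise :: "real mat \<Rightarrow> (nat \<Rightarrow> nat \<Rightarrow> real) \<Rightarrow> nat \<Rightarrow> nat \<Rightarrow> real" where
  "scaled_noise \<pi> c k l = (c k l - (\<Sum>j<s. P $$ (k, j) * c k j)) / \<pi> $$ (0, k)"

lemma scaled_noise_martingale:
  assumes "i < s"
  shows "(\<Sum>j<s. P $$ (i, j) * scaled_noise \<pi> c i j) = 0"
proof -
  have "(\<Sum>j<s. P $$ (i, j) * scaled_noise \<pi> c i j)
      = ((\<Sum>j<s. P $$ (i, j) * c i j) - (\<Sum>j<s. P $$ (i, j)) * (\<Sum>j<s. P $$ (i, j) * c i j)) / \<pi> $$ (0, i)"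
    by (simp add: scaled_noise_def right_diff_distrib sum_subtractf sum_distrib_right flip: sum_divide_distrib)
  then show ?thesis using P_row_sum[OF assms] by simp
qed

text \<open>
  The left-hand sides, summed over the states, are the variance in \<open>martingale_clt\<close>; the right-hand sides
  are what the covariances of \<open>W\<close> give for the functional with the same coefficients.
\<close>

lemma scaled_noise_variance:
  assumes "k < s" "0 < \<pi> $$ (0, k)"
  shows "\<pi> $$ (0, k) * increment_variance (scaled_noise \<pi> c) k
    = inverse (\<pi> $$ (0, k)) * ((\<Sum>j<s. P $$ (k, j) * (c k j)\<^sup>2) - (\<Sum>j<s. P $$ (k, j) * c k j)\<^sup>2)"
proof -
  let ?m = "\<Sum>j<s. P $$ (k, j) * c k j"
  have "(\<Sum>j<s. P $$ (k, j) * (c k j - ?m)\<^sup>2)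
      = (\<Sum>j<s. P $$ (k, j) * (c k j)\<^sup>2) + (\<Sum>j<s. P $$ (k, j)) * ?m\<^sup>2 - (\<Sum>j<s. P $$ (k, j) * c k j) * (2 * ?m)"
    unfolding sum_distrib_right[of "\<lambda>j. P $$ (k, j)"] sum_distrib_right[of "\<lambda>j. P $$ (k, j) * c k j" _ "2 * ?m"]
    by (simp add: power2_diff algebra_simps sum.distrib sum_subtractf)
  then have "(\<Sum>j<s. P $$ (k, j) * (c k j - ?m)\<^sup>2) = (\<Sum>j<s. P $$ (k, j) * (c k j)\<^sup>2) - ?m\<^sup>2"
    using P_row_sum[OF assms(1)] by (simp add: power2_eq_square)
  moreover have "increment_variance (scaled_noise \<pi> c) k = (\<Sum>j<s. P $$ (k, j) * (c k j - ?m)\<^sup>2) / (\<pi> $$ (0, k))\<^sup>2"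
    by (simp add: increment_variance_def scaled_noise_def power_divide flip: sum_divide_distrib)
  ultimately show ?thesis using assms(2) by (simp add: power2_eq_square field_simps)
qed

lemma path_sum_scaled_noise:
  assumes w: "\<omega> \<in> space M"
  shows "path_sum (scaled_noise \<pi> c) n (\<lambda>k. X k \<omega>)
    = (\<Sum>i<s. \<Sum>j<s. c i j * (path_sum (transition_noise i j) n (\<lambda>k. X k \<omega>) / \<pi> $$ (0, i)))"
proof -
  have *: "scaled_noise \<pi> c k l = (\<Sum>i<s. \<Sum>j<s. c i j * (transition_noise i j k l / \<pi> $$ (0, i)))" if "k < s" "l < s" for k l
  proof -
    have "(\<Sum>i<s. \<Sum>j<s. c i j * (transition_noise i j k l / \<pi> $$ (0, i)))
        = (\<Sum>i<s. if k = i then \<Sum>j<s. c i j * ((of_bool (l = j) - P $$ (i, j)) / \<pi> $$ (0, i)) else 0)"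
      by (intro sum.cong refl) (auto simp: transition_noise_def)
    also have "\<dots> = (\<Sum>j<s. c k j * ((of_bool (l = j) - P $$ (k, j)) / \<pi> $$ (0, k)))" using that by simp
    also have "\<dots> = (\<Sum>j<s. (if l = j then c k j / \<pi> $$ (0, k) else 0) - P $$ (k, j) * c k j / \<pi> $$ (0, k))"
      by (intro sum.cong refl) (auto simp: field_simps diff_divide_distrib)
    also have "\<dots> = scaled_noise \<pi> c k l"
      using that by (simp add: scaled_noise_def sum_subtractf diff_divide_distrib sum_divide_distrib)
    finally show ?thesis by simp
  qed
  have "path_sum (scaled_noise \<pi> c) n (\<lambda>k. X k \<omega>)
      = (\<Sum>m<n. \<Sum>i<s. \<Sum>j<s. c i j * (transition_noise i j (X m \<omega>) (X (Suc m) \<omega>) / \<pi> $$ (0, i)))"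
    using *[OF X_less[OF w] X_less[OF w]] by (simp add: path_sum_def)
  also have "\<dots> = (\<Sum>i<s. \<Sum>m<n. \<Sum>j<s. c i j * (transition_noise i j (X m \<omega>) (X (Suc m) \<omega>) / \<pi> $$ (0, i)))"
    by (rule sum.swap)
  also have "\<dots> = (\<Sum>i<s. \<Sum>j<s. \<Sum>m<n. c i j * (transition_noise i j (X m \<omega>) (X (Suc m) \<omega>) / \<pi> $$ (0, i)))"
    by (intro sum.cong refl sum.swap)
  finally show ?thesis by (simp add: path_sum_def sum_distrib_left sum_divide_distrib)
qed

text \<open>
  With \<open>m = (N\<^sub>i\<^sub>j - p\<^sub>i\<^sub>j N\<^sub>i) / n\<close> and \<open>k = N\<^sub>i / n\<close>, the deviation of the empirical entry is \<open>m / k\<close>, and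
  \<open>m / k - m / \<pi>\<^sub>i\<close> is \<open>m (\<pi>\<^sub>i - k) / (k \<pi>\<^sub>i)\<close>, a product of two deviations. The bound on the fluctuation forces \<open>k \<ge> q / 2\<close>; in
  particular the state \<open>i\<close> has been visited.
\<close>

lemma empirical_mat_linearization:
  assumes w: "\<omega> \<in> space M" and n: "1 \<le> n" and i: "i < s" and j: "j < s"
    and q: "0 < q" "q \<le> \<pi> $$ (0, i)" and Q: "fluctuation \<pi> n \<omega> \<le> (q / 2)\<^sup>2"
  shows "\<bar>empirical_mat s X n \<omega> $$ (i, j) - P $$ (i, j)\<bar> \<le> 2 / q * sqrt (fluctuation \<pi> n \<omega>)"
    and "\<bar>empirical_mat s X n \<omega> $$ (i, j) - P $$ (i, j)
      - path_sum (transition_noise i j) n (\<lambda>k. X k \<omega>) / real n / \<pi> $$ (0, i)\<bar> \<le> 2 / q\<^sup>2 * fluctuation \<pi> n \<omega>"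
proof -
  let ?Q = "fluctuation \<pi> n \<omega>" and ?p = "\<pi> $$ (0, i)"
  define k where "k = real (visit_count s X n \<omega> i) / real n"
  define m where "m = path_sum (transition_noise i j) n (\<lambda>k. X k \<omega>) / real n"
  let ?V = "\<lambda>i. (real (visit_count s X n \<omega> i) / real n - \<pi> $$ (0, i))\<^sup>2"
  let ?T = "\<lambda>i j. (path_sum (transition_noise i j) n (\<lambda>k. X k \<omega>) / real n)\<^sup>2"
  have Q0: "0 \<le> ?Q" by (rule fluctuation_nonneg)
  have kmQ: "(k - ?p)\<^sup>2 + m\<^sup>2 \<le> ?Q"
  proof -
    have "(k - ?p)\<^sup>2 \<le> (\<Sum>i<s. ?V i)" unfolding k_def using i by (intro member_le_sum[of i _ ?V]) auto
    moreover have "m\<^sup>2 \<le> (\<Sum>j<s. ?T i j)" unfolding m_def using j by (intro member_le_sum[of j _ "?T i"]) auto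
    moreover have "(\<Sum>j<s. ?T i j) \<le> (\<Sum>i<s. \<Sum>j<s. ?T i j)"
      using i by (intro member_le_sum[of i _ "\<lambda>i. \<Sum>j<s. ?T i j"] sum_nonneg) auto
    ultimately show ?thesis unfolding fluctuation_def by linarith
  qed
  have "(k - ?p)\<^sup>2 \<le> (q / 2)\<^sup>2" using kmQ Q zero_le_power2[of m] by linarith
  then have "\<bar>k - ?p\<bar> \<le> q / 2" using q by (simp only: abs_le_square_iff[symmetric])
  then have kq: "q / 2 \<le> k" using q by linarith
  then have k0: "0 < k" using q by linarith
  have "m\<^sup>2 \<le> ?Q" using kmQ zero_le_power2[of "k - ?p"] by linarith
  then have mQ: "\<bar>m\<bar> \<le> sqrt ?Q" using real_sqrt_le_mono by fastforce
  have vc: "real (visit_count s X n \<omega> i) = k * real n" using n by (simp add: k_def)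
  have "real (transition_count X n \<omega> i j) = m * real n + P $$ (i, j) * (k * real n)"
    using path_sum_transition_noise[OF w, of i j n] n by (simp add: m_def vc)
  then have e: "empirical_mat s X n \<omega> $$ (i, j) - P $$ (i, j) = m / k"
  proof -
    assume tc: "real (transition_count X n \<omega> i j) = m * real n + P $$ (i, j) * (k * real n)"
    have "visit_count s X n \<omega> i \<noteq> 0" using vc k0 n by (metis mult_eq_0_iff of_nat_0 of_nat_eq_0_iff less_irrefl not_one_le_zero)
    then have "empirical_mat s X n \<omega> $$ (i, j) = (m * real n + P $$ (i, j) * (k * real n)) / (k * real n)"
      using i j by (simp add: empirical_mat_def tc vc)
    also have "\<dots> = (m + P $$ (i, j) * k) * real n / (k * real n)" by (simp add: algebra_simps)
    also have "\<dots> = (m + P $$ (i, j) * k) / k" using n by simp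
    finally show ?thesis using k0 by (simp add: add_divide_distrib)
  qed
  have "\<bar>m / k\<bar> \<le> sqrt ?Q / (q / 2)"
    unfolding abs_divide using mQ kq q k0 Q0 by (intro frac_le) auto
  then show "\<bar>empirical_mat s X n \<omega> $$ (i, j) - P $$ (i, j)\<bar> \<le> 2 / q * sqrt ?Q"
    unfolding e by (simp add: mult.commute)
  have p0: "0 < ?p" using q by linarith
  have "m / k - m / ?p = m * (?p - k) / (k * ?p)" using k0 p0 by (simp add: field_simps)
  then have "\<bar>m / k - m / ?p\<bar> = \<bar>m\<bar> * \<bar>k - ?p\<bar> / (k * ?p)" using k0 p0 by (simp add: abs_mult abs_minus_commute)
  also have "\<dots> \<le> ?Q / (q / 2 * q)"
  proof (rule frac_le)
    have "2 * (\<bar>m\<bar> * \<bar>k - ?p\<bar>) \<le> m\<^sup>2 + (k - ?p)\<^sup>2"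
      using sum_squares_bound[of "\<bar>m\<bar>" "\<bar>k - ?p\<bar>"] by (simp add: mult.assoc)
    moreover have "0 \<le> \<bar>m\<bar> * \<bar>k - ?p\<bar>" by simp
    ultimately show "\<bar>m\<bar> * \<bar>k - ?p\<bar> \<le> ?Q" using kmQ by linarith
    show "q / 2 * q \<le> k * ?p" using kq q k0 by (intro mult_mono) auto
  qed (use q Q0 in auto)
  also have "\<dots> = 2 / q\<^sup>2 * ?Q" by (simp add: power2_eq_square)
  finally show "\<bar>empirical_mat s X n \<omega> $$ (i, j) - P $$ (i, j)
      - path_sum (transition_noise i j) n (\<lambda>k. X k \<omega>) / real n / ?p\<bar> \<le> 2 / q\<^sup>2 * ?Q"
    unfolding e m_def[symmetric] .
qed

end

section \<open>Linear functionals of the Gaussian limit\<close>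

context prob_space
begin

lemma normal_law_moments:
  assumes Y [measurable]: "random_variable borel Y"
    and d: "distr M borel Y = normal_law \<mu> \<sigma>" and \<sigma>: "0 \<le> \<sigma>"
  shows "integrable M (\<lambda>\<omega>. (Y \<omega>)\<^sup>2)" and "expectation Y = \<mu>" and "variance Y = \<sigma>\<^sup>2"
    and "\<mu> = 0 \<Longrightarrow> Characteristic_Functions.char (distr M borel Y) t = of_real (exp (- (t\<^sup>2 / 2 * \<sigma>\<^sup>2)))"
proof -
  have char: "Characteristic_Functions.char (distr M borel Y) t = (LINT \<omega>|M. iexp (t * Y \<omega>))"
    unfolding Characteristic_Functions.char_def by (subst integral_distr) auto
  have "integrable M (\<lambda>\<omega>. (Y \<omega>)\<^sup>2) \<and> expectation Y = \<mu> \<and> variance Y = \<sigma>\<^sup>2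
    \<and> (\<mu> = 0 \<longrightarrow> (LINT \<omega>|M. iexp (t * Y \<omega>)) = of_real (exp (- (t\<^sup>2 / 2 * \<sigma>\<^sup>2))))"
  proof (cases "\<sigma> = 0")
    case True
    have "AE x in return borel \<mu>. x = \<mu>" by (subst AE_return) auto
    moreover have "normal_law \<mu> \<sigma> = return borel \<mu>" using True by (simp add: normal_law_def)
    ultimately have "AE x in distr M borel Y. x = \<mu>" by (simp only: d)
    then have ae: "AE \<omega> in M. Y \<omega> = \<mu>" by (rule AE_distrD[OF Y])
    have "integrable M (\<lambda>\<omega>. (Y \<omega>)\<^sup>2)"
      by (subst integrable_cong_AE[of _ _ "\<lambda>_. \<mu>\<^sup>2"]) (use ae in auto)
    moreover have e: "expectation Y = \<mu>"
      by (subst integral_cong_AE[of _ _ "\<lambda>_. \<mu>"]) (use ae in \<open>auto simp: prob_space\<close>)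
    moreover have "variance Y = 0"
      unfolding e by (subst integral_cong_AE[of _ _ "\<lambda>_. 0"]) (use ae in auto)
    moreover have "(LINT \<omega>|M. iexp (t * Y \<omega>)) = 1" if "\<mu> = 0"
      by (subst integral_cong_AE[of _ _ "\<lambda>_. 1"]) (use ae that in \<open>auto simp: prob_space\<close>)
    ultimately show ?thesis using True by simp
  next
    case False
    then have pos: "0 < \<sigma>" using \<sigma> by simp
    have "distr M lborel Y = distr M borel Y" by (rule distr_cong) auto
    then have D: "distributed M lborel Y (normal_density \<mu> \<sigma>)"
      using d False by (simp add: distributed_def normal_law_def)
    have "integrable M (\<lambda>\<omega>. (Y \<omega> - \<mu>)\<^sup>2)"
      using distributed_integrable[OF D, of "\<lambda>x. (x - \<mu>)\<^sup>2"] integrable_normal_moment[OF pos, of \<mu> 2] by simp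
    moreover have "integrable M Y"
      using distributed_integrable[OF D, of "\<lambda>x. x"] integrable_normal_moment_nz_1[OF pos, of \<mu>] by simp
    ultimately have "integrable M (\<lambda>\<omega>. (Y \<omega> - \<mu>)\<^sup>2 + 2 * \<mu> * Y \<omega> - \<mu>\<^sup>2)" by simp
    then have int: "integrable M (\<lambda>\<omega>. (Y \<omega>)\<^sup>2)" by (simp add: power2_eq_square algebra_simps)
    have "(LINT \<omega>|M. iexp (t * Y \<omega>)) = of_real (exp (- (t\<^sup>2 / 2 * \<sigma>\<^sup>2)))" if "\<mu> = 0"
    proof -
      have "distributed M lborel (\<lambda>\<omega>. Y \<omega> / \<sigma>) std_normal_density"
        using D normal_standard_normal_convert[OF pos, of Y \<mu>] that by simp
      then have "distr M lborel (\<lambda>\<omega>. Y \<omega> / \<sigma>) = std_normal_distribution"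
        by (simp add: distributed_def)
      moreover have "(LINT \<omega>|M. iexp (t * Y \<omega>)) = (LINT x|distr M lborel (\<lambda>\<omega>. Y \<omega> / \<sigma>). iexp (t * \<sigma> * x))"
        using False by (subst integral_distr) auto
      ultimately have "(LINT \<omega>|M. iexp (t * Y \<omega>)) = Characteristic_Functions.char std_normal_distribution (t * \<sigma>)"
        by (simp add: Characteristic_Functions.char_def)
      then show ?thesis by (simp add: char_std_normal_distribution power_mult_distrib)
    qed
    then show ?thesis
      using int normal_distributed_expectation[OF pos D] normal_distributed_variance[OF pos D] by simp
  qed
  then show "integrable M (\<lambda>\<omega>. (Y \<omega>)\<^sup>2)" and "expectation Y = \<mu>" and "variance Y = \<sigma>\<^sup>2"
    and "\<mu> = 0 \<Longrightarrow> Characteristic_Functions.char (distr M borel Y) t = of_real (exp (- (t\<^sup>2 / 2 * \<sigma>\<^sup>2)))"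
    unfolding char by auto
qed

lemma integrable_mult_square_integrable:
  fixes Y Z :: "'a \<Rightarrow> real"
  assumes [measurable]: "random_variable borel Y" "random_variable borel Z"
    and "integrable M (\<lambda>\<omega>. (Y \<omega>)\<^sup>2)" "integrable M (\<lambda>\<omega>. (Z \<omega>)\<^sup>2)"
  shows "integrable M (\<lambda>\<omega>. Y \<omega> * Z \<omega>)"
proof (rule Bochner_Integration.integrable_bound[of _ "\<lambda>\<omega>. (Y \<omega>)\<^sup>2 + (Z \<omega>)\<^sup>2"])
  have "\<bar>y * z\<bar> \<le> y\<^sup>2 + z\<^sup>2" for y z :: real
  proof -
    have "2 * (\<bar>y\<bar> * \<bar>z\<bar>) \<le> y\<^sup>2 + z\<^sup>2" using sum_squares_bound[of "\<bar>y\<bar>" "\<bar>z\<bar>"] by (simp add: mult.assoc)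
    moreover have "0 \<le> \<bar>y\<bar> * \<bar>z\<bar>" by simp
    ultimately show ?thesis unfolding abs_mult by linarith
  qed
  then show "AE \<omega> in M. norm (Y \<omega> * Z \<omega>) \<le> norm ((Y \<omega>)\<^sup>2 + (Z \<omega>)\<^sup>2)" by simp
qed (use assms in auto)

lemma variance_linear_combination:
  fixes Y :: "'k \<Rightarrow> 'a \<Rightarrow> real"
  assumes Y: "\<And>k. k \<in> K \<Longrightarrow> random_variable borel (Y k)"
    and sq: "\<And>k. k \<in> K \<Longrightarrow> integrable M (\<lambda>\<omega>. (Y k \<omega>)\<^sup>2)"
  shows "variance (\<lambda>\<omega>. \<Sum>k\<in>K. c k * Y k \<omega>) = (\<Sum>k\<in>K. \<Sum>l\<in>K. c k * c l * covariance M (Y k) (Y l))"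
proof -
  let ?Z = "\<lambda>k \<omega>. Y k \<omega> - expectation (Y k)"
  have int: "integrable M (Y k)" if "k \<in> K" for k
    using Y[OF that] sq[OF that] by (rule square_integrable_imp_integrable)
  have Z [measurable]: "random_variable borel (?Z k)" if "k \<in> K" for k
    using Y[OF that] by measurable
  have "integrable M (\<lambda>\<omega>. (?Z k \<omega>)\<^sup>2)" if "k \<in> K" for k
    using sq[OF that] int[OF that] by (simp add: power2_diff)
  then have ZZ: "integrable M (\<lambda>\<omega>. ?Z k \<omega> * ?Z l \<omega>)" if "k \<in> K" "l \<in> K" for k l
    using that by (intro integrable_mult_square_integrable Z)
  have "expectation (\<lambda>\<omega>. \<Sum>k\<in>K. c k * Y k \<omega>) = (\<Sum>k\<in>K. c k * expectation (Y k))"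
    using int by simp
  then have "variance (\<lambda>\<omega>. \<Sum>k\<in>K. c k * Y k \<omega>) = (LINT \<omega>|M. (\<Sum>k\<in>K. c k * ?Z k \<omega>)\<^sup>2)"
    by (simp add: right_diff_distrib sum_subtractf)
  also have "\<dots> = (LINT \<omega>|M. (\<Sum>k\<in>K. \<Sum>l\<in>K. (c k * c l) * (?Z k \<omega> * ?Z l \<omega>)))"
    by (simp only: power2_eq_square sum_product mult_ac)
  also have "\<dots> = (\<Sum>k\<in>K. \<Sum>l\<in>K. c k * c l * covariance M (Y k) (Y l))"
    using ZZ by (simp add: covariance_def)
  finally show ?thesis .
qed

lemma limit_mat_entry_square_integrable:
  assumes W: "limit_mat M s P \<pi> W" and "i < s" "j < s"
  shows "random_variable borel (\<lambda>\<omega>. W \<omega> $$ (i, j))" and "integrable M (\<lambda>\<omega>. (W \<omega> $$ (i, j))\<^sup>2)"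
proof -
  have g: "gaussian_random_mat M s W" using W by (simp add: limit_mat_def)
  show m: "random_variable borel (\<lambda>\<omega>. W \<omega> $$ (i, j))" using g assms by (simp add: gaussian_random_mat_def)
  define c where "c k l = (if k = i then if l = j then 1 else 0 else 0 :: real)" for k l
  have "\<exists>\<mu> \<sigma>. \<sigma> \<ge> 0 \<and> distr M borel (\<lambda>\<omega>. \<Sum>i<s. \<Sum>j<s. c i j * W \<omega> $$ (i, j)) = normal_law \<mu> \<sigma>"
    using g unfolding gaussian_random_mat_def by blast
  moreover have "(\<Sum>k<s. \<Sum>l<s. c k l * W \<omega> $$ (k, l)) = W \<omega> $$ (i, j)" for \<omega>
  proof -
    have "(\<Sum>k<s. \<Sum>l<s. c k l * W \<omega> $$ (k, l)) = (\<Sum>k<s. if k = i then \<Sum>l<s. if l = j then W \<omega> $$ (k, l) else 0 else 0)"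
    proof (rule sum.cong[OF refl])
      fix k
      show "(\<Sum>l<s. c k l * W \<omega> $$ (k, l)) = (if k = i then \<Sum>l<s. if l = j then W \<omega> $$ (k, l) else 0 else 0)"
        by (simp add: c_def if_distrib[of "\<lambda>x. x * _"] cong: if_cong)
    qed
    then show ?thesis using assms(2,3) by simp
  qed
  ultimately show "integrable M (\<lambda>\<omega>. (W \<omega> $$ (i, j))\<^sup>2)"
    using normal_law_moments(1)[OF m] by auto
qed

text \<open>
  Covariances between different rows vanish, so the variance is a sum over the rows, and each row
  contributes the variance of \<open>c i\<close> under the distribution \<open>P i\<close>, divided by \<open>\<pi>\<^sub>i\<close>.
\<close>

lemma limit_mat_functional:
  fixes c :: "nat \<Rightarrow> nat \<Rightarrow> real"
  assumes W: "limit_mat M s P \<pi> W"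
  defines "v \<equiv> \<Sum>i<s. inverse (\<pi> $$ (0, i)) * ((\<Sum>j<s. P $$ (i, j) * (c i j)\<^sup>2) - (\<Sum>j<s. P $$ (i, j) * c i j)\<^sup>2)"
  shows "Characteristic_Functions.char (distr M borel (\<lambda>\<omega>. \<Sum>i<s. \<Sum>j<s. c i j * W \<omega> $$ (i, j))) t
    = of_real (exp (- (t\<^sup>2 / 2 * v)))"
proof -
  let ?K = "{..<s} \<times> {..<s}"
  define Y where "Y = (\<lambda>\<omega>. \<Sum>i<s. \<Sum>j<s. c i j * W \<omega> $$ (i, j))"
  note ent = limit_mat_entry_square_integrable[OF W]
  have cov: "covariance M (\<lambda>\<omega>. W \<omega> $$ (i, j)) (\<lambda>\<omega>. W \<omega> $$ (k, l)) =
      (if i = k then inverse (\<pi> $$ (0, i)) * P $$ (i, j) * ((if j = l then 1 else 0) - P $$ (i, l)) else 0)"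
    if "i < s" "j < s" "k < s" "l < s" for i j k l
    using W that by (simp add: limit_mat_def)
  have Ysum: "Y = (\<lambda>\<omega>. \<Sum>p\<in>?K. c (fst p) (snd p) * W \<omega> $$ (fst p, snd p))"
    by (simp add: Y_def sum.cartesian_product split_def)
  have Ym: "random_variable borel Y" unfolding Y_def using ent(1) by (intro borel_measurable_sum borel_measurable_times) auto
  obtain \<mu> \<sigma> where n: "\<sigma> \<ge> 0" "distr M borel Y = normal_law \<mu> \<sigma>"
    using W unfolding limit_mat_def gaussian_random_mat_def Y_def by blast
  note mom = normal_law_moments[OF Ym n(2,1)]
  have "expectation Y = 0"
  proof -
    have "integrable M (\<lambda>\<omega>. W \<omega> $$ (fst p, snd p))" if "p \<in> ?K" for p
    proof -
      have "fst p < s" "snd p < s" using that by auto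
      from ent[OF this] show ?thesis by (rule square_integrable_imp_integrable)
    qed
    moreover have "(LINT \<omega>|M. W \<omega> $$ (fst p, snd p)) = 0" if "p \<in> ?K" for p
      using W that by (auto simp: limit_mat_def)
    ultimately show ?thesis unfolding Ysum by simp
  qed
  then have "\<mu> = 0" using mom(2) by simp
  have "variance Y = (\<Sum>p\<in>?K. \<Sum>q\<in>?K. c (fst p) (snd p) * c (fst q) (snd q) *
      covariance M (\<lambda>\<omega>. W \<omega> $$ (fst p, snd p)) (\<lambda>\<omega>. W \<omega> $$ (fst q, snd q)))"
    unfolding Ysum by (rule variance_linear_combination) (use ent in auto)
  also have "\<dots> = (\<Sum>i<s. \<Sum>j<s. \<Sum>k<s. \<Sum>l<s. c i j * c k l *
      covariance M (\<lambda>\<omega>. W \<omega> $$ (i, j)) (\<lambda>\<omega>. W \<omega> $$ (k, l)))"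
    by (simp add: sum.cartesian_product' split_def)
  also have "\<dots> = (\<Sum>i<s. \<Sum>j<s. \<Sum>k<s. if k = i then \<Sum>l<s. c i j * c i l *
      (inverse (\<pi> $$ (0, i)) * P $$ (i, j) * ((if j = l then 1 else 0) - P $$ (i, l))) else 0)"
    by (intro sum.cong refl) (auto simp: cov)
  also have "\<dots> = (\<Sum>i<s. \<Sum>j<s. \<Sum>l<s. c i j * c i l *
      (inverse (\<pi> $$ (0, i)) * P $$ (i, j) * ((if j = l then 1 else 0) - P $$ (i, l))))"
    by simp
  also have "\<dots> = v"
    unfolding v_def
  proof (rule sum.cong[OF refl])
    fix i
    let ?r = "inverse (\<pi> $$ (0, i))"
    have "(\<Sum>l<s. c i j * c i l * (?r * P $$ (i, j) * ((if j = l then 1 else 0) - P $$ (i, l))))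
        = ?r * (P $$ (i, j) * (c i j)\<^sup>2 - P $$ (i, j) * c i j * (\<Sum>l<s. P $$ (i, l) * c i l))" if "j < s" for j
    proof -
      have "(\<Sum>l<s. c i j * c i l * (?r * P $$ (i, j) * ((if j = l then 1 else 0) - P $$ (i, l))))
          = (\<Sum>l<s. (if j = l then ?r * (P $$ (i, j) * c i j * c i l) else 0) - ?r * (P $$ (i, j) * c i j * (P $$ (i, l) * c i l)))"
        by (intro sum.cong refl) (simp add: algebra_simps)
      then show ?thesis
        using that by (simp add: sum_subtractf right_diff_distrib power2_eq_square mult.assoc sum_distrib_left)
    qed
    then have "(\<Sum>j<s. \<Sum>l<s. c i j * c i l * (?r * P $$ (i, j) * ((if j = l then 1 else 0) - P $$ (i, l))))
        = (\<Sum>j<s. ?r * (P $$ (i, j) * (c i j)\<^sup>2 - P $$ (i, j) * c i j * (\<Sum>l<s. P $$ (i, l) * c i l)))"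
      by simp
    then show "(\<Sum>j<s. \<Sum>l<s. c i j * c i l * (?r * P $$ (i, j) * ((if j = l then 1 else 0) - P $$ (i, l))))
        = ?r * ((\<Sum>j<s. P $$ (i, j) * (c i j)\<^sup>2) - (\<Sum>j<s. P $$ (i, j) * c i j)\<^sup>2)"
      by (simp add: sum_subtractf right_diff_distrib power2_eq_square sum_distrib_left[symmetric] sum_distrib_right[symmetric])
  qed
  finally have "\<sigma>\<^sup>2 = v" using mom(3) by simp
  then show ?thesis using mom(4)[OF \<open>\<mu> = 0\<close>, of t] by (simp add: Y_def)
qed

end

section \<open>The plug-in estimator of a mean time\<close>

text \<open>
  Submatrices are indexed by positions inside \<open>B\<close>. This carries coefficients given by position to
  coefficients on pairs of states, with 0 outside of \<open>B\<close>, so that a functional of \<open>P\<^sub>B\<^sub>B\<close> or \<open>W\<^sub>B\<^sub>B\<close>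
  becomes one of \<open>P\<close> or \<open>W\<close>.
\<close>

definition pick_coefficients :: "nat set \<Rightarrow> (nat \<Rightarrow> nat \<Rightarrow> real) \<Rightarrow> nat \<Rightarrow> nat \<Rightarrow> real" where
  "pick_coefficients B w k l = (\<Sum>i<card B. \<Sum>j<card B. of_bool (pick B i = k \<and> pick B j = l) * w i j)"

lemma sum_pick_coefficients:
  fixes w F :: "nat \<Rightarrow> nat \<Rightarrow> real"
  assumes "B \<subseteq> {0..<s}"
  shows "(\<Sum>k<s. \<Sum>l<s. pick_coefficients B w k l * F k l)
    = (\<Sum>i<card B. \<Sum>j<card B. w i j * F (pick B i) (pick B j))"
proof -
  let ?p = "pick B" and ?I = "{..<card B} \<times> {..<card B}"
  define d :: "nat \<times> nat \<Rightarrow> nat \<Rightarrow> nat \<Rightarrow> real"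
    where "d q k l = of_bool (?p (fst q) = k \<and> ?p (snd q) = l) * w (fst q) (snd q) * F k l" for q k l
  have d: "pick_coefficients B w k l * F k l = (\<Sum>q\<in>?I. d q k l)" for k l
    unfolding pick_coefficients_def sum_distrib_right d_def sum.cartesian_product split_def ..
  have "(\<Sum>k<s. \<Sum>l<s. \<Sum>q\<in>?I. d q k l) = (\<Sum>k<s. \<Sum>q\<in>?I. \<Sum>l<s. d q k l)"
    by (intro sum.cong refl sum.swap)
  also have "\<dots> = (\<Sum>q\<in>?I. \<Sum>k<s. \<Sum>l<s. d q k l)" by (rule sum.swap)
  also have "\<dots> = (\<Sum>q\<in>?I. w (fst q) (snd q) * F (?p (fst q)) (?p (snd q)))"
  proof (rule sum.cong[OF refl])
    fix q assume q: "q \<in> ?I"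
    have "(\<Sum>l<s. d q k l) = (if ?p (fst q) = k then w (fst q) (snd q) * F k (?p (snd q)) else 0)" for k
    proof -
      have "(\<Sum>l<s. d q k l) = (\<Sum>l<s. if ?p (snd q) = l then if ?p (fst q) = k then w (fst q) (snd q) * F k l else 0 else 0)"
        by (intro sum.cong refl) (simp add: d_def)
      then show ?thesis using pick_less[OF assms] q by auto
    qed
    then show "(\<Sum>k<s. \<Sum>l<s. d q k l) = w (fst q) (snd q) * F (?p (fst q)) (?p (snd q))"
      using pick_less[OF assms] q by auto
  qed
  finally show ?thesis unfolding d by (simp add: sum.cartesian_product split_def)
qed

text \<open>
  Where the fluctuation is small, the inverse exists at the empirical matrix, so the value of the estimator
  is determined and the two linearizations apply; elsewhere its value does not affect the limit.
\<close>

lemma (in finite_markov_chain) plug_in_characteristic: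
  assumes irr: "irreducible_mat s P" and stat: "stationary_row s P \<pi>" and a: "a \<in> carrier_mat 1 s"
    and B: "B \<subset> {0..<s}" and est: "plug_in_estimator M s X a B est"
  defines "u \<equiv> \<lambda>i. (submatrix a UNIV B * fundamental_mat P B) $$ (0, i)"
    and "v \<equiv> \<lambda>j. (fundamental_mat P B * ones (card B)) $$ (j, 0)"
  defines "c \<equiv> pick_coefficients B (\<lambda>i j. u i * v j)"
  shows "(\<lambda>n. LINT \<omega>|M. iexp (t * (sqrt (real n) * (est n \<omega> - mean_time a B P))))
    \<longlonglongrightarrow> of_real (exp (- (t\<^sup>2 / 2 * (\<Sum>i<s. inverse (\<pi> $$ (0, i)) *
      ((\<Sum>j<s. P $$ (i, j) * (c i j)\<^sup>2) - (\<Sum>j<s. P $$ (i, j) * c i j)\<^sup>2)))))"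
proof -
  have P: "P \<in> carrier_mat s s" using stoch by (simp add: stochastic_mat_def)
  have Bs: "B \<subseteq> {0..<s}" using B by auto
  note pi_pos = stationary_row_pos[OF stoch irr stat]
  have "\<exists>C \<eta>. 0 \<le> C \<and> 0 < \<eta> \<and> (\<forall>P'\<in>carrier_mat s s. \<forall>e.
      (\<forall>i<s. \<forall>j<s. \<bar>P' $$ (i, j) - P $$ (i, j)\<bar> \<le> e) \<longrightarrow> 0 \<le> e \<longrightarrow> e \<le> \<eta> \<longrightarrow>
       invertible_mat (1\<^sub>m (card B) - submatrix P' B B) \<and>
       \<bar>mean_time a B P' - mean_time a B P -
         (\<Sum>i<card B. \<Sum>j<card B. u i * v j * (P' $$ (pick B i, pick B j) - P $$ (pick B i, pick B j)))\<bar> \<le> C * e\<^sup>2)"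
    unfolding u_def v_def by (rule mean_time_perturbation[OF a P Bs invertible_mat_restriction[OF stoch irr B]])
  then obtain C \<eta>\<^sub>0 where C: "0 \<le> C" "0 < \<eta>\<^sub>0" and pert: "\<forall>P'\<in>carrier_mat s s. \<forall>e.
      (\<forall>i<s. \<forall>j<s. \<bar>P' $$ (i, j) - P $$ (i, j)\<bar> \<le> e) \<longrightarrow> 0 \<le> e \<longrightarrow> e \<le> \<eta>\<^sub>0 \<longrightarrow>
       invertible_mat (1\<^sub>m (card B) - submatrix P' B B) \<and>
       \<bar>mean_time a B P' - mean_time a B P -
         (\<Sum>i<card B. \<Sum>j<card B. u i * v j * (P' $$ (pick B i, pick B j) - P $$ (pick B i, pick B j)))\<bar> \<le> C * e\<^sup>2"
    by (elim exE conjE) (rule that)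
  obtain q where q: "0 < q" "\<And>i. i < s \<Longrightarrow> q \<le> \<pi> $$ (0, i)"
  proof
    let ?S = "insert 1 ((\<lambda>i. \<pi> $$ (0, i)) ` {..<s})"
    show "0 < Min ?S" using pi_pos by (subst Min_gr_iff) auto
    show "Min ?S \<le> \<pi> $$ (0, i)" if "i < s" for i using that by (intro Min_le) auto
  qed
  \<comment> \<open>The first bound keeps the visit frequencies above \<open>q / 2\<close>; the second keeps the empirical matrix
    within the radius \<open>\<eta>\<^sub>0\<close> of the expansion of the mean time.\<close>
  define \<eta> where "\<eta> = min ((q / 2)\<^sup>2) ((q / 2 * \<eta>\<^sub>0)\<^sup>2)"
  define R where "R = (\<Sum>i<s. \<Sum>j<s. \<bar>c i j\<bar> * (2 / q\<^sup>2))"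
  define K where "K = C * (2 / q)\<^sup>2 + R"
  let ?T = "\<lambda>n \<omega>. path_sum (scaled_noise \<pi> c) n (\<lambda>k. X k \<omega>)"
  have "0 \<le> R" unfolding R_def by (intro sum_nonneg) auto
  then have K0: "0 \<le> K" using C(1) by (simp add: K_def)
  have main: "\<bar>est n \<omega> - mean_time a B P - ?T n \<omega> / real n\<bar> \<le> K * fluctuation \<pi> n \<omega>"
    if n: "1 \<le> n" and w: "\<omega> \<in> space M" and Q: "fluctuation \<pi> n \<omega> \<le> \<eta>" for n \<omega>
  proof -
    let ?Q = "fluctuation \<pi> n \<omega>" and ?P = "empirical_mat s X n \<omega>"
    let ?m = "\<lambda>i j. path_sum (transition_noise i j) n (\<lambda>k. X k \<omega>) / real n / \<pi> $$ (0, i)"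
    have Q0: "0 \<le> ?Q" by (rule fluctuation_nonneg)
    have Q1: "?Q \<le> (q / 2)\<^sup>2" and Q2: "?Q \<le> (q / 2 * \<eta>\<^sub>0)\<^sup>2" using Q by (auto simp: \<eta>_def)
    have Pc: "?P \<in> carrier_mat s s" by (simp add: empirical_mat_def)
    note lin = empirical_mat_linearization[OF w n _ _ q(1) q(2) Q1]
    have "sqrt ?Q \<le> q / 2 * \<eta>\<^sub>0" using Q2 q(1) C(2) by (intro real_le_lsqrt) auto
    then have "2 / q * sqrt ?Q \<le> 2 / q * (q / 2 * \<eta>\<^sub>0)" using q(1) by (intro mult_left_mono) auto
    then have e: "2 / q * sqrt ?Q \<le> \<eta>\<^sub>0" using q(1) by simp
    have "0 \<le> 2 / q * sqrt ?Q" using q(1) Q0 by simp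
    then have "invertible_mat (1\<^sub>m (card B) - submatrix ?P B B) \<and>
       \<bar>mean_time a B ?P - mean_time a B P -
         (\<Sum>i<card B. \<Sum>j<card B. u i * v j * (?P $$ (pick B i, pick B j) - P $$ (pick B i, pick B j)))\<bar>
        \<le> C * (2 / q * sqrt ?Q)\<^sup>2"
      using lin(1) e by (intro pert[rule_format, OF Pc])
    then have inv: "invertible_mat (1\<^sub>m (card B) - submatrix ?P B B)"
      and approx: "\<bar>mean_time a B ?P - mean_time a B P -
         (\<Sum>i<card B. \<Sum>j<card B. u i * v j * (?P $$ (pick B i, pick B j) - P $$ (pick B i, pick B j)))\<bar>
        \<le> C * (2 / q * sqrt ?Q)\<^sup>2" by auto
    have est_eq: "est n \<omega> = mean_time a B ?P"
      using est inv w by (simp add: plug_in_estimator_def)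
    have coeff: "(\<Sum>i<card B. \<Sum>j<card B. u i * v j * (?P $$ (pick B i, pick B j) - P $$ (pick B i, pick B j)))
        = (\<Sum>k<s. \<Sum>l<s. c k l * (?P $$ (k, l) - P $$ (k, l)))"
      unfolding c_def by (rule sum_pick_coefficients[OF Bs, symmetric])
    have T_eq: "?T n \<omega> / real n = (\<Sum>k<s. \<Sum>l<s. c k l * ?m k l)"
      unfolding path_sum_scaled_noise[OF w] by (simp add: sum_divide_distrib mult_ac)
    have "\<bar>(\<Sum>k<s. \<Sum>l<s. c k l * (?P $$ (k, l) - P $$ (k, l))) - ?T n \<omega> / real n\<bar>
        = \<bar>\<Sum>k<s. \<Sum>l<s. c k l * (?P $$ (k, l) - P $$ (k, l) - ?m k l)\<bar>"
      unfolding T_eq by (simp only: right_diff_distrib sum_subtractf)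
    also have "\<dots> \<le> (\<Sum>k<s. \<Sum>l<s. \<bar>c k l * (?P $$ (k, l) - P $$ (k, l) - ?m k l)\<bar>)"
      by (rule order.trans[OF sum_abs sum_mono]) (rule sum_abs)
    also have "\<dots> \<le> (\<Sum>k<s. \<Sum>l<s. \<bar>c k l\<bar> * (2 / q\<^sup>2 * ?Q))"
      unfolding abs_mult using lin(2) by (intro sum_mono mult_left_mono) auto
    also have "\<dots> = R * ?Q" by (simp add: R_def sum_distrib_right mult.assoc)
    finally have "\<bar>est n \<omega> - mean_time a B P - ?T n \<omega> / real n\<bar> \<le> C * (2 / q * sqrt ?Q)\<^sup>2 + R * ?Q"
      using approx unfolding est_eq coeff by linarith
    also have "\<dots> = K * ?Q" using Q0 unfolding power_mult_distrib by (simp add: K_def algebra_simps)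
    finally show ?thesis .
  qed
  obtain b where b: "0 \<le> b" "martingale_increment (scaled_noise \<pi> c) b"
    using martingale_increment_bounded[of "scaled_noise \<pi> c", OF scaled_noise_martingale] by auto
  have v_eq: "(\<Sum>i<s. \<pi> $$ (0, i) * increment_variance (scaled_noise \<pi> c) i)
      = (\<Sum>i<s. inverse (\<pi> $$ (0, i)) * ((\<Sum>j<s. P $$ (i, j) * (c i j)\<^sup>2) - (\<Sum>j<s. P $$ (i, j) * c i j)\<^sup>2))"
    using scaled_noise_variance pi_pos by (intro sum.cong) auto
  note clt = martingale_clt[OF irr stat b(2,1), of t, unfolded v_eq]
  show ?thesis
  proof (rule characteristic_approximation[OF irr stat _ _ _ K0 _ clt, where \<eta> = \<eta>])
    show "random_variable borel (\<lambda>\<omega>. sqrt (real n) * (est n \<omega> - mean_time a B P))" for n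
    proof -
      have "random_variable borel (est n)" using est by (simp add: plug_in_estimator_def)
      then show ?thesis by (intro borel_measurable_times borel_measurable_diff borel_measurable_const)
    qed
    show "random_variable borel (\<lambda>\<omega>. ?T n \<omega> / sqrt (real n))" for n
      using borel_measurable_integrable[OF adapted_integrable[OF adapted_path_sum[of n "\<lambda>y. y / sqrt (real n)"]]] .
    show "0 < \<eta>" using q(1) C(2) by (simp add: \<eta>_def)
    fix n :: nat and \<omega> assume n: "1 \<le> n" and w: "\<omega> \<in> space M" and Q: "fluctuation \<pi> n \<omega> \<le> \<eta>"
    have "real n = sqrt (real n) * sqrt (real n)" by simp
    then have "?T n \<omega> / sqrt (real n) = sqrt (real n) * (?T n \<omega> / real n)"
      using n by (simp add: field_simps)
    then have "\<bar>sqrt (real n) * (est n \<omega> - mean_time a B P) - ?T n \<omega> / sqrt (real n)\<bar>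
        = sqrt (real n) * \<bar>est n \<omega> - mean_time a B P - ?T n \<omega> / real n\<bar>"
      by (simp only: right_diff_distrib[symmetric] abs_mult) simp
    also have "\<dots> \<le> sqrt (real n) * (K * fluctuation \<pi> n \<omega>)"
      using main[OF n w Q] by (intro mult_left_mono) auto
    finally show "\<bar>sqrt (real n) * (est n \<omega> - mean_time a B P) - ?T n \<omega> / sqrt (real n)\<bar>
        \<le> K * sqrt (real n) * fluctuation \<pi> n \<omega>" by (simp add: mult_ac)
  qed
qed

lemma sandwich_entry:
  assumes a: "a \<in> carrier_mat 1 s" and N: "N \<in> carrier_mat (card B) (card B)" and Bs: "B \<subseteq> {0..<s}"
    and V: "V \<in> carrier_mat s s"
  shows "(submatrix a UNIV B * N * submatrix V B B * N * ones (card B)) $$ (0, 0)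
    = (\<Sum>i<card B. \<Sum>j<card B. (submatrix a UNIV B * N) $$ (0, i) * (N * ones (card B)) $$ (j, 0) * V $$ (pick B i, pick B j))"
proof -
  let ?c = "card B"
  have aN: "submatrix a UNIV B * N \<in> carrier_mat 1 ?c" using submatrix_row[OF a Bs] N by simp
  have o: "ones ?c \<in> carrier_mat ?c 1" by (simp add: ones_def)
  have No: "N * ones ?c \<in> carrier_mat ?c 1" using N o by simp
  note S = submatrix_square[OF V Bs]
  have aNS: "submatrix a UNIV B * N * submatrix V B B \<in> carrier_mat 1 ?c" using aN S(1) by simp
  have "(submatrix a UNIV B * N * submatrix V B B * N * ones ?c) $$ (0, 0)
      = (submatrix a UNIV B * N * submatrix V B B * (N * ones ?c)) $$ (0, 0)"
    using assoc_mult_mat[OF aNS N o] by simp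
  also have "\<dots> = (\<Sum>j<?c. (submatrix a UNIV B * N * submatrix V B B) $$ (0, j) * (N * ones ?c) $$ (j, 0))"
    by (rule mult_mat_entry[OF aNS No]) auto
  also have "\<dots> = (\<Sum>j<?c. (\<Sum>i<?c. (submatrix a UNIV B * N) $$ (0, i) * V $$ (pick B i, pick B j)) * (N * ones ?c) $$ (j, 0))"
  proof (rule sum.cong[OF refl])
    fix j assume "j \<in> {..<?c}"
    then show "(submatrix a UNIV B * N * submatrix V B B) $$ (0, j) * (N * ones ?c) $$ (j, 0)
        = (\<Sum>i<?c. (submatrix a UNIV B * N) $$ (0, i) * V $$ (pick B i, pick B j)) * (N * ones ?c) $$ (j, 0)"
      using mult_mat_entry[OF aN S(1), of 0 j] S(2) by simp
  qed
  also have "\<dots> = (\<Sum>i<?c. \<Sum>j<?c. (submatrix a UNIV B * N) $$ (0, i) * (N * ones ?c) $$ (j, 0) * V $$ (pick B i, pick B j))"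
    unfolding sum_distrib_right by (subst sum.swap) (simp add: mult_ac)
  finally show ?thesis .
qed

lemma sum_lessThan_square:
  fixes f :: "nat \<Rightarrow> nat \<Rightarrow> 'a::comm_monoid_add"
  shows "(\<Sum>k<c * c. f (k div c) (k mod c)) = (\<Sum>i<c. \<Sum>j<c. f i j)"
proof -
  have "(\<Sum>k<c * c. f (k div c) (k mod c)) = (\<Sum>p\<in>{..<c} \<times> {..<c}. f (fst p) (snd p))"
  proof (rule sum.reindex_bij_witness[of _ "\<lambda>p. fst p * c + snd p" "\<lambda>k. (k div c, k mod c)"])
    fix k assume "k \<in> {..<c * c}"
    then have "k < c * c" by simp
    moreover from this have "0 < c" by (cases c) auto
    ultimately show "(k div c, k mod c) \<in> {..<c} \<times> {..<c}" by (simp add: less_mult_imp_div_less)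
  next
    fix p assume "p \<in> {..<c} \<times> {..<c}"
    then obtain i j where p: "p = (i, j)" "i < c" "j < c" by auto
    have "i * c + j < Suc i * c" using p by simp
    also have "\<dots> \<le> c * c" using p by (intro mult_le_mono1) simp
    finally show "fst p * c + snd p \<in> {..<c * c}" by (simp add: p)
    show "((fst p * c + snd p) div c, (fst p * c + snd p) mod c) = p" using p by simp
  qed auto
  then show ?thesis by (simp add: sum.cartesian_product split_def)
qed

lemma kronecker_row_entry:
  assumes "A \<in> carrier_mat 1 m" "B \<in> carrier_mat 1 n"
  shows "kronecker A B \<in> carrier_mat 1 (m * n)"
    and "k < m * n \<Longrightarrow> kronecker A B $$ (0, k) = A $$ (0, k div n) * B $$ (0, k mod n)"
  using assms by (auto simp: kronecker_def)

text \<open>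
  The row \<open>L\<close> lists the products \<open>u\<^sub>i v\<^sub>j\<close> of the entries of \<open>u = a\<^sub>B N\<close> and \<open>v = N 1\<close> in the order in which
  \<open>vec (W\<^sub>B\<^sub>B\<^sup>T)\<close> lists the entries of \<open>W\<^sub>B\<^sub>B\<close>, namely row by row. So the functional is \<open>L\<close> applied to that vector.
\<close>

lemma sandwich_variance:
  assumes M: "prob_space M" and W: "limit_mat M s P \<pi> W"
    and a: "a \<in> carrier_mat 1 s" and N: "N \<in> carrier_mat (card B) (card B)" and Bs: "B \<subseteq> {0..<s}"
  defines "L \<equiv> kronecker (submatrix a UNIV B * N) (transpose_mat (ones (card B)) * transpose_mat N)"
  shows "prob_space.variance M (\<lambda>\<omega>. (submatrix a UNIV B * N * submatrix (W \<omega>) B B * N * ones (card B)) $$ (0, 0))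
    = (L * sigma_mat M W B * transpose_mat L) $$ (0, 0)"
proof -
  interpret prob_space M by (rule M)
  let ?c = "card B"
  let ?u = "\<lambda>i. (submatrix a UNIV B * N) $$ (0, i)" and ?v = "\<lambda>j. (N * ones ?c) $$ (j, 0)"
  define Y where "Y k \<omega> = W \<omega> $$ (pick B (k div ?c), pick B (k mod ?c))" for k \<omega>
  have Wc: "W \<omega> \<in> carrier_mat s s" if "\<omega> \<in> space M" for \<omega>
    using W that by (simp add: limit_mat_def gaussian_random_mat_def)
  have aN: "submatrix a UNIV B * N \<in> carrier_mat 1 ?c" using submatrix_row[OF a Bs] N by simp
  have o: "ones ?c \<in> carrier_mat ?c 1" by (simp add: ones_def)
  have oN: "transpose_mat (ones ?c) * transpose_mat N = transpose_mat (N * ones ?c)"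
    using transpose_mult[OF N o] by simp
  have oNc: "transpose_mat (N * ones ?c) \<in> carrier_mat 1 ?c" using N o by simp
  have L: "L \<in> carrier_mat 1 (?c * ?c)" unfolding L_def oN by (rule kronecker_row_entry(1)[OF aN oNc])
  have dm: "k div ?c < ?c \<and> k mod ?c < ?c" if "k < ?c * ?c" for k
    using that by (cases "?c = 0") (auto simp: less_mult_imp_div_less)
  have Lk: "L $$ (0, k) = ?u (k div ?c) * ?v (k mod ?c)" if "k < ?c * ?c" for k
    unfolding L_def oN kronecker_row_entry(2)[OF aN oNc that]
    using dm[OF that] N o by (simp del: index_mult_mat(1))
  have Vk: "vec_cols (transpose_mat (submatrix (W \<omega>) B B)) $$ (k, 0) = Y k \<omega>"
    if "\<omega> \<in> space M" "k < ?c * ?c" for \<omega> k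
    using submatrix_square[OF Wc[OF that(1)] Bs] dm[OF that(2)] that(2)
    by (auto simp: vec_cols_def Y_def)
  have \<Sigma>: "sigma_mat M W B \<in> carrier_mat (?c * ?c) (?c * ?c)"
    by (simp add: sigma_mat_def covariance_mat_def)
  have \<Sigma>kl: "sigma_mat M W B $$ (k, l) = covariance M (Y k) (Y l)" if "k < ?c * ?c" "l < ?c * ?c" for k l
    using that by (simp add: sigma_mat_def covariance_mat_def covariance_def Vk cong: Bochner_Integration.integral_cong)
  have "(submatrix a UNIV B * N * submatrix (W \<omega>) B B * N * ones ?c) $$ (0, 0) = (\<Sum>k<?c * ?c. L $$ (0, k) * Y k \<omega>)"
    if "\<omega> \<in> space M" for \<omega>
  proof -
    have "(\<Sum>k<?c * ?c. L $$ (0, k) * Y k \<omega>)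
        = (\<Sum>k<?c * ?c. ?u (k div ?c) * ?v (k mod ?c) * W \<omega> $$ (pick B (k div ?c), pick B (k mod ?c)))"
      by (intro sum.cong refl) (simp only: lessThan_iff Lk Y_def)
    also have "\<dots> = (\<Sum>i<?c. \<Sum>j<?c. ?u i * ?v j * W \<omega> $$ (pick B i, pick B j))"
      by (rule sum_lessThan_square)
    finally show ?thesis using sandwich_entry[OF a N Bs Wc[OF that]] by simp
  qed
  then have "variance (\<lambda>\<omega>. (submatrix a UNIV B * N * submatrix (W \<omega>) B B * N * ones ?c) $$ (0, 0))
      = variance (\<lambda>\<omega>. \<Sum>k<?c * ?c. L $$ (0, k) * Y k \<omega>)"
    by (simp only: cong: Bochner_Integration.integral_cong)
  also have "\<dots> = (\<Sum>k<?c * ?c. \<Sum>l<?c * ?c. L $$ (0, k) * L $$ (0, l) * covariance M (Y k) (Y l))"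
  proof (rule variance_linear_combination)
    fix k assume "k \<in> {..<?c * ?c}"
    then have "pick B (k div ?c) < s" "pick B (k mod ?c) < s" using dm pick_less[OF Bs] by auto
    from limit_mat_entry_square_integrable[OF W this]
    show "random_variable borel (Y k)" "integrable M (\<lambda>\<omega>. (Y k \<omega>)\<^sup>2)" by (simp_all add: Y_def[abs_def])
  qed
  also have "\<dots> = (\<Sum>l<?c * ?c. (\<Sum>k<?c * ?c. L $$ (0, k) * sigma_mat M W B $$ (k, l)) * L $$ (0, l))"
    unfolding sum_distrib_right by (subst sum.swap) (intro sum.cong refl, simp add: \<Sigma>kl)
  also have "\<dots> = (\<Sum>l<?c * ?c. (L * sigma_mat M W B) $$ (0, l) * transpose_mat L $$ (l, 0))"
  proof (rule sum.cong[OF refl])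
    fix l assume "l \<in> {..<?c * ?c}"
    then show "(\<Sum>k<?c * ?c. L $$ (0, k) * sigma_mat M W B $$ (k, l)) * L $$ (0, l)
        = (L * sigma_mat M W B) $$ (0, l) * transpose_mat L $$ (l, 0)"
      using mult_mat_entry[OF L \<Sigma>, of 0 l] L by simp
  qed
  also have "\<dots> = (L * sigma_mat M W B * transpose_mat L) $$ (0, 0)"
    by (rule mult_mat_entry[symmetric]) (use L \<Sigma> in auto)
  finally show ?thesis .
qed

lemma plug_in_clt:
  assumes M: "prob_space M" and M': "prob_space M'"
    and st: "stochastic_mat s P" and irr: "irreducible_mat s P" and stat: "stationary_row s P \<pi>"
    and a: "a \<in> carrier_mat 1 s" and chain: "markov_chain M s a P X"
    and W: "limit_mat M' s P \<pi> W" and B: "B \<subset> {0..<s}" and est: "plug_in_estimator M s X a B est"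
  defines "N \<equiv> fundamental_mat P B"
  shows "weak_conv_m (\<lambda>n. distr M borel (\<lambda>\<omega>. sqrt (real n) * (est n \<omega> - mean_time a B P)))
    (distr M' borel (\<lambda>\<omega>. (submatrix a UNIV B * N * submatrix (W \<omega>) B B * N * ones (card B)) $$ (0, 0)))"
proof -
  interpret finite_markov_chain M s a P X
    using M st chain by (simp add: finite_markov_chain_def finite_markov_chain_axioms_def)
  interpret M': prob_space M' by (rule M')
  have P: "P \<in> carrier_mat s s" and Bs: "B \<subseteq> {0..<s}" using st B by (auto simp: stochastic_mat_def)
  have N: "N \<in> carrier_mat (card B) (card B)"
    unfolding N_def by (rule fundamental_mat_inverse(1)[OF P Bs invertible_mat_restriction[OF st irr B]])
  define c where "c = pick_coefficients B (\<lambda>i j. (submatrix a UNIV B * N) $$ (0, i) * (N * ones (card B)) $$ (j, 0))"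
  let ?Z = "\<lambda>\<omega>. (submatrix a UNIV B * N * submatrix (W \<omega>) B B * N * ones (card B)) $$ (0, 0)"
  let ?Y = "\<lambda>n \<omega>. sqrt (real n) * (est n \<omega> - mean_time a B P)"
  have Z: "?Z \<omega> = (\<Sum>i<s. \<Sum>j<s. c i j * W \<omega> $$ (i, j))" if "\<omega> \<in> space M'" for \<omega>
  proof -
    have "W \<omega> \<in> carrier_mat s s" using W that by (simp add: limit_mat_def gaussian_random_mat_def)
    from sandwich_entry[OF a N Bs this] show ?thesis
      unfolding c_def by (simp only: sum_pick_coefficients[OF Bs])
  qed
  then have distr_Z: "distr M' borel ?Z = distr M' borel (\<lambda>\<omega>. \<Sum>i<s. \<Sum>j<s. c i j * W \<omega> $$ (i, j))"
    by (intro distr_cong) auto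
  have meas: "(\<lambda>\<omega>. \<Sum>i<s. \<Sum>j<s. c i j * W \<omega> $$ (i, j)) \<in> borel_measurable M'"
    using M'.limit_mat_entry_square_integrable(1)[OF W]
    by (intro borel_measurable_sum borel_measurable_times) auto
  have Ym: "random_variable borel (?Y n)" for n
  proof -
    have "random_variable borel (est n)" using est by (simp add: plug_in_estimator_def)
    then show ?thesis by (intro borel_measurable_times borel_measurable_diff borel_measurable_const)
  qed
  show ?thesis
    unfolding distr_Z
  proof (rule levy_continuity)
    show "real_distribution (distr M borel (?Y n))" for n by (rule real_distribution_distr[OF Ym])
    show "real_distribution (distr M' borel (\<lambda>\<omega>. \<Sum>i<s. \<Sum>j<s. c i j * W \<omega> $$ (i, j)))"
      by (rule M'.real_distribution_distr[OF meas])
    fix t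
    have "Characteristic_Functions.char (distr M borel (?Y n)) t = (LINT \<omega>|M. iexp (t * ?Y n \<omega>))" for n
      unfolding Characteristic_Functions.char_def using Ym by (subst integral_distr) auto
    then show "(\<lambda>n. Characteristic_Functions.char (distr M borel (?Y n)) t)
        \<longlonglongrightarrow> Characteristic_Functions.char (distr M' borel (\<lambda>\<omega>. \<Sum>i<s. \<Sum>j<s. c i j * W \<omega> $$ (i, j))) t"
      unfolding M'.limit_mat_functional[OF W]
      using plug_in_characteristic[OF irr stat a B est, of t] by (simp only: c_def N_def)
  qed
qed

theorem proposition11:
  fixes M :: "'w measure" and M' :: "'v measure"
    and s r :: nat and U D :: "nat set"
    and P a \<pi> N\<^sub>U N\<^sub>D a\<^sub>U a\<^sub>D L\<^sub>U L\<^sub>D :: "real mat"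
    and X :: "nat \<Rightarrow> 'w \<Rightarrow> nat" and W :: "'v \<Rightarrow> real mat"
    and mttf_est mttr_est :: "nat \<Rightarrow> 'w \<Rightarrow> real"
    and MTTF MTTR :: real
  assumes "prob_space M" and "prob_space M'"
    and "1 \<le> r" and "r \<le> s - 1" and "U = {0..<r}" and "D = {r..<s}"
    and "stochastic_mat s P" and "irreducible_mat s P"
    and "probability_row s a" and "stationary_row s P \<pi>"
    and "markov_chain M s a P X"
    and "limit_mat M' s P \<pi> W"
    and "N\<^sub>U = fundamental_mat P U" and "N\<^sub>D = fundamental_mat P D"
    and "a\<^sub>U = submatrix a UNIV U" and "a\<^sub>D = submatrix a UNIV D"
    and "MTTF = mean_time a U P" and "MTTR = mean_time a D P"
    and "plug_in_estimator M s X a U mttf_est" and "plug_in_estimator M s X a D mttr_est"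
    and "L\<^sub>U = kronecker (a\<^sub>U * N\<^sub>U) (transpose_mat (ones r) * transpose_mat N\<^sub>U)"
    and "L\<^sub>D = kronecker (a\<^sub>D * N\<^sub>D) (transpose_mat (ones (s - r)) * transpose_mat N\<^sub>D)"
  shows
    "weak_conv_m
       (\<lambda>n. distr M borel (\<lambda>\<omega>. sqrt (real n) * (mttf_est n \<omega> - MTTF)))
       (distr M' borel (\<lambda>\<omega>. (a\<^sub>U * N\<^sub>U * submatrix (W \<omega>) U U * N\<^sub>U * ones r) $$ (0, 0)))
     \<and> prob_space.variance M' (\<lambda>\<omega>. (a\<^sub>U * N\<^sub>U * submatrix (W \<omega>) U U * N\<^sub>U * ones r) $$ (0, 0))
       = (L\<^sub>U * sigma_mat M' W U * transpose_mat L\<^sub>U) $$ (0, 0)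
     \<and> weak_conv_m
       (\<lambda>n. distr M borel (\<lambda>\<omega>. sqrt (real n) * (mttr_est n \<omega> - MTTR)))
       (distr M' borel (\<lambda>\<omega>. (a\<^sub>D * N\<^sub>D * submatrix (W \<omega>) D D * N\<^sub>D * ones (s - r)) $$ (0, 0)))
     \<and> prob_space.variance M' (\<lambda>\<omega>. (a\<^sub>D * N\<^sub>D * submatrix (W \<omega>) D D * N\<^sub>D * ones (s - r)) $$ (0, 0))
       = (L\<^sub>D * sigma_mat M' W D * transpose_mat L\<^sub>D) $$ (0, 0)"
proof -
  have a: "a \<in> carrier_mat 1 s" using \<open>probability_row s a\<close> by (simp add: probability_row_def)
  have P: "P \<in> carrier_mat s s" using \<open>stochastic_mat s P\<close> by (simp add: stochastic_mat_def)
  have "r \<in> {0..<s} - U" "0 \<in> {0..<s} - D" "U \<subseteq> {0..<s}" "D \<subseteq> {0..<s}"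
    using \<open>1 \<le> r\<close> \<open>r \<le> s - 1\<close> \<open>U = {0..<r}\<close> \<open>D = {r..<s}\<close> by auto
  then have U: "U \<subset> {0..<s}" and D: "D \<subset> {0..<s}" by auto
  have card: "card U = r" "card D = s - r" using \<open>U = {0..<r}\<close> \<open>D = {r..<s}\<close> by auto
  note clt = plug_in_clt[OF \<open>prob_space M\<close> \<open>prob_space M'\<close> \<open>stochastic_mat s P\<close> \<open>irreducible_mat s P\<close>
      \<open>stationary_row s P \<pi>\<close> a \<open>markov_chain M s a P X\<close> \<open>limit_mat M' s P \<pi> W\<close>]
  have carrier: "fundamental_mat P B \<in> carrier_mat (card B) (card B)" if "B \<subset> {0..<s}" for B
    using fundamental_mat_inverse(1)[OF P _ invertible_mat_restriction[OF \<open>stochastic_mat s P\<close> \<open>irreducible_mat s P\<close> that]] that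
    by auto
  have var: "prob_space.variance M' (\<lambda>\<omega>. (submatrix a UNIV B * fundamental_mat P B * submatrix (W \<omega>) B B * fundamental_mat P B * ones (card B)) $$ (0, 0))
      = (kronecker (submatrix a UNIV B * fundamental_mat P B) (transpose_mat (ones (card B)) * transpose_mat (fundamental_mat P B))
          * sigma_mat M' W B * transpose_mat (kronecker (submatrix a UNIV B * fundamental_mat P B)
            (transpose_mat (ones (card B)) * transpose_mat (fundamental_mat P B)))) $$ (0, 0)"
    if "B \<subset> {0..<s}" for B
    by (rule sandwich_variance[OF \<open>prob_space M'\<close> \<open>limit_mat M' s P \<pi> W\<close> a carrier[OF that]]) (use that in auto)
  from clt[OF U \<open>plug_in_estimator M s X a U mttf_est\<close>] var[OF U]
    clt[OF D \<open>plug_in_estimator M s X a D mttr_est\<close>] var[OF D]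
  show ?thesis
    unfolding card assms(13-18,21,22) by (intro conjI)
qed

end
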